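(* Let $\mathcal{A}$ be a commutative $C^*$-algebra. The Varopoulos algebra $V_{\mathcal{A}}=\mathcal{A}\otimes_\gamma\mathcal{A}$ is strongly Arens irregular if and only if $\mathcal{A}$ is finite-dimensional.
   Context: $\mathcal{A}\otimes_\gamma\mathcal{A}$ is the projective Banach space tensor product (completion of $\mathcal{A}\otimes\mathcal{A}$ in $\|u\|_\gamma=\inf\{\sum_k\|x_k\|\|y_k\|:u=\sum_kx_k\otimes y_k\}$), a Banach algebra with product determined by $(a\otimes b)(c\otimes d)=ac\otimes bd$. For a Banach algebra $\mathcal{C}$, the left Arens product on $\mathcal{C}^{**}$ is $\langle X\Box Y,f\rangle=\langle X,Y\Box f\rangle$, $\langle Y\Box f,a\rangle=\langle Y,f\Box a\rangle$, $\langle f\Box a,b\rangle=\langle f,ab\rangle$ for $X,Y\in\mathcal{C}^{**}$, $f\in\mathcal{C}^*$, $a,b\in\mathcal{C}$. The (left) topological centre $Z_t(\mathcal{C}^{**})$ is the set of $X\in\mathcal{C}^{**}$ such that $Y\mapsto X\Box Y$ is $w^*$-$w^*$-continuous on $\mathcal{C}^{**}$; for commutative $\mathcal{C}$ it equals the centre of $(\mathcal{C}^{**},\Box)$. $\mathcal{C}$ is (left) strongly Arens irregular if $Z_t(\mathcal{C}^{**})=\mathcal{C}$ (canonically embedded in $\mathcal{C}^{**}$). *)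

theory Defs
  imports "HOL-Analysis.Analysis" "HOL-Library.Multiset"
begin

section \<open>Complex Banach algebras and \<open>C\<^sup>*\<close>-algebras\<close>

class scaleC =
  fixes scaleC :: "complex \<Rightarrow> 'a \<Rightarrow> 'a" (infixr \<open>*\<^sub>C\<close> 75)

class complex_vector = real_vector + scaleC +
  assumes scaleC_add_right: "c *\<^sub>C (x + y) = c *\<^sub>C x + c *\<^sub>C y"
    and scaleC_add_left: "(c + d) *\<^sub>C x = c *\<^sub>C x + d *\<^sub>C x"
    and scaleC_scaleC: "c *\<^sub>C (d *\<^sub>C x) = (c * d) *\<^sub>C x"
    and scaleR_scaleC: "r *\<^sub>R x = complex_of_real r *\<^sub>C x"
begin

lemma scaleC_one: "1 *\<^sub>C x = x"
  using scaleR_scaleC[of 1 x] scaleR_one[of x] by (simp only: of_real_1)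

end

global_interpretation complex_vector: vector_space "scaleC :: complex \<Rightarrow> 'a \<Rightarrow> 'a::complex_vector"
  by unfold_locales (rule scaleC_add_right scaleC_add_left scaleC_scaleC scaleC_one)+

class complex_algebra = complex_vector + ring +
  assumes mult_scaleC_left: "(c *\<^sub>C x) * y = c *\<^sub>C (x * y)"
    and mult_scaleC_right: "x * (c *\<^sub>C y) = c *\<^sub>C (x * y)"
begin

subclass real_algebra
  by standard (simp_all add: scaleR_scaleC mult_scaleC_left mult_scaleC_right)

end

class complex_normed_vector = complex_vector + real_normed_vector +
  assumes norm_scaleC: "norm (c *\<^sub>C x) = cmod c * norm x"

class complex_normed_algebra = complex_algebra + complex_normed_vector +
  assumes norm_mult_le: "norm (x * y) \<le> norm x * norm y"
begin

subclass real_normed_algebra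
  by standard (rule norm_mult_le)

end

class complex_banach_algebra = complex_normed_algebra + banach

text \<open>Neither a unit nor non-triviality is required.\<close>

class cstar_algebra = complex_banach_algebra +
  fixes star :: "'a \<Rightarrow> 'a"
  assumes star_star: "star (star x) = x"
    and star_add: "star (x + y) = star x + star y"
    and star_scaleC: "star (c *\<^sub>C x) = cnj c *\<^sub>C star x"
    and star_mult: "star (x * y) = star y * star x"
    and norm_star_mult_self: "norm (star x * x) = norm x ^ 2"

class commutative_cstar_algebra = cstar_algebra + comm_ring

definition finite_dimensional :: "'a::complex_vector itself \<Rightarrow> bool" where
  "finite_dimensional _ \<longleftrightarrow> (\<exists>B :: 'a set. finite B \<and> complex_vector.span B = UNIV)"


section \<open>The Banach space dual\<close>

typedef (overloaded) ('a::complex_normed_vector) cdual =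
  "{f :: 'a \<Rightarrow>\<^sub>L complex. \<forall>c x. blinfun_apply f (c *\<^sub>C x) = c * blinfun_apply f x}"
  morphisms cdual_blinfun Abs_cdual
  by (rule exI[of _ 0]) simp

setup_lifting type_definition_cdual

lift_definition cdual_apply :: "'a::complex_normed_vector cdual \<Rightarrow> 'a \<Rightarrow> complex"
  is blinfun_apply .

instantiation cdual :: (complex_normed_vector) complex_normed_vector
begin

lift_definition zero_cdual :: "'a cdual" is 0 by simp
lift_definition plus_cdual :: "'a cdual \<Rightarrow> 'a cdual \<Rightarrow> 'a cdual" is "(+)"
  by (simp add: blinfun.bilinear_simps algebra_simps)
lift_definition minus_cdual :: "'a cdual \<Rightarrow> 'a cdual \<Rightarrow> 'a cdual" is "(-)"
  by (simp add: blinfun.bilinear_simps algebra_simps)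
lift_definition uminus_cdual :: "'a cdual \<Rightarrow> 'a cdual" is uminus
  by (simp add: blinfun.bilinear_simps)
lift_definition scaleR_cdual :: "real \<Rightarrow> 'a cdual \<Rightarrow> 'a cdual" is scaleR
  by (simp add: blinfun.bilinear_simps)
lift_definition scaleC_cdual :: "complex \<Rightarrow> 'a cdual \<Rightarrow> 'a cdual"
  is "\<lambda>c f. blinfun_mult_right c o\<^sub>L f"
  by simp
lift_definition norm_cdual :: "'a cdual \<Rightarrow> real" is norm .
definition "sgn (f :: 'a cdual) = inverse (norm f) *\<^sub>R f"
definition "dist (f :: 'a cdual) g = norm (f - g)"
definition [code del]:
  "(uniformity :: ('a cdual \<times> 'a cdual) filter) = (INF e\<in>{0<..}. principal {(x, y). dist x y < e})"
definition [code del]: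
  "open (U :: 'a cdual set) \<longleftrightarrow> (\<forall>x\<in>U. eventually (\<lambda>(x', y). x' = x \<longrightarrow> y \<in> U) uniformity)"

instance
proof
  fix f g h :: "'a cdual" and r s :: real and c d :: complex
  show "f + g + h = f + (g + h)" "f + g = g + f" "0 + f = f" "- f + f = 0" "f - g = f + - g"
    "r *\<^sub>R (f + g) = r *\<^sub>R f + r *\<^sub>R g" "(r + s) *\<^sub>R f = r *\<^sub>R f + s *\<^sub>R f"
    "r *\<^sub>R s *\<^sub>R f = (r * s) *\<^sub>R f" "1 *\<^sub>R f = f"
    "(norm f = 0) = (f = 0)" "norm (f + g) \<le> norm f + norm g"
    "norm (r *\<^sub>R f) = \<bar>r\<bar> * norm f"
    by (transfer; simp add: algebra_simps norm_triangle_ineq)+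
  show "c *\<^sub>C (f + g) = c *\<^sub>C f + c *\<^sub>C g" "(c + d) *\<^sub>C f = c *\<^sub>C f + d *\<^sub>C f"
    "c *\<^sub>C d *\<^sub>C f = (c * d) *\<^sub>C f" "r *\<^sub>R f = complex_of_real r *\<^sub>C f"
    by (transfer; rule blinfun_eqI; simp add: blinfun.bilinear_simps algebra_simps scaleR_conv_of_real)+
  have le: "norm (b *\<^sub>C k) \<le> cmod b * norm k" for b and k :: "'a cdual"
  proof transfer
    fix b and k :: "'a \<Rightarrow>\<^sub>L complex"
    show "norm (blinfun_mult_right b o\<^sub>L k) \<le> cmod b * norm k"
    proof (rule norm_blinfun_bound)
      show "norm (blinfun_apply (blinfun_mult_right b o\<^sub>L k) x) \<le> cmod b * norm k * norm x" for x
        using mult_left_mono[OF norm_blinfun[of k x], of "cmod b"] by (simp add: norm_mult mult.assoc)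
    qed simp
  qed
  show "norm (c *\<^sub>C f) = cmod c * norm f"
  proof (cases "c = 0")
    case True
    then show ?thesis using le[of c f] by (simp add: \<open>(norm f = 0) = (f = 0)\<close>) 
        (transfer, simp)
  next
    case False
    have "inverse c *\<^sub>C c *\<^sub>C f = f"
      using False by (transfer, intro blinfun_eqI) (simp add: mult.assoc[symmetric])
    then have "norm f \<le> cmod (inverse c) * norm (c *\<^sub>C f)"
      using le[of "inverse c" "c *\<^sub>C f"] by simp
    then have "cmod c * norm f \<le> norm (c *\<^sub>C f)"
      using False by (simp add: norm_divide field_simps)
    then show ?thesis using le[of c f] by simp
  qed
qed (simp_all add: sgn_cdual_def dist_cdual_def uniformity_cdual_def open_cdual_def)

end

lemma cdual_apply_add: "cdual_apply f (x + y) = cdual_apply f x + cdual_apply f y"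
  by transfer (simp add: blinfun.bilinear_simps)

lemma cdual_apply_scaleC: "cdual_apply f (c *\<^sub>C x) = c * cdual_apply f x"
  by transfer simp

lemma norm_cdual_apply: "cmod (cdual_apply f x) \<le> norm f * norm x"
  by transfer (rule norm_blinfun)

lemma cdual_apply_simps:
  "cdual_apply (f + g) x = cdual_apply f x + cdual_apply g x"
  "cdual_apply (c *\<^sub>C f) x = c * cdual_apply f x"
  by (transfer; simp add: blinfun.bilinear_simps)+

lemma cdual_eqI: "(\<And>x. cdual_apply f x = cdual_apply g x) \<Longrightarrow> f = g"
  by transfer (rule blinfun_eqI)

lemma norm_cdual_bound:
  "0 \<le> K \<Longrightarrow> (\<And>x. cmod (cdual_apply f x) \<le> K * norm x) \<Longrightarrow> norm f \<le> K"
  by transfer (rule norm_blinfun_bound)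

text \<open>Meaningful only for bounded complex-linear \<open>f\<close>; see \<open>cdual_apply_cdual_of\<close>.\<close>

definition cdual_of :: "('a::complex_normed_vector \<Rightarrow> complex) \<Rightarrow> 'a cdual" where
  "cdual_of f = Abs_cdual (Blinfun f)"

lemma cdual_apply_cdual_of:
  assumes add: "\<And>x y. f (x + y) = f x + f y" and scale: "\<And>c x. f (c *\<^sub>C x) = c * f x"
    and bound: "\<And>x. cmod (f x) \<le> K * norm x"
  shows "cdual_apply (cdual_of f) x = f x"
proof -
  have "bounded_linear f"
    by (rule bounded_linear_intro[of _ K])
      (simp_all add: add scale scaleR_scaleC bound mult.commute[of _ K] scaleR_conv_of_real)
  then have "blinfun_apply (Blinfun f) = f"
    by (rule bounded_linear_Blinfun_apply)
  then show ?thesis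
    by (simp add: cdual_of_def cdual_apply.rep_eq Abs_cdual_inverse scale)
qed

lemma norm_cdual_of:
  assumes "\<And>x y. f (x + y) = f x + f y" and "\<And>c x. f (c *\<^sub>C x) = c * f x"
    and "\<And>x. cmod (f x) \<le> K * norm x" and "0 \<le> K"
  shows "norm (cdual_of f) \<le> K"
  using assms by (intro norm_cdual_bound) (simp_all add: cdual_apply_cdual_of[of f K])

definition weak_star_topology :: "'a::complex_normed_vector cdual topology" where
  "weak_star_topology =
    pullback_topology UNIV cdual_apply (product_topology (\<lambda>_. euclidean) UNIV)"


section \<open>The left Arens product and the topological centre\<close>

definition bidual_embed :: "'a::complex_normed_vector \<Rightarrow> 'a cdual cdual" where
  "bidual_embed a = cdual_of (\<lambda>f. cdual_apply f a)"

definition functional_box :: "'a::complex_normed_algebra cdual \<Rightarrow> 'a \<Rightarrow> 'a cdual" where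
  "functional_box f a = cdual_of (\<lambda>b. cdual_apply f (a * b))"

definition bidual_box :: "'a::complex_normed_algebra cdual cdual \<Rightarrow> 'a cdual \<Rightarrow> 'a cdual" where
  "bidual_box Y f = cdual_of (\<lambda>a. cdual_apply Y (functional_box f a))"

definition arens :: "'a::complex_normed_algebra cdual cdual \<Rightarrow> 'a cdual cdual \<Rightarrow> 'a cdual cdual"
    (infixl \<open>\<box>\<close> 70) where
  "X \<box> Y = cdual_of (\<lambda>f. cdual_apply X (bidual_box Y f))"

lemma cdual_apply_bidual_embed: "cdual_apply (bidual_embed a) f = cdual_apply f a"
  unfolding bidual_embed_def
  by (rule cdual_apply_cdual_of[where K = "norm a"])
    (simp_all add: cdual_apply_simps norm_cdual_apply mult.commute[of "norm a"])

lemma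
  shows cdual_apply_functional_box: "cdual_apply (functional_box f a) b = cdual_apply f (a * b)"
    and norm_functional_box: "norm (functional_box f a) \<le> norm f * norm a"
proof -
  have *: "cmod (cdual_apply f (a * b)) \<le> norm f * norm a * norm b" for b
    using norm_cdual_apply[of f "a * b"] mult_left_mono[OF norm_mult_le[of a b], of "norm f"]
    by (simp add: mult.assoc)
  show "cdual_apply (functional_box f a) b = cdual_apply f (a * b)"
    unfolding functional_box_def
    by (rule cdual_apply_cdual_of[OF _ _ *])
      (simp_all add: distrib_left cdual_apply_add mult_scaleC_right cdual_apply_scaleC)
  show "norm (functional_box f a) \<le> norm f * norm a"
    unfolding functional_box_def
    by (rule norm_cdual_of[OF _ _ *])
      (simp_all add: distrib_left cdual_apply_add mult_scaleC_right cdual_apply_scaleC)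
qed

lemma functional_box_linear:
  "functional_box (f + g) a = functional_box f a + functional_box g a"
  "functional_box (c *\<^sub>C f) a = c *\<^sub>C functional_box f a"
  "functional_box f (a + b) = functional_box f a + functional_box f b"
  "functional_box f (c *\<^sub>C a) = c *\<^sub>C functional_box f a"
  by (rule cdual_eqI, simp add: cdual_apply_functional_box cdual_apply_simps distrib_right
      cdual_apply_add mult_scaleC_left cdual_apply_scaleC)+

lemma
  shows cdual_apply_bidual_box: "cdual_apply (bidual_box Y f) a = cdual_apply Y (functional_box f a)"
    and norm_bidual_box: "norm (bidual_box Y f) \<le> norm Y * norm f"
proof -
  have *: "cmod (cdual_apply Y (functional_box f a)) \<le> norm Y * norm f * norm a" for a
    using norm_cdual_apply[of Y "functional_box f a"]
      mult_left_mono[OF norm_functional_box[of f a], of "norm Y"]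
    by (simp add: mult.assoc)
  show "cdual_apply (bidual_box Y f) a = cdual_apply Y (functional_box f a)"
    unfolding bidual_box_def
    by (rule cdual_apply_cdual_of[OF _ _ *])
      (simp_all add: functional_box_linear cdual_apply_add cdual_apply_scaleC)
  show "norm (bidual_box Y f) \<le> norm Y * norm f"
    unfolding bidual_box_def
    by (rule norm_cdual_of[OF _ _ *])
      (simp_all add: functional_box_linear cdual_apply_add cdual_apply_scaleC)
qed

lemma bidual_box_linear:
  "bidual_box Y (f + g) = bidual_box Y f + bidual_box Y g"
  "bidual_box Y (c *\<^sub>C f) = c *\<^sub>C bidual_box Y f"
  by (rule cdual_eqI, simp add: cdual_apply_bidual_box cdual_apply_simps functional_box_linear
      cdual_apply_add cdual_apply_scaleC)+

lemma
  shows cdual_apply_arens: "cdual_apply (X \<box> Y) f = cdual_apply X (bidual_box Y f)"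
    and norm_arens: "norm (X \<box> Y) \<le> norm X * norm Y"
proof -
  have *: "cmod (cdual_apply X (bidual_box Y f)) \<le> norm X * norm Y * norm f" for f
    using norm_cdual_apply[of X "bidual_box Y f"]
      mult_left_mono[OF norm_bidual_box[of Y f], of "norm X"]
    by (simp add: mult.assoc)
  show "cdual_apply (X \<box> Y) f = cdual_apply X (bidual_box Y f)"
    unfolding arens_def
    by (rule cdual_apply_cdual_of[OF _ _ *])
      (simp_all add: bidual_box_linear cdual_apply_add cdual_apply_scaleC)
  show "norm (X \<box> Y) \<le> norm X * norm Y"
    unfolding arens_def
    by (rule norm_cdual_of[OF _ _ *])
      (simp_all add: bidual_box_linear cdual_apply_add cdual_apply_scaleC)
qed

definition topological_centre :: "'a::complex_normed_algebra cdual cdual set" where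
  "topological_centre =
    {X. continuous_map weak_star_topology weak_star_topology (\<lambda>Y. X \<box> Y)}"

definition strongly_Arens_irregular :: "'a::complex_banach_algebra itself \<Rightarrow> bool" where
  "strongly_Arens_irregular _ \<longleftrightarrow>
    (topological_centre :: 'a cdual cdual set) = range bidual_embed"


section \<open>The algebraic tensor product\<close>

text \<open>
  A multiset \<open>{#(x\<^sub>1, y\<^sub>1), \<dots>, (x\<^sub>n, y\<^sub>n)#}\<close> stands for the formal sum
  \<open>x\<^sub>1 \<otimes> y\<^sub>1 + \<dots> + x\<^sub>n \<otimes> y\<^sub>n\<close>; the tensor product is the quotient by the congruence generated by
  bilinearity.
\<close>

inductive tensor_eq ::
  "('a::complex_vector \<times> 'b::complex_vector) multiset \<Rightarrow> ('a \<times> 'b) multiset \<Rightarrow> bool" where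
  refl: "tensor_eq M M"
| sym: "tensor_eq M N \<Longrightarrow> tensor_eq N M"
| trans: "tensor_eq M N \<Longrightarrow> tensor_eq N K \<Longrightarrow> tensor_eq M K"
| add: "tensor_eq M M' \<Longrightarrow> tensor_eq N N' \<Longrightarrow> tensor_eq (M + N) (M' + N')"
| zero: "tensor_eq {#(0, y)#} {#}"
| add_left: "tensor_eq {#(x + x', y)#} {#(x, y), (x', y)#}"
| add_right: "tensor_eq {#(x, y + y')#} {#(x, y), (x, y')#}"
| scale: "tensor_eq {#(c *\<^sub>C x, y)#} {#(x, c *\<^sub>C y)#}"

quotient_type (overloaded) ('a, 'b) tensor =
  "('a::complex_vector \<times> 'b::complex_vector) multiset" / tensor_eq
  by (intro equivpI reflpI sympI transpI) (blast intro: tensor_eq.intros)+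

lift_definition elem_tensor :: "'a::complex_vector \<Rightarrow> 'b::complex_vector \<Rightarrow> ('a, 'b) tensor"
  is "\<lambda>x y. {#(x, y)#}" .


instantiation tensor :: (complex_vector, complex_vector) complex_vector
begin

lift_definition zero_tensor :: "('a, 'b) tensor" is "{#}" .
lift_definition plus_tensor :: "('a, 'b) tensor \<Rightarrow> ('a, 'b) tensor \<Rightarrow> ('a, 'b) tensor" is "(+)"
  by (rule tensor_eq.add)
lift_definition scaleC_tensor :: "complex \<Rightarrow> ('a, 'b) tensor \<Rightarrow> ('a, 'b) tensor"
  is "\<lambda>c. image_mset (\<lambda>(x, y). (c *\<^sub>C x, y))"
proof -
  fix c and M N :: "('a \<times> 'b) multiset"
  assume "tensor_eq M N"
  then show "tensor_eq (image_mset (\<lambda>(x, y). (c *\<^sub>C x, y)) M) (image_mset (\<lambda>(x, y). (c *\<^sub>C x, y)) N)"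
  proof induction
    case (scale d x y)
    show ?case using tensor_eq.scale[of d "c *\<^sub>C x" y]
      by (simp add: scaleC_scaleC mult.commute)
  qed (auto simp: scaleC_add_right intro: tensor_eq.intros)
qed
definition "uminus (u :: ('a, 'b) tensor) = (-1) *\<^sub>C u"
definition "(u :: ('a, 'b) tensor) - v = u + - v"
definition "r *\<^sub>R (u :: ('a, 'b) tensor) = complex_of_real r *\<^sub>C u"

instance
proof
  fix u v w :: "('a, 'b) tensor" and r s :: real and c d :: complex
  show add: "u + v + w = u + (v + w)" "u + v = v + u" "0 + u = u"
    by (transfer; simp add: ac_simps tensor_eq.refl)+
  show distR: "c *\<^sub>C (u + v) = c *\<^sub>C u + c *\<^sub>C v" for c and u v :: "('a, 'b) tensor"
    by (transfer; simp add: tensor_eq.refl)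
  show assoc: "c *\<^sub>C d *\<^sub>C u = (c * d) *\<^sub>C u" for c d
    by transfer (simp add: multiset.map_comp o_def case_prod_unfold scaleC_scaleC tensor_eq.refl)
  have one: "1 *\<^sub>C u = u"
    by transfer (simp add: scaleC_one case_prod_unfold tensor_eq.refl)
  show distL: "(c + d) *\<^sub>C u = c *\<^sub>C u + d *\<^sub>C u" for c d
  proof transfer
    fix c d and M :: "('a \<times> 'b) multiset"
    show "tensor_eq (image_mset (\<lambda>(x, y). ((c + d) *\<^sub>C x, y)) M)
      (image_mset (\<lambda>(x, y). (c *\<^sub>C x, y)) M + image_mset (\<lambda>(x, y). (d *\<^sub>C x, y)) M)"
    proof (induction M)
      case (add p M)
      obtain x y where p: "p = (x, y)" by (cases p)
      show ?case
        using tensor_eq.add[OF tensor_eq.add_left[of "c *\<^sub>C x" "d *\<^sub>C x" y] add]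
        by (simp add: p scaleC_add_left add_mset_commute)
    qed (simp add: tensor_eq.refl)
  qed
  have zero: "0 *\<^sub>C u = 0"
  proof transfer
    fix M :: "('a \<times> 'b) multiset"
    show "tensor_eq (image_mset (\<lambda>(x, y). (0 *\<^sub>C x, y)) M) {#}"
    proof (induction M)
      case (add p M)
      then show ?case
        using tensor_eq.add[OF tensor_eq.zero[of "snd p"] add]
        by (simp add: case_prod_unfold)
    qed (simp add: tensor_eq.refl)
  qed
  show "- u + u = 0"
    using distL[of "-1" 1] one zero by (simp add: uminus_tensor_def)
  show "u - v = u + - v" by (rule minus_tensor_def)
  show "r *\<^sub>R u = complex_of_real r *\<^sub>C u" by (rule scaleR_tensor_def)
  show "r *\<^sub>R (u + v) = r *\<^sub>R u + r *\<^sub>R v" "(r + s) *\<^sub>R u = r *\<^sub>R u + s *\<^sub>R u"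
    "r *\<^sub>R s *\<^sub>R u = (r * s) *\<^sub>R u" "1 *\<^sub>R u = u"
    by (simp_all add: scaleR_tensor_def distL distR assoc one)
qed

end

lemma elem_tensor_add_left: "elem_tensor (x + x') y = elem_tensor x y + elem_tensor x' y"
  by transfer (use tensor_eq.add_left in \<open>simp add: add_mset_commute\<close>)

lemma elem_tensor_add_right: "elem_tensor x (y + y') = elem_tensor x y + elem_tensor x y'"
  by transfer (use tensor_eq.add_right in \<open>simp add: add_mset_commute\<close>)

lemma elem_tensor_scaleC_left: "elem_tensor (c *\<^sub>C x) y = c *\<^sub>C elem_tensor x y"
  by transfer (simp add: tensor_eq.refl)

lemma elem_tensor_scaleC_right: "elem_tensor x (c *\<^sub>C y) = c *\<^sub>C elem_tensor x y"
  by transfer (simp add: tensor_eq.scale tensor_eq.sym)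

lemma tensor_induct [case_names zero elem add]:
  assumes "P 0" "\<And>x y. P (elem_tensor x y)" "\<And>u v. P u \<Longrightarrow> P v \<Longrightarrow> P (u + v)"
  shows "P u"
proof (induction u rule: tensor.abs_induct)
  case (1 M)
  show ?case
  proof (induction M)
    case empty
    then show ?case using assms(1) by (simp add: zero_tensor_def)
  next
    case (add p M)
    have "abs_tensor (add_mset p M) = elem_tensor (fst p) (snd p) + abs_tensor M"
      by (simp add: plus_tensor.abs_eq elem_tensor_def)
    then show ?case using assms(2,3) add by simp
  qed
qed

definition multiset_times ::
  "('a::complex_algebra \<times> 'b::complex_algebra) multiset \<Rightarrow> ('a \<times> 'b) multiset \<Rightarrow> ('a \<times> 'b) multiset"
  where "multiset_times M N = (\<Sum>(a, b)\<in>#M. image_mset (\<lambda>(c, d). (a * c, b * d)) N)"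

lemma multiset_times_simps:
  "multiset_times {#} N = {#}" "multiset_times M {#} = {#}"
  "multiset_times (M + M') N = multiset_times M N + multiset_times M' N"
  "multiset_times M (N + N') = multiset_times M N + multiset_times M N'"
  "multiset_times {#(a, b)#} {#(c, d)#} = {#(a * c, b * d)#}"
  by (auto simp: multiset_times_def case_prod_unfold sum_mset.distrib[symmetric])

lemma tensor_eq_times_left:
  assumes "tensor_eq M M'"
  shows "tensor_eq (multiset_times M N) (multiset_times M' N)"
proof (induction N)
  case (add q N)
  obtain c d where q: "q = (c, d)" by (cases q)
  from assms have "tensor_eq (multiset_times M {#q#}) (multiset_times M' {#q#})"
  proof induction
    case (zero y)
    then show ?case using tensor_eq.zero[of "y * d"] by (simp add: multiset_times_def q)
  next
    case (add_left x x' y)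
    then show ?case using tensor_eq.add_left[of "x * c" "x' * c" "y * d"]
      by (simp add: multiset_times_def q distrib_right add_mset_commute)
  next
    case (add_right x y y')
    then show ?case using tensor_eq.add_right[of "x * c" "y * d" "y' * d"]
      by (simp add: multiset_times_def q distrib_right add_mset_commute)
  next
    case (scale k x y)
    then show ?case using tensor_eq.scale[of k "x * c" "y * d"]
      by (simp add: multiset_times_def q mult_scaleC_left)
  qed (auto simp: multiset_times_simps(3) intro: tensor_eq.intros)
  with add show ?case
    using multiset_times_simps(4)[of _ "{#q#}" N] by (simp add: tensor_eq.add)
qed (simp add: multiset_times_simps tensor_eq.refl)

lemma tensor_eq_times_right:
  assumes "tensor_eq N N'"
  shows "tensor_eq (multiset_times M N) (multiset_times M N')"
proof (induction M)
  case (add q M)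
  obtain c d where q: "q = (c, d)" by (cases q)
  from assms have "tensor_eq (multiset_times {#q#} N) (multiset_times {#q#} N')"
  proof induction
    case (zero y)
    then show ?case using tensor_eq.zero[of "d * y"] by (simp add: multiset_times_def q)
  next
    case (add_left x x' y)
    then show ?case using tensor_eq.add_left[of "c * x" "c * x'" "d * y"]
      by (simp add: multiset_times_def q distrib_left add_mset_commute)
  next
    case (add_right x y y')
    then show ?case using tensor_eq.add_right[of "c * x" "d * y" "d * y'"]
      by (simp add: multiset_times_def q distrib_left add_mset_commute)
  next
    case (scale k x y)
    then show ?case using tensor_eq.scale[of k "c * x" "d * y"]
      by (simp add: multiset_times_def q mult_scaleC_right)
  qed (auto simp: multiset_times_simps(4) intro: tensor_eq.intros)
  with add show ?case
    using multiset_times_simps(3)[of "{#q#}" M] by (simp add: tensor_eq.add)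
qed (simp add: multiset_times_simps tensor_eq.refl)

instantiation tensor :: (complex_algebra, complex_algebra) complex_algebra
begin

lift_definition times_tensor :: "('a, 'b) tensor \<Rightarrow> ('a, 'b) tensor \<Rightarrow> ('a, 'b) tensor"
  is multiset_times
  by (blast intro: tensor_eq.trans tensor_eq_times_left tensor_eq_times_right)

instance
proof
  fix u v w :: "('a, 'b) tensor" and c :: complex
  show distl: "(u + v) * w = u * w + v * w" for u v w :: "('a, 'b) tensor"
    by transfer (simp add: multiset_times_simps(3) tensor_eq.refl)
  show distr: "u * (v + w) = u * v + u * w" for u v w :: "('a, 'b) tensor"
    by transfer (simp add: multiset_times_simps(4) tensor_eq.refl)
  have zero: "0 * u = 0" "u * 0 = 0" for u :: "('a, 'b) tensor"
    by (transfer; simp add: multiset_times_simps tensor_eq.refl)+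
  have times_elem: "elem_tensor a b * elem_tensor c d = elem_tensor (a * c) (b * d)"
    for a c :: 'a and b d :: 'b
    by transfer (simp add: multiset_times_simps tensor_eq.refl)
  show "u * v * w = u * (v * w)"
  proof (induction u rule: tensor_induct)
    case (elem a b)
    show ?case
    proof (induction v rule: tensor_induct)
      case (elem c d)
      show ?case
        by (induction w rule: tensor_induct)
          (simp_all add: zero distl distr mult.assoc times_elem)
    qed (simp_all add: zero distl distr)
  qed (simp_all add: zero distl distr)
  show "c *\<^sub>C u * v = c *\<^sub>C (u * v)"
  proof (induction u rule: tensor_induct)
    case (elem a b)
    show ?case
      by (induction v rule: tensor_induct)
        (simp_all add: zero distr scaleC_add_right elem_tensor_scaleC_left[symmetric] mult_scaleC_left times_elem)
  qed (simp_all add: zero distl scaleC_add_right)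
  show "u * c *\<^sub>C v = c *\<^sub>C (u * v)"
  proof (induction u rule: tensor_induct)
    case (elem a b)
    show ?case
      by (induction v rule: tensor_induct)
        (simp_all add: zero distr scaleC_add_right elem_tensor_scaleC_left[symmetric] mult_scaleC_right times_elem)
  qed (simp_all add: zero distl scaleC_add_right)
qed

end

lemma elem_tensor_mult: "elem_tensor a b * elem_tensor c d = elem_tensor (a * c) (b * d)"
  by transfer (simp add: multiset_times_simps tensor_eq.refl)


lifting_update tensor.lifting
lifting_forget tensor.lifting


section \<open>The projective tensor product\<close>

definition proj_norm :: "('a::complex_normed_vector, 'b::complex_normed_vector) tensor \<Rightarrow> real" where
  "proj_norm u =
    (INF M\<in>{M. u = (\<Sum>(x, y)\<in>#M. elem_tensor x y)}. \<Sum>(x, y)\<in>#M. norm x * norm y)"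

lemma tensor_representation: "\<exists>M. u = (\<Sum>(x, y)\<in>#M. elem_tensor x y)"
proof (induction u rule: tensor_induct)
  case zero
  show ?case by (rule exI[of _ "{#}"]) simp
next
  case (elem x y)
  show ?case by (rule exI[of _ "{#(x, y)#}"]) simp
next
  case (add u v)
  then obtain M N where "u = (\<Sum>(x, y)\<in>#M. elem_tensor x y)" "v = (\<Sum>(x, y)\<in>#N. elem_tensor x y)"
    by blast
  then have "u + v = (\<Sum>(x, y)\<in>#M + N. elem_tensor x y)"
    by (simp only: image_mset_union sum_mset.union)
  then show ?case by blast
qed

lemma rep_norm_nonneg:
  "0 \<le> (\<Sum>(x, y)\<in>#M. norm (x::'a::real_normed_vector) * norm (y::'b::real_normed_vector))"
proof (induction M)
  case (add p M)
  then show ?case by (cases p) (simp only: image_mset_add_mset sum_mset.add_mset prod.case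
    add_nonneg_nonneg mult_nonneg_nonneg norm_ge_zero)
qed simp

lemma rep_norm_bdd_below:
  "bdd_below ((\<lambda>M. \<Sum>(x, y)\<in>#M. norm (x::'a::real_normed_vector) * norm (y::'b::real_normed_vector)) ` S)"
  by (rule bdd_belowI2) (rule rep_norm_nonneg)

lemma proj_norm_le: "proj_norm (\<Sum>(x, y)\<in>#M. elem_tensor x y) \<le> (\<Sum>(x, y)\<in>#M. norm x * norm y)"
  unfolding proj_norm_def by (rule cINF_lower[OF rep_norm_bdd_below]) simp

lemma proj_norm_approx:
  assumes "e > 0"
  obtains M where "u = (\<Sum>(x, y)\<in>#M. elem_tensor x y)" "(\<Sum>(x, y)\<in>#M. norm x * norm y) < proj_norm u + e"
proof -
  have "(\<lambda>M. \<Sum>(x, y)\<in>#M. norm x * norm y) ` {M. u = (\<Sum>(x, y)\<in>#M. elem_tensor x y)} \<noteq> {}"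
    using tensor_representation[of u] by blast
  moreover have "(INF M\<in>{M. u = (\<Sum>(x, y)\<in>#M. elem_tensor x y)}. \<Sum>(x, y)\<in>#M. norm x * norm y) < proj_norm u + e"
    unfolding proj_norm_def[symmetric] using assms by (rule less_add_same_cancel1[THEN iffD2])
  ultimately have "\<exists>r\<in>(\<lambda>M. \<Sum>(x, y)\<in>#M. norm x * norm y) ` {M. u = (\<Sum>(x, y)\<in>#M. elem_tensor x y)}.
      r < proj_norm u + e"
    by (rule cInf_lessD)
  then show ?thesis using that by blast
qed

lemma proj_norm_nonneg: "0 \<le> proj_norm u"
  unfolding proj_norm_def
proof (rule cINF_greatest)
  show "{M. u = (\<Sum>(x, y)\<in>#M. elem_tensor x y)} \<noteq> {}"
    using tensor_representation[of u] by blast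
qed (rule rep_norm_nonneg)

lemma proj_norm_zero: "proj_norm (0 :: ('a::complex_normed_vector, 'b::complex_normed_vector) tensor) = 0"
  using proj_norm_le[of "{#} :: ('a \<times> 'b) multiset"]
    proj_norm_nonneg[of "0 :: ('a, 'b) tensor"] by simp

lemma proj_norm_elem: "proj_norm (elem_tensor x y) \<le> norm x * norm y"
  using proj_norm_le[of "{#(x, y)#}"] by simp

lemma proj_norm_triangle: "proj_norm (u + v) \<le> proj_norm u + proj_norm v"
proof (rule field_le_epsilon)
  fix e :: real assume "e > 0"
  then have e: "e / 2 > 0" by simp
  obtain M where M: "u = (\<Sum>(x, y)\<in>#M. elem_tensor x y)" "(\<Sum>(x, y)\<in>#M. norm x * norm y) < proj_norm u + e / 2"
    using proj_norm_approx[OF e] .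
  obtain N where N: "v = (\<Sum>(x, y)\<in>#N. elem_tensor x y)" "(\<Sum>(x, y)\<in>#N. norm x * norm y) < proj_norm v + e / 2"
    using proj_norm_approx[OF e] .
  have "u + v = (\<Sum>(x, y)\<in>#M + N. elem_tensor x y)" using M(1) N(1) by simp
  then have "proj_norm (u + v) \<le> (\<Sum>(x, y)\<in>#M + N. norm x * norm y)"
    using proj_norm_le[of "M + N"] by simp
  then show "proj_norm (u + v) \<le> proj_norm u + proj_norm v + e"
    using M(2) N(2) by simp
qed

lemma small_factor:
  fixes k e :: real
  assumes "k \<ge> 0" "e > 0"
  obtains d where "d > 0" "k * d \<le> e"
proof (cases "k = 0")
  case True
  then show ?thesis using that[of 1] assms by simp
next
  case False
  then show ?thesis using that[of "e / k"] assms by simp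
qed

lemma proj_norm_scaleC: "proj_norm (c *\<^sub>C u) = cmod c * proj_norm u"
proof -
  have le: "proj_norm (c *\<^sub>C u) \<le> cmod c * proj_norm u"
    for c and u :: "('a, 'b) tensor"
  proof (rule field_le_epsilon)
    fix e :: real assume e: "e > 0"
    obtain d where d: "d > 0" and cd: "cmod c * d \<le> e"
      using small_factor[OF norm_ge_zero e] .
    obtain M where M: "u = (\<Sum>(x, y)\<in>#M. elem_tensor x y)" "(\<Sum>(x, y)\<in>#M. norm x * norm y) < proj_norm u + d"
      using proj_norm_approx[OF d] .
    define N where "N = image_mset (\<lambda>(x, y). (c *\<^sub>C x, y)) M"
    have N1: "c *\<^sub>C (\<Sum>(x, y)\<in>#M. elem_tensor x y) = (\<Sum>(x, y)\<in>#N. elem_tensor x y)"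
      unfolding N_def
    proof (induction M)
      case (add p M)
      then show ?case
        by (cases p) (simp only: image_mset_add_mset sum_mset.add_mset prod.case scaleC_add_right
            elem_tensor_scaleC_left)
    qed (simp add: complex_vector.scale_zero_right)
    have N2: "(\<Sum>(x, y)\<in>#N. norm x * norm y) = cmod c * (\<Sum>(x, y)\<in>#M. norm x * norm y)"
      unfolding N_def
    proof (induction M)
      case (add p M)
      then show ?case
        by (cases p) (simp only: image_mset_add_mset sum_mset.add_mset prod.case norm_scaleC
            distrib_left mult.assoc)
    qed simp
    have "proj_norm (c *\<^sub>C u) \<le> cmod c * (\<Sum>(x, y)\<in>#M. norm x * norm y)"
      using proj_norm_le[of N] unfolding N1[symmetric] N2 M(1)[symmetric] .
    also have "\<dots> \<le> cmod c * (proj_norm u + d)"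
      by (rule mult_left_mono[OF less_imp_le[OF M(2)] norm_ge_zero])
    finally show "proj_norm (c *\<^sub>C u) \<le> cmod c * proj_norm u + e"
      using cd by (simp add: distrib_left)
  qed
  show ?thesis
  proof (cases "c = 0")
    case True
    then show ?thesis by (simp add: complex_vector.scale_zero_left proj_norm_zero)
  next
    case False
    have "proj_norm u = proj_norm (inverse c *\<^sub>C c *\<^sub>C u)"
      using False by (simp add: scaleC_scaleC scaleC_one)
    also have "\<dots> \<le> cmod (inverse c) * proj_norm (c *\<^sub>C u)" by (rule le)
    finally have "cmod c * proj_norm u \<le> cmod c * (cmod (inverse c) * proj_norm (c *\<^sub>C u))"
      by (rule mult_left_mono) simp
    also have "\<dots> = proj_norm (c *\<^sub>C u)"
      using False by (simp add: norm_inverse)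
    finally have "cmod c * proj_norm u \<le> proj_norm (c *\<^sub>C u)" .
    with le[of c u] show ?thesis by simp
  qed
qed

lemma proj_norm_minus: "proj_norm (- u) = proj_norm u"
  unfolding uminus_tensor_def proj_norm_scaleC by simp

lemma proj_norm_minus_commute: "proj_norm (u - v) = proj_norm (v - u)"
  using proj_norm_minus[of "u - v"] by simp

lemma proj_norm_diff_triangle: "proj_norm (u - w) \<le> proj_norm (u - v) + proj_norm (v - w)"
  using proj_norm_triangle[of "u - v" "v - w"] by simp

lemma proj_norm_diff_abs: "\<bar>proj_norm u - proj_norm v\<bar> \<le> proj_norm (u - v)"
  using proj_norm_triangle[of "u - v" v] proj_norm_triangle[of "v - u" u]
    proj_norm_minus_commute[of u v] by simp

lemma proj_norm_mult:
  fixes u v :: "('a::complex_normed_algebra, 'b::complex_normed_algebra) tensor"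
  shows "proj_norm (u * v) \<le> proj_norm u * proj_norm v"
proof -
  have elem: "proj_norm (elem_tensor a b * v) \<le> norm a * norm b * proj_norm v" for a b
  proof (rule field_le_epsilon)
    fix e :: real assume e: "e > 0"
    define k where "k = norm a * norm b"
    have k: "k \<ge> 0" by (simp add: k_def)
    obtain d where d: "d > 0" and kd: "k * d \<le> e"
      using small_factor[OF k e] .
    obtain M where M: "v = (\<Sum>(x, y)\<in>#M. elem_tensor x y)" "(\<Sum>(x, y)\<in>#M. norm x * norm y) < proj_norm v + d"
      using proj_norm_approx[OF d] .
    have "proj_norm (elem_tensor a b * (\<Sum>(x, y)\<in>#M. elem_tensor x y)) \<le> k * (\<Sum>(x, y)\<in>#M. norm x * norm y)"
    proof (induction M)
      case (add p M)
      obtain x y where p: "p = (x, y)" by (cases p)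
      have "proj_norm (elem_tensor (a * x) (b * y)) \<le> norm (a * x) * norm (b * y)"
        by (rule proj_norm_elem)
      also have "\<dots> \<le> (norm a * norm x) * (norm b * norm y)"
        by (intro mult_mono norm_mult_le) auto
      also have "\<dots> = k * (norm x * norm y)" by (simp only: k_def ac_simps)
      finally have 1: "proj_norm (elem_tensor a b * elem_tensor x y) \<le> k * (norm x * norm y)"
        by (simp only: elem_tensor_mult)
      show ?case
        unfolding p image_mset_add_mset sum_mset.add_mset prod.case distrib_left
        by (rule order_trans[OF proj_norm_triangle add_mono[OF 1 add]])
    qed (simp add: proj_norm_zero)
    also have "\<dots> \<le> k * (proj_norm v + d)" by (rule mult_left_mono[OF less_imp_le[OF M(2)] k])
    finally show "proj_norm (elem_tensor a b * v) \<le> norm a * norm b * proj_norm v + e"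
      unfolding M(1)[symmetric] distrib_left using kd unfolding k_def by linarith
  qed
  show ?thesis
  proof (rule field_le_epsilon)
    fix e :: real assume e: "e > 0"
    define k where "k = proj_norm v"
    have k: "k \<ge> 0" by (simp add: k_def proj_norm_nonneg)
    obtain d where d: "d > 0" and "k * d \<le> e"
      using small_factor[OF k e] .
    then have kd: "d * k \<le> e" by (simp only: mult.commute)
    obtain M where M: "u = (\<Sum>(x, y)\<in>#M. elem_tensor x y)" "(\<Sum>(x, y)\<in>#M. norm x * norm y) < proj_norm u + d"
      using proj_norm_approx[OF d] .
    have "proj_norm ((\<Sum>(x, y)\<in>#M. elem_tensor x y) * v) \<le> (\<Sum>(x, y)\<in>#M. norm x * norm y) * k"
    proof (induction M)
      case (add p M)
      obtain x y where p: "p = (x, y)" by (cases p)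
      show ?case
        unfolding p image_mset_add_mset sum_mset.add_mset prod.case distrib_right
        by (rule order_trans[OF proj_norm_triangle add_mono[OF elem[of x y, folded k_def] add]])
    qed (simp add: proj_norm_zero)
    also have "\<dots> \<le> (proj_norm u + d) * k" by (rule mult_right_mono[OF less_imp_le[OF M(2)] k])
    finally show "proj_norm (u * v) \<le> proj_norm u * proj_norm v + e"
      unfolding M(1)[symmetric] distrib_right using kd unfolding k_def by linarith
  qed
qed

text \<open>
  The completion consists of the Cauchy sequences modulo null sequences. This quotient makes sense
  for any seminorm, so it does not presuppose that \<open>proj_norm\<close> is positive definite.
\<close>

definition proj_Cauchy ::
  "(nat \<Rightarrow> ('a::complex_normed_vector, 'b::complex_normed_vector) tensor) \<Rightarrow> bool" where
  "proj_Cauchy u \<longleftrightarrow> (\<forall>e>0. \<exists>N. \<forall>m\<ge>N. \<forall>n\<ge>N. proj_norm (u m - u n) < e)"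

definition proj_eq ::
  "(nat \<Rightarrow> ('a::complex_normed_vector, 'b::complex_normed_vector) tensor) \<Rightarrow> (nat \<Rightarrow> ('a, 'b) tensor) \<Rightarrow> bool"
  where "proj_eq u v \<longleftrightarrow>
    proj_Cauchy u \<and> proj_Cauchy v \<and> (\<lambda>n. proj_norm (u n - v n)) \<longlonglongrightarrow> 0"

lemma proj_Cauchy_const: "proj_Cauchy (\<lambda>_. u)"
  by (simp add: proj_Cauchy_def proj_norm_zero)

lemma proj_null_le:
  assumes "f \<longlonglongrightarrow> 0" and "\<And>n. proj_norm (u n) \<le> f n"
  shows "(\<lambda>n. proj_norm (u n)) \<longlonglongrightarrow> 0"
  by (rule tendsto_sandwich[OF _ _ tendsto_const assms(1)]) (simp_all add: assms(2) proj_norm_nonneg)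

lemma proj_eq_refl_iff: "proj_eq u u \<longleftrightarrow> proj_Cauchy u"
  by (simp add: proj_eq_def proj_norm_zero)

lemma proj_Cauchy_Cauchy: "proj_Cauchy u \<Longrightarrow> Cauchy (\<lambda>n. proj_norm (u n))"
  unfolding proj_Cauchy_def Cauchy_def dist_real_def
  by (meson le_less_trans proj_norm_diff_abs)

lemma proj_Cauchy_convergent: "proj_Cauchy u \<Longrightarrow> convergent (\<lambda>n. proj_norm (u n))"
  by (simp add: proj_Cauchy_Cauchy real_Cauchy_convergent)

lemma proj_Cauchy_LIMSEQ:
  "proj_Cauchy u \<Longrightarrow> (\<lambda>n. proj_norm (u n)) \<longlonglongrightarrow> lim (\<lambda>n. proj_norm (u n))"
  using proj_Cauchy_convergent by (simp only: convergent_LIMSEQ_iff)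

lemma proj_Cauchy_bounded:
  assumes "proj_Cauchy u"
  obtains K where "K > 0" "\<And>n. proj_norm (u n) \<le> K"
proof -
  have "Bseq (\<lambda>n. proj_norm (u n))"
    using proj_Cauchy_Cauchy[OF assms] by (rule Cauchy_Bseq)
  then obtain K where "K > 0" "\<And>n. norm (proj_norm (u n)) \<le> K"
    by (auto elim: BseqE)
  then show ?thesis using that[of K] by (simp add: proj_norm_nonneg)
qed

lemma proj_Cauchy_add:
  assumes "proj_Cauchy u" "proj_Cauchy v"
  shows "proj_Cauchy (\<lambda>n. u n + v n)"
  unfolding proj_Cauchy_def
proof (intro allI impI)
  fix e :: real assume "e > 0"
  then have e: "e / 2 > 0" by simp
  obtain M where M: "\<And>m n. m \<ge> M \<Longrightarrow> n \<ge> M \<Longrightarrow> proj_norm (u m - u n) < e / 2"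
    using assms(1) e unfolding proj_Cauchy_def by blast
  obtain N where N: "\<And>m n. m \<ge> N \<Longrightarrow> n \<ge> N \<Longrightarrow> proj_norm (v m - v n) < e / 2"
    using assms(2) e unfolding proj_Cauchy_def by blast
  have "proj_norm (u m + v m - (u n + v n)) < e" if "m \<ge> max M N" "n \<ge> max M N" for m n
    using proj_norm_triangle[of "u m - u n" "v m - v n"] M[of m n] N[of m n] that
    by (simp add: algebra_simps)
  then show "\<exists>N. \<forall>m\<ge>N. \<forall>n\<ge>N. proj_norm (u m + v m - (u n + v n)) < e" by blast
qed

lemma proj_Cauchy_scaleC:
  assumes "proj_Cauchy u"
  shows "proj_Cauchy (\<lambda>n. c *\<^sub>C u n)"
  unfolding proj_Cauchy_def
proof (intro allI impI)
  fix e :: real assume "e > 0"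
  moreover have pos: "cmod c + 1 > 0" using norm_ge_zero[of c] by linarith
  ultimately have "e / (cmod c + 1) > 0" by simp
  then obtain N where N: "\<And>m n. m \<ge> N \<Longrightarrow> n \<ge> N \<Longrightarrow> proj_norm (u m - u n) < e / (cmod c + 1)"
    using assms unfolding proj_Cauchy_def by blast
  have "proj_norm (c *\<^sub>C u m - c *\<^sub>C u n) < e" if "m \<ge> N" "n \<ge> N" for m n
  proof -
    have "proj_norm (c *\<^sub>C u m - c *\<^sub>C u n) = cmod c * proj_norm (u m - u n)"
      by (simp add: complex_vector.scale_right_diff_distrib[symmetric] proj_norm_scaleC)
    also have "\<dots> \<le> (cmod c + 1) * proj_norm (u m - u n)"
      by (intro mult_right_mono proj_norm_nonneg) simp
    also have "\<dots> < e" using N[OF that] pos by (simp only: pos_less_divide_eq mult.commute)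
    finally show ?thesis .
  qed
  then show "\<exists>N. \<forall>m\<ge>N. \<forall>n\<ge>N. proj_norm (c *\<^sub>C u m - c *\<^sub>C u n) < e" by blast
qed

lemma proj_norm_mult_diff:
  fixes u v u' v' :: "('a::complex_normed_algebra, 'b::complex_normed_algebra) tensor"
  shows "proj_norm (u * v - u' * v') \<le> proj_norm (u - u') * proj_norm v + proj_norm u' * proj_norm (v - v')"
proof -
  have "u * v - u' * v' = (u - u') * v + u' * (v - v')" by (simp add: algebra_simps)
  then show ?thesis
    using proj_norm_triangle[of "(u - u') * v" "u' * (v - v')"]
      proj_norm_mult[of "u - u'" v] proj_norm_mult[of u' "v - v'"] by simp
qed

lemma proj_Cauchy_mult:
  fixes u v :: "nat \<Rightarrow> ('a::complex_normed_algebra, 'b::complex_normed_algebra) tensor"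
  assumes "proj_Cauchy u" "proj_Cauchy v"
  shows "proj_Cauchy (\<lambda>n. u n * v n)"
  unfolding proj_Cauchy_def
proof (intro allI impI)
  fix e :: real assume e: "e > 0"
  obtain K where K: "K > 0" "\<And>n. proj_norm (u n) \<le> K" using proj_Cauchy_bounded[OF assms(1)] by blast
  obtain L where L: "L > 0" "\<And>n. proj_norm (v n) \<le> L" using proj_Cauchy_bounded[OF assms(2)] by blast
  have eL: "e / (2 * L) > 0" and eK: "e / (2 * K) > 0" using e K L by simp_all
  obtain M where M: "\<And>m n. m \<ge> M \<Longrightarrow> n \<ge> M \<Longrightarrow> proj_norm (u m - u n) < e / (2 * L)"
    using assms(1) eL unfolding proj_Cauchy_def by blast
  obtain N where N: "\<And>m n. m \<ge> N \<Longrightarrow> n \<ge> N \<Longrightarrow> proj_norm (v m - v n) < e / (2 * K)"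
    using assms(2) eK unfolding proj_Cauchy_def by blast
  have "proj_norm (u m * v m - u n * v n) < e" if "m \<ge> max M N" "n \<ge> max M N" for m n
  proof -
    have "proj_norm (u m - u n) * proj_norm (v m) \<le> proj_norm (u m - u n) * L"
      by (intro mult_left_mono L proj_norm_nonneg)
    moreover have "proj_norm (u m - u n) * L < e / 2"
      using M[of m n] that L(1) by (simp add: field_simps)
    moreover have "proj_norm (u n) * proj_norm (v m - v n) \<le> K * proj_norm (v m - v n)"
      by (intro mult_right_mono K proj_norm_nonneg)
    moreover have "K * proj_norm (v m - v n) < e / 2"
      using N[of m n] that K(1) by (simp add: field_simps)
    ultimately show ?thesis using proj_norm_mult_diff[of "u m" "v m" "u n" "v n"] by linarith
  qed
  then show "\<exists>N. \<forall>m\<ge>N. \<forall>n\<ge>N. proj_norm (u m * v m - u n * v n) < e" by blast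
qed

lemma part_equivp_proj_eq:
  "part_equivp (proj_eq :: (nat \<Rightarrow> ('a::complex_normed_vector, 'b::complex_normed_vector) tensor) \<Rightarrow> _)"
proof (rule part_equivpI)
  show "\<exists>u :: nat \<Rightarrow> ('a, 'b) tensor. proj_eq u u"
    by (rule exI[of _ "\<lambda>_. 0"]) (simp add: proj_eq_refl_iff proj_Cauchy_const)
  show "symp (proj_eq :: (nat \<Rightarrow> ('a, 'b) tensor) \<Rightarrow> _)"
    by (auto simp: symp_def proj_eq_def proj_norm_minus_commute)
  show "transp (proj_eq :: (nat \<Rightarrow> ('a, 'b) tensor) \<Rightarrow> _)"
  proof (rule transpI)
    fix u v w :: "nat \<Rightarrow> ('a, 'b) tensor"
    assume uv: "proj_eq u v" and vw: "proj_eq v w"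
    have "(\<lambda>n. proj_norm (u n - v n) + proj_norm (v n - w n)) \<longlonglongrightarrow> 0"
      using uv vw unfolding proj_eq_def by (intro tendsto_add_zero) auto
    then have "(\<lambda>n. proj_norm (u n - w n)) \<longlonglongrightarrow> 0"
      by (rule proj_null_le) (rule proj_norm_diff_triangle)
    then show "proj_eq u w" using uv vw by (simp add: proj_eq_def)
  qed
qed

quotient_type (overloaded) ('a, 'b) proj_tensor =
  "nat \<Rightarrow> ('a::complex_normed_vector, 'b::complex_normed_vector) tensor" / partial: proj_eq
  by (rule part_equivp_proj_eq)

lift_definition of_tensor ::
  "('a::complex_normed_vector, 'b::complex_normed_vector) tensor \<Rightarrow> ('a, 'b) proj_tensor"
  is "\<lambda>u n. u"
  by (simp add: proj_eq_refl_iff proj_Cauchy_const)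

instantiation proj_tensor :: (complex_normed_vector, complex_normed_vector) complex_normed_vector
begin

lift_definition zero_proj_tensor :: "('a, 'b) proj_tensor" is "\<lambda>n. 0"
  by (simp add: proj_eq_refl_iff proj_Cauchy_const)

lift_definition plus_proj_tensor ::
  "('a, 'b) proj_tensor \<Rightarrow> ('a, 'b) proj_tensor \<Rightarrow> ('a, 'b) proj_tensor"
  is "\<lambda>u v n. u n + v n"
proof -
  fix u u' v v' :: "nat \<Rightarrow> ('a, 'b) tensor"
  assume a: "proj_eq u u'" "proj_eq v v'"
  have "(\<lambda>n. proj_norm (u n - u' n) + proj_norm (v n - v' n)) \<longlonglongrightarrow> 0"
    using a unfolding proj_eq_def by (intro tendsto_add_zero) auto
  moreover have "proj_norm (u n + v n - (u' n + v' n)) \<le> proj_norm (u n - u' n) + proj_norm (v n - v' n)" for n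
    using proj_norm_triangle[of "u n - u' n" "v n - v' n"] by (simp only: add_diff_add)
  ultimately have "(\<lambda>n. proj_norm (u n + v n - (u' n + v' n))) \<longlonglongrightarrow> 0"
    by (rule proj_null_le)
  then show "proj_eq (\<lambda>n. u n + v n) (\<lambda>n. u' n + v' n)"
    using a by (simp only: proj_eq_def proj_Cauchy_add simp_thms)
qed

lift_definition scaleC_proj_tensor :: "complex \<Rightarrow> ('a, 'b) proj_tensor \<Rightarrow> ('a, 'b) proj_tensor"
  is "\<lambda>c u n. c *\<^sub>C u n"
proof -
  fix c and u v :: "nat \<Rightarrow> ('a, 'b) tensor"
  assume a: "proj_eq u v"
  have "(\<lambda>n. cmod c * proj_norm (u n - v n)) \<longlonglongrightarrow> 0"
    using a unfolding proj_eq_def by (intro tendsto_mult_right_zero) auto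
  then have "(\<lambda>n. proj_norm (c *\<^sub>C u n - c *\<^sub>C v n)) \<longlonglongrightarrow> 0"
    by (simp only: complex_vector.scale_right_diff_distrib[symmetric] proj_norm_scaleC)
  then show "proj_eq (\<lambda>n. c *\<^sub>C u n) (\<lambda>n. c *\<^sub>C v n)"
    using a by (simp only: proj_eq_def proj_Cauchy_scaleC simp_thms)
qed

lift_definition norm_proj_tensor :: "('a, 'b) proj_tensor \<Rightarrow> real"
  is "\<lambda>u. lim (\<lambda>n. proj_norm (u n))"
proof -
  fix u v :: "nat \<Rightarrow> ('a, 'b) tensor"
  assume a: "proj_eq u v"
  have "(\<lambda>n. proj_norm (u n) - proj_norm (v n)) \<longlonglongrightarrow> 0"
  proof (rule Lim_null_comparison)
    show "eventually (\<lambda>n. norm (proj_norm (u n) - proj_norm (v n)) \<le> proj_norm (u n - v n)) sequentially"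
      unfolding real_norm_def by (rule always_eventually) (rule allI, rule proj_norm_diff_abs)
    show "(\<lambda>n. proj_norm (u n - v n)) \<longlonglongrightarrow> 0"
      using a unfolding proj_eq_def by blast
  qed
  moreover have "(\<lambda>n. proj_norm (v n)) \<longlonglongrightarrow> lim (\<lambda>n. proj_norm (v n))"
    using a by (simp only: proj_eq_def proj_Cauchy_LIMSEQ)
  ultimately have "(\<lambda>n. proj_norm (u n) - proj_norm (v n) + proj_norm (v n)) \<longlonglongrightarrow> 0 + lim (\<lambda>n. proj_norm (v n))"
    by (rule tendsto_add)
  then have "(\<lambda>n. proj_norm (u n)) \<longlonglongrightarrow> lim (\<lambda>n. proj_norm (v n))"
    by (simp only: diff_add_cancel add_0_left)
  then show "lim (\<lambda>n. proj_norm (u n)) = lim (\<lambda>n. proj_norm (v n))"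
    by (rule limI)
qed

definition "uminus (u :: ('a, 'b) proj_tensor) = (-1) *\<^sub>C u"
definition "(u :: ('a, 'b) proj_tensor) - v = u + - v"
definition "r *\<^sub>R (u :: ('a, 'b) proj_tensor) = complex_of_real r *\<^sub>C u"
definition "sgn (u :: ('a, 'b) proj_tensor) = inverse (norm u) *\<^sub>R u"
definition "dist (u :: ('a, 'b) proj_tensor) v = norm (u - v)"
definition [code del]:
  "(uniformity :: (('a, 'b) proj_tensor \<times> ('a, 'b) proj_tensor) filter) =
    (INF e\<in>{0<..}. principal {(x, y). dist x y < e})"
definition [code del]:
  "open (U :: ('a, 'b) proj_tensor set) \<longleftrightarrow>
    (\<forall>x\<in>U. eventually (\<lambda>(x', y). x' = x \<longrightarrow> y \<in> U) uniformity)"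

instance
proof
  fix u v w :: "('a, 'b) proj_tensor" and r s :: real and c d :: complex
  show "u + v + w = u + (v + w)"
    by transfer (simp only: add.assoc proj_eq_refl_iff proj_Cauchy_add proj_Cauchy_scaleC)
  show "u + v = v + u"
    by transfer (subst add.commute, simp only: proj_eq_refl_iff proj_Cauchy_add proj_Cauchy_scaleC)
  show "0 + u = u"
    by transfer (simp only: add_0_left)
  show distR: "c *\<^sub>C (u + v) = c *\<^sub>C u + c *\<^sub>C v" for c and u v :: "('a, 'b) proj_tensor"
    by transfer (simp only: scaleC_add_right proj_eq_refl_iff proj_Cauchy_add proj_Cauchy_scaleC)
  show assoc: "c *\<^sub>C d *\<^sub>C u = (c * d) *\<^sub>C u" for c d
    by transfer (simp only: scaleC_scaleC proj_eq_refl_iff proj_Cauchy_add proj_Cauchy_scaleC)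
  have one: "1 *\<^sub>C u = u"
    by transfer (simp only: scaleC_one)
  show distL: "(c + d) *\<^sub>C u = c *\<^sub>C u + d *\<^sub>C u" for c d
    by transfer (simp only: scaleC_add_left proj_eq_refl_iff proj_Cauchy_add proj_Cauchy_scaleC)
  have zero: "0 *\<^sub>C u = 0"
    by transfer (simp only: complex_vector.scale_zero_left proj_eq_refl_iff proj_Cauchy_const)
  show "- u + u = 0"
    unfolding uminus_proj_tensor_def using distL[of "-1" 1] one zero by simp
  show "u - v = u + - v" by (rule minus_proj_tensor_def)
  show "r *\<^sub>R u = complex_of_real r *\<^sub>C u" by (rule scaleR_proj_tensor_def)
  show "r *\<^sub>R (u + v) = r *\<^sub>R u + r *\<^sub>R v" "(r + s) *\<^sub>R u = r *\<^sub>R u + s *\<^sub>R u"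
    "r *\<^sub>R s *\<^sub>R u = (r * s) *\<^sub>R u" "1 *\<^sub>R u = u"
    by (simp_all add: scaleR_proj_tensor_def distL distR assoc one)
  show norm_scaleC: "norm (c *\<^sub>C u) = cmod c * norm u" for c
  proof transfer
    fix c and u :: "nat \<Rightarrow> ('a, 'b) tensor"
    assume "proj_eq u u"
    then have "(\<lambda>n. proj_norm (u n)) \<longlonglongrightarrow> lim (\<lambda>n. proj_norm (u n))"
      by (simp only: proj_eq_refl_iff proj_Cauchy_LIMSEQ)
    then have "(\<lambda>n. cmod c * proj_norm (u n)) \<longlonglongrightarrow> cmod c * lim (\<lambda>n. proj_norm (u n))"
      by (intro tendsto_mult tendsto_const)
    then show "lim (\<lambda>n. proj_norm (c *\<^sub>C u n)) = cmod c * lim (\<lambda>n. proj_norm (u n))"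
      by (simp only: proj_norm_scaleC limI)
  qed
  show "norm (r *\<^sub>R u) = \<bar>r\<bar> * norm u"
    unfolding scaleR_proj_tensor_def norm_scaleC norm_of_real ..
  show "norm (u + v) \<le> norm u + norm v"
  proof transfer
    fix u v :: "nat \<Rightarrow> ('a, 'b) tensor"
    assume "proj_eq u u" "proj_eq v v"
    then have *: "(\<lambda>n. proj_norm (u n)) \<longlonglongrightarrow> lim (\<lambda>n. proj_norm (u n))"
      "(\<lambda>n. proj_norm (v n)) \<longlonglongrightarrow> lim (\<lambda>n. proj_norm (v n))"
      "(\<lambda>n. proj_norm (u n + v n)) \<longlonglongrightarrow> lim (\<lambda>n. proj_norm (u n + v n))"
      by (simp_all only: proj_eq_refl_iff proj_Cauchy_LIMSEQ proj_Cauchy_add)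
    show "lim (\<lambda>n. proj_norm (u n + v n)) \<le> lim (\<lambda>n. proj_norm (u n)) + lim (\<lambda>n. proj_norm (v n))"
      by (rule LIMSEQ_le[OF *(3) tendsto_add[OF *(1,2)]]) (simp add: proj_norm_triangle)
  qed
  show "(norm u = 0) = (u = 0)"
  proof transfer
    fix u :: "nat \<Rightarrow> ('a, 'b) tensor"
    assume u: "proj_eq u u"
    then have *: "(\<lambda>n. proj_norm (u n)) \<longlonglongrightarrow> lim (\<lambda>n. proj_norm (u n))"
      by (simp only: proj_eq_refl_iff proj_Cauchy_LIMSEQ)
    have "proj_eq u (\<lambda>n. 0) \<longleftrightarrow> (\<lambda>n. proj_norm (u n)) \<longlonglongrightarrow> 0"
      using u unfolding proj_eq_refl_iff unfolding proj_eq_def by (simp only: proj_Cauchy_const diff_zero simp_thms)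
    then show "(lim (\<lambda>n. proj_norm (u n)) = 0) = proj_eq u (\<lambda>n. 0)"
      using * limI[of "\<lambda>n. proj_norm (u n)" 0] by (cases "lim (\<lambda>n. proj_norm (u n)) = 0") (simp_all only:, blast)
  qed
qed (simp_all add: sgn_proj_tensor_def dist_proj_tensor_def uniformity_proj_tensor_def
    open_proj_tensor_def)

end

lemma norm_of_tensor: "norm (of_tensor u) = proj_norm u"
  by transfer (simp add: limI)

lemma of_tensor_add: "of_tensor (u + v) = of_tensor u + of_tensor v"
  by transfer (simp add: proj_eq_refl_iff proj_Cauchy_const)

lemma of_tensor_scaleC: "of_tensor (c *\<^sub>C u) = c *\<^sub>C of_tensor u"
  by transfer (simp add: proj_eq_refl_iff proj_Cauchy_const)

lemma of_tensor_diff: "of_tensor (u - v) = of_tensor u - of_tensor v"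
  unfolding minus_proj_tensor_def minus_tensor_def uminus_proj_tensor_def uminus_tensor_def
    of_tensor_add of_tensor_scaleC ..

lemma norm_diff_of_tensor_le:
  assumes u: "proj_Cauchy u" and "\<And>n. n \<ge> N \<Longrightarrow> proj_norm (u n - t) \<le> e"
  shows "norm (abs_proj_tensor u - of_tensor t) \<le> e"
proof -
  have "proj_Cauchy (\<lambda>n. u n + - t)"
    by (rule proj_Cauchy_add[OF u proj_Cauchy_const])
  then have C: "proj_Cauchy (\<lambda>n. u n - t)" by simp
  have "abs_proj_tensor u - of_tensor t = abs_proj_tensor (\<lambda>n. u n - t)"
    unfolding minus_proj_tensor_def uminus_proj_tensor_def of_tensor.abs_eq
      minus_tensor_def uminus_tensor_def
    by (simp only: scaleC_proj_tensor.abs_eq plus_proj_tensor.abs_eq proj_eq_refl_iff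
        proj_Cauchy_const proj_Cauchy_scaleC u)
  then have "norm (abs_proj_tensor u - of_tensor t) = lim (\<lambda>n. proj_norm (u n - t))"
    by (simp add: norm_proj_tensor.abs_eq proj_eq_refl_iff C)
  moreover have "(\<lambda>n. proj_norm (u n - t)) \<longlonglongrightarrow> lim (\<lambda>n. proj_norm (u n - t))"
    using C by (rule proj_Cauchy_LIMSEQ)
  ultimately show ?thesis
    using LIMSEQ_le_const2[of "\<lambda>n. proj_norm (u n - t)" _ e] assms(2) by auto
qed

lemma abs_proj_tensor_LIMSEQ:
  assumes "proj_Cauchy u"
  shows "(\<lambda>n. of_tensor (u n)) \<longlonglongrightarrow> abs_proj_tensor u"
  unfolding lim_sequentially
proof (intro allI impI)
  fix e :: real assume "e > 0"
  then have "e / 2 > 0" by simp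
  then obtain N where N: "\<And>m n. m \<ge> N \<Longrightarrow> n \<ge> N \<Longrightarrow> proj_norm (u m - u n) < e / 2"
    using assms unfolding proj_Cauchy_def by blast
  have "dist (of_tensor (u n)) (abs_proj_tensor u) < e" if "n \<ge> N" for n
  proof -
    have "norm (abs_proj_tensor u - of_tensor (u n)) \<le> e / 2"
      using N that by (intro norm_diff_of_tensor_le[OF assms, of N]) (auto intro: less_imp_le)
    then show ?thesis using \<open>e > 0\<close> by (simp add: dist_norm norm_minus_commute)
  qed
  then show "\<exists>N. \<forall>n\<ge>N. dist (of_tensor (u n)) (abs_proj_tensor u) < e" by blast
qed

lemma of_tensor_dense:
  assumes "e > 0"
  shows "\<exists>t. dist (of_tensor t) z < e"
proof -
  have "\<exists>u. proj_Cauchy u \<and> z = abs_proj_tensor u"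
    by (induction z rule: proj_tensor.abs_induct) (auto simp: proj_eq_refl_iff)
  then obtain u where u: "proj_Cauchy u" "z = abs_proj_tensor u" by blast
  then show ?thesis
    using abs_proj_tensor_LIMSEQ[OF u(1)] assms unfolding lim_sequentially by blast
qed

instance proj_tensor :: (complex_normed_vector, complex_normed_vector) banach
proof
  fix X :: "nat \<Rightarrow> ('a, 'b) proj_tensor"
  assume X: "Cauchy X"
  have "\<exists>t. dist (of_tensor t) (X n) < 1 / real (Suc n)" for n
    by (rule of_tensor_dense) simp
  then obtain t where t: "\<And>n. dist (of_tensor (t n)) (X n) < 1 / real (Suc n)" by metis
  have null: "(\<lambda>n. of_tensor (t n) - X n) \<longlonglongrightarrow> 0"
  proof (rule Lim_null_comparison)
    show "eventually (\<lambda>n. norm (of_tensor (t n) - X n) \<le> inverse (real (Suc n))) sequentially"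
      by (intro always_eventually allI less_imp_le) (use t in \<open>simp only: dist_norm inverse_eq_divide\<close>)
  qed (rule LIMSEQ_inverse_real_of_nat)
  have "proj_Cauchy t"
    unfolding proj_Cauchy_def
  proof (intro allI impI)
    fix e :: real assume "e > 0"
    then have e: "e / 3 > 0" by simp
    obtain M where M: "\<And>m n. m \<ge> M \<Longrightarrow> n \<ge> M \<Longrightarrow> dist (X m) (X n) < e / 3"
      using X e unfolding Cauchy_def by blast
    obtain N where N: "\<And>n. n \<ge> N \<Longrightarrow> norm (of_tensor (t n) - X n) < e / 3"
      using LIMSEQ_D[OF null e] unfolding diff_zero by blast
    have "proj_norm (t m - t n) < e" if "m \<ge> max M N" "n \<ge> max M N" for m n
    proof -
      have "dist (of_tensor (t m)) (of_tensor (t n)) \<le>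
          dist (of_tensor (t m)) (X m) + dist (X m) (X n) + dist (X n) (of_tensor (t n))"
        by (meson add_right_mono dist_triangle order_trans)
      moreover have "dist (of_tensor (t m)) (X m) < e / 3" "dist (X n) (of_tensor (t n)) < e / 3"
        using N[of m] N[of n] that by (simp_all add: dist_norm norm_minus_commute)
      moreover have "dist (X m) (X n) < e / 3"
        using M that by simp
      moreover have "proj_norm (t m - t n) = dist (of_tensor (t m)) (of_tensor (t n))"
        by (simp only: dist_norm of_tensor_diff[symmetric] norm_of_tensor)
      ultimately show ?thesis by linarith
    qed
    then show "\<exists>N. \<forall>m\<ge>N. \<forall>n\<ge>N. proj_norm (t m - t n) < e" by blast
  qed
  then have "(\<lambda>n. of_tensor (t n)) \<longlonglongrightarrow> abs_proj_tensor t"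
    by (rule abs_proj_tensor_LIMSEQ)
  from tendsto_diff[OF this null] show "convergent X"
    by (intro convergentI) simp
qed

instantiation proj_tensor :: (complex_normed_algebra, complex_normed_algebra) complex_banach_algebra
begin

lift_definition times_proj_tensor ::
  "('a, 'b) proj_tensor \<Rightarrow> ('a, 'b) proj_tensor \<Rightarrow> ('a, 'b) proj_tensor"
  is "\<lambda>u v n. u n * v n"
proof -
  fix u u' v v' :: "nat \<Rightarrow> ('a, 'b) tensor"
  assume a: "proj_eq u u'" "proj_eq v v'"
  obtain K where K: "\<And>n. proj_norm (u' n) \<le> K"
    using a proj_Cauchy_bounded[of u'] unfolding proj_eq_def by blast
  obtain L where L: "\<And>n. proj_norm (v n) \<le> L"
    using a proj_Cauchy_bounded[of v] unfolding proj_eq_def by blast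
  have "(\<lambda>n. proj_norm (u n - u' n) * L + K * proj_norm (v n - v' n)) \<longlonglongrightarrow> 0"
    using a unfolding proj_eq_def
    by (intro tendsto_add_zero tendsto_mult_left_zero tendsto_mult_right_zero) auto
  moreover have "proj_norm (u n * v n - u' n * v' n) \<le>
      proj_norm (u n - u' n) * L + K * proj_norm (v n - v' n)" for n
    using proj_norm_mult_diff[of "u n" "v n" "u' n" "v' n"]
      mult_left_mono[OF L[of n] proj_norm_nonneg[of "u n - u' n"]]
      mult_right_mono[OF K[of n] proj_norm_nonneg[of "v n - v' n"]] by linarith
  ultimately have "(\<lambda>n. proj_norm (u n * v n - u' n * v' n)) \<longlonglongrightarrow> 0"
    by (rule proj_null_le)
  then show "proj_eq (\<lambda>n. u n * v n) (\<lambda>n. u' n * v' n)"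
    using a by (simp only: proj_eq_def proj_Cauchy_mult simp_thms)
qed

instance
proof
  fix u v w :: "('a, 'b) proj_tensor" and c :: complex
  show "u * v * w = u * (v * w)"
    by transfer (simp only: mult.assoc proj_eq_refl_iff proj_Cauchy_mult)
  show "(u + v) * w = u * w + v * w" "u * (v + w) = u * v + u * w"
    by (transfer; simp only: distrib_left distrib_right proj_eq_refl_iff
        proj_Cauchy_mult proj_Cauchy_add)+
  show "c *\<^sub>C u * v = c *\<^sub>C (u * v)" "u * c *\<^sub>C v = c *\<^sub>C (u * v)"
    by (transfer; simp only: mult_scaleC_left mult_scaleC_right proj_eq_refl_iff
        proj_Cauchy_mult proj_Cauchy_scaleC)+
  show "norm (u * v) \<le> norm u * norm v"
  proof transfer
    fix u v :: "nat \<Rightarrow> ('a, 'b) tensor"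
    assume "proj_eq u u" "proj_eq v v"
    then have *: "(\<lambda>n. proj_norm (u n)) \<longlonglongrightarrow> lim (\<lambda>n. proj_norm (u n))"
      "(\<lambda>n. proj_norm (v n)) \<longlonglongrightarrow> lim (\<lambda>n. proj_norm (v n))"
      "(\<lambda>n. proj_norm (u n * v n)) \<longlonglongrightarrow> lim (\<lambda>n. proj_norm (u n * v n))"
      by (simp_all only: proj_eq_refl_iff proj_Cauchy_LIMSEQ proj_Cauchy_mult)
    show "lim (\<lambda>n. proj_norm (u n * v n)) \<le> lim (\<lambda>n. proj_norm (u n)) * lim (\<lambda>n. proj_norm (v n))"
      by (rule LIMSEQ_le[OF *(3) tendsto_mult[OF *(1,2)]]) (simp add: proj_norm_mult)
  qed
qed

end

lemma of_tensor_mult: "of_tensor (u * v) = of_tensor u * of_tensor v"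
  by transfer (simp add: proj_eq_refl_iff proj_Cauchy_const)

type_synonym 'a varopoulos = "('a, 'a) proj_tensor"

end

theory Submission
  imports Defs "HOL-Complex_Analysis.Cauchy_Integral_Formula"
begin

text \<open>
  If \<open>A\<close> is finite-dimensional, then a functional on \<open>V\<^sub>A\<close> is determined by finitely many values, so
  every element of the bidual is an evaluation.

  Conversely, take \<open>g \<in> A\<close> with \<open>g\<^sup>* = -g\<close> and put \<open>b\<^sub>n = ng(1 + ng)\<^sup>-\<^sup>1\<close>, a bounded approximate identity for the
  closed ideal generated by \<open>g\<close>. For a bounded bilinear form \<open>F\<close> and an element \<open>a\<close>, the functionals
  \<open>F \<box> (a \<otimes> b\<^sub>n)\<close> are norm Cauchy: otherwise there are arbitrarily long nearly orthogonal sequences \<open>y\<^sub>j\<close>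
  and \<open>c\<^sub>j\<close> in the unit ball with \<open>\<bar>F(c\<^sub>j, y\<^sub>j)\<bar>\<close> bounded below, contradicting the estimate
  \<open>\<bar>\<Sum>\<^sub>j F(c\<^sub>j, y\<^sub>j)\<bar> = O(\<surd>n)\<close>, which follows from a Riesz product in the \<open>c\<^sub>j\<close>. Hence the weak-star limit of
  \<open>a \<otimes> b\<^sub>n\<close> lies in the topological centre. If it lies in \<open>V\<^sub>A\<close>, then slicing shows that \<open>b\<^sub>n\<close> converges
  weakly in \<open>A\<close>, which forces \<open>g \<in> g\<^sup>2A\<close>. So strong Arens irregularity makes \<open>A\<close> von Neumann regular,
  and a commutative von Neumann regular Banach algebra is finite-dimensional: it has no infinite
  sequence of orthogonal idempotents \<open>e\<^sub>n\<close> because of the element \<open>\<Sum>\<^sub>n 2\<^sup>-\<^sup>n e\<^sub>n / \<parallel>e\<^sub>n\<parallel>\<close>, and its minimal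
  idempotents span one-dimensional ideals by the Gelfand--Mazur theorem.
\<close>

section \<open>Nearly orthogonal sequences and Riesz products\<close>

lemma norm_star: "norm (star x) = norm (x::'a::cstar_algebra)"
proof -
  have le: "norm x \<le> norm (star x)" for x :: 'a
  proof (cases "x = 0")
    case False
    have "norm x * norm x \<le> norm (star x) * norm x"
      using norm_star_mult_self[of x] norm_mult_le[of "star x" x] by (simp add: power2_eq_square)
    then show ?thesis using False by simp
  qed simp
  show ?thesis using le[of x] le[of "star x"] by (simp add: star_star)
qed

lemma star_zero: "star (0::'a::cstar_algebra) = 0"
  using norm_star[of "0::'a"] by simp

lemma star_minus: "star (- x) = - star (x::'a::cstar_algebra)"
  using star_add[of x "- x"] by (simp add: star_zero eq_neg_iff_add_eq_0 add.commute)

lemma star_diff: "star (x - y) = star x - star (y::'a::cstar_algebra)"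
  using star_add[of x "- y"] by (simp add: star_minus)

lemma norm_mult_star_self: "norm (x * star x) = norm (x::'a::cstar_algebra) ^ 2"
  using norm_star_mult_self[of "star x"] by (simp add: star_star norm_star)

lemma norm_square: "norm (x * x) = norm (x::'a::commutative_cstar_algebra) ^ 2"
proof -
  have "norm (x * x) ^ 2 = norm (star (x * x) * (x * x))"
    by (simp add: norm_star_mult_self)
  also have "star (x * x) * (x * x) = star (star x * x) * (star x * x)"
    by (simp add: star_mult star_star ac_simps)
  also have "norm \<dots> = (norm x ^ 2) ^ 2"
    by (simp only: norm_star_mult_self)
  finally show ?thesis by (rule power2_eq_imp_eq) simp_all
qed

text \<open>There need not be a unit, so a factor 1 + Q is accessible only through its action.
  Letting \<open>y\<close> act on \<open>star y\<close> and using the C*-identity recovers a bound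
  on its norm.\<close>

lemma norm_le_multiplier:
  fixes y :: "'a::cstar_algebra"
  assumes "\<And>x. norm (y * x) \<le> K * norm x" and "0 \<le> K"
  shows "norm y \<le> K"
proof (cases "y = 0")
  case False
  have "norm y * norm y \<le> K * norm y"
    using assms(1)[of "star y"] by (simp add: norm_mult_star_self norm_star power2_eq_square)
  then show ?thesis using False by simp
qed (use assms(2) in simp)

text \<open>Formally, 1 + w and 1 - w have equal modulus when w has imaginary values: the
  star-squares of z + w z and z - w z agree. The average of these two elements is z.\<close>

lemma norm_le_skew:
  fixes w z :: "'a::commutative_cstar_algebra"
  assumes "star w = - w"
  shows "norm z \<le> norm (z + w * z)"
proof -
  have "norm (z + w * z) ^ 2 = norm (z - w * z) ^ 2"
    unfolding norm_star_mult_self[symmetric]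
    by (simp add: star_add star_diff star_mult assms algebra_simps)
  then have eq: "norm (z - w * z) = norm (z + w * z)"
    by simp
  have "2 * norm z = norm ((z + w * z) + (z - w * z))"
    by (simp add: scaleR_2[symmetric])
  also have "\<dots> \<le> norm (z + w * z) + norm (z - w * z)" by (rule norm_triangle_ineq)
  finally show ?thesis using eq by simp
qed

text \<open>If the sum had norm at least 2, replace each y_j by its square again and again. The
  off-diagonal products contribute at most 1 in total, so the norms of the sums grow without bound,
  although each is at most n.\<close>

lemma norm_sum_nearly_orthogonal:
  fixes y :: "nat \<Rightarrow> 'a::commutative_cstar_algebra"
  assumes "\<And>j. j < n \<Longrightarrow> norm (y j) \<le> 1"
    and "\<And>i j. i < n \<Longrightarrow> j < n \<Longrightarrow> i \<noteq> j \<Longrightarrow> norm (y i * y j) \<le> 1 / (real n)^2"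
  shows "norm (\<Sum>j<n. y j) < 2"
proof (rule ccontr)
  assume ge: "\<not> norm (\<Sum>j<n. y j) < 2"
  define s where "s k = (\<Sum>j<n. ((\<lambda>x. x * x) ^^ k) (y j))" for k
  have bd: "norm (((\<lambda>x. x * x) ^^ k) (y j)) \<le> 1" if "j < n" for j k
    by (induction k) (simp_all add: assms(1) that norm_square power_le_one)
  have orth: "norm (((\<lambda>x. x * x) ^^ k) (y i) * ((\<lambda>x. x * x) ^^ k) (y j)) \<le> 1 / (real n)^2"
    if "i < n" "j < n" "i \<noteq> j" for i j k
  proof (induction k)
    case 0
    then show ?case using assms(2)[OF that] by simp
  next
    case (Suc k)
    let ?a = "((\<lambda>x. x * x) ^^ k) (y i)" and ?b = "((\<lambda>x. x * x) ^^ k) (y j)"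
    have 1: "norm (?a * ?b) \<le> 1"
      using norm_mult_le[of ?a ?b] mult_mono[OF bd[OF that(1), of k] bd[OF that(2), of k]] by simp
    have "(?a * ?a) * (?b * ?b) = (?a * ?b) * (?a * ?b)" by (simp add: ac_simps)
    then have "norm ((?a * ?a) * (?b * ?b)) = norm (?a * ?b) * norm (?a * ?b)"
      by (simp add: norm_square power2_eq_square)
    also have "\<dots> \<le> 1 * norm (?a * ?b)" by (rule mult_right_mono[OF 1]) simp
    finally show ?case using Suc by simp
  qed
  have step: "norm (s k) ^ 2 \<le> norm (s (Suc k)) + 1" for k
  proof -
    define z where "z j = ((\<lambda>x. x * x) ^^ k) (y j)" for j
    have "s k * s k = (\<Sum>i<n. \<Sum>j<n. z i * z j)"
      by (simp add: s_def z_def sum_product)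
    also have "\<dots> = (\<Sum>i<n. z i * z i + (\<Sum>j\<in>{..<n}-{i}. z i * z j))"
      by (intro sum.cong sum.remove) auto
    also have "\<dots> = s (Suc k) + (\<Sum>i<n. \<Sum>j\<in>{..<n}-{i}. z i * z j)"
      by (simp add: s_def z_def sum.distrib)
    finally have eq: "s k * s k = s (Suc k) + (\<Sum>i<n. \<Sum>j\<in>{..<n}-{i}. z i * z j)" .
    have "norm (\<Sum>i<n. \<Sum>j\<in>{..<n}-{i}. z i * z j) \<le> (\<Sum>i<n. \<Sum>j\<in>{..<n}-{i}. 1 / (real n)^2)"
      by (intro sum_norm_le) (auto simp: z_def intro!: orth)
    also have "\<dots> \<le> (\<Sum>i<n. \<Sum>j<n. 1 / (real n)^2)"
      by (intro sum_mono sum_mono2) auto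
    also have "\<dots> \<le> 1" by (simp add: power2_eq_square)
    finally show ?thesis
      unfolding norm_square[symmetric] eq
      using norm_triangle_ineq[of "s (Suc k)" "\<Sum>i<n. \<Sum>j\<in>{..<n}-{i}. z i * z j"] by linarith
  qed
  \<comment> \<open>Linear growth suffices: (2 + k)^2 - 1 is at least 3 + k, and \<open>s n\<close>
    has norm at most n.\<close>
  have grow: "2 + real k \<le> norm (s k)" for k
  proof (induction k)
    case 0
    then show ?case using ge by (simp add: s_def)
  next
    case (Suc k)
    have "(2 + real k) * 2 \<le> norm (s k) * norm (s k)"
      using Suc by (intro mult_mono) auto
    then show ?case using step[of k] by (simp add: power2_eq_square)
  qed
  have "norm (s n) \<le> (\<Sum>j<n. 1)"
    unfolding s_def by (rule sum_norm_le) (simp add: bd)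
  with grow[of n] show False by simp
qed

section \<open>Bounded bilinear forms and Riesz products\<close>

definition bounded_bilinear_form ::
  "('a::complex_normed_vector \<Rightarrow> 'b::complex_normed_vector \<Rightarrow> complex) \<Rightarrow> real \<Rightarrow> bool"
  where "bounded_bilinear_form B K \<longleftrightarrow>
    (\<forall>x x' y. B (x + x') y = B x y + B x' y) \<and> (\<forall>x y y'. B x (y + y') = B x y + B x y') \<and>
    (\<forall>c x y. B (c *\<^sub>C x) y = c * B x y) \<and> (\<forall>c x y. B x (c *\<^sub>C y) = c * B x y) \<and>
    (\<forall>x y. cmod (B x y) \<le> K * norm x * norm y)"

lemma bounded_bilinear_formD:
  assumes "bounded_bilinear_form B K"
  shows "B (x + x') y = B x y + B x' y" "B x (y + y') = B x y + B x y'"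
    "B (c *\<^sub>C x) y = c * B x y" "B x (c *\<^sub>C y) = c * B x y"
    "cmod (B x y) \<le> K * norm x * norm y"
  using assms unfolding bounded_bilinear_form_def by blast+

text \<open>
  Here \<open>1 + Q\<close> is a Riesz product of factors \<open>1 + it\<epsilon>c\<close> with \<open>c\<close> among the first \<open>k\<close> of the \<open>c\<^sub>j\<close>; each
  factor has norm at most \<open>(1 + t\<^sup>2)\<close> to the power \<open>1/2\<close>. The average of the last expression over both
  signs \<open>\<epsilon>\<^sub>k\<close> does not depend on \<open>k\<close>, so the signs can be chosen one after the other such that its
  modulus does not decrease.
\<close>

lemma Riesz_product:
  fixes B :: "'a::commutative_cstar_algebra \<Rightarrow> 'b::complex_normed_vector \<Rightarrow> complex"
  assumes B: "bounded_bilinear_form B K"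
    and c: "\<And>j. star (c j) = c j" "\<And>j. norm (c j) \<le> 1"
  assumes "k \<le> n"
  shows "\<exists>Q Z (\<epsilon>::nat \<Rightarrow> real). (\<forall>j. \<epsilon> j = 1 \<or> \<epsilon> j = -1) \<and> Z = (\<Sum>j<k. \<epsilon> j *\<^sub>R y j) \<and>
    (\<forall>x. norm (x + Q * x) ^ 2 \<le> (1 + t\<^sup>2) ^ k * norm x ^ 2) \<and>
    cmod (\<i> * t * (\<Sum>j<n. B (c j) (y j))) \<le>
    cmod (B Q Z + \<i> * t * (\<Sum>j=k..<n. B (c j + c j * Q) (y j)))"
  using \<open>k \<le> n\<close>
proof (induction k)
  case 0
  have "B 0 0 = 0" using bounded_bilinear_formD(3)[OF B, of 0 0 0] by simp
  then show ?case
    by (intro exI[of _ 0] exI[of _ "\<lambda>_. 1"]) (simp add: atLeast0LessThan)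
next
  case (Suc k)
  note B' = bounded_bilinear_formD[OF B]
  from Suc obtain Q Z \<epsilon> where IH: "\<forall>j::nat. \<epsilon> j = (1::real) \<or> \<epsilon> j = -1" "Z = (\<Sum>j<k. \<epsilon> j *\<^sub>R y j)"
    "\<forall>x. norm (x + Q * x) ^ 2 \<le> (1 + t\<^sup>2) ^ k * norm x ^ 2"
    "cmod (\<i> * t * (\<Sum>j<n. B (c j) (y j))) \<le>
    cmod (B Q Z + \<i> * t * (\<Sum>j=k..<n. B (c j + c j * Q) (y j)))" by auto
  \<comment> \<open>In a unitization this reads 1 + Q' = (1 + i e t c_k)(1 + Q).\<close>
  define Q' where "Q' e = Q + (\<i> * e * t) *\<^sub>C (c k + c k * Q)" for e :: real
  define Z' where "Z' e = Z + e *\<^sub>R y k" for e :: real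
  define \<Phi> where "\<Phi> e = B (Q' e) (Z' e) + \<i> * t * (\<Sum>j=Suc k..<n. B (c j + c j * Q' e) (y j))" for e
  have split: "(\<Sum>j=k..<n. g j) = g k + (\<Sum>j=Suc k..<n. g j)" for g :: "nat \<Rightarrow> complex"
    using Suc.prems by (simp add: sum.atLeast_Suc_lessThan)
  have B1: "B (Q' e) (Z' e) = B Q Z + e * B Q (y k) + (\<i> * e * t) * B (c k + c k * Q) Z
      + (\<i> * e\<^sup>2 * t) * B (c k + c k * Q) (y k)" for e
    by (simp add: Q'_def Z'_def B' scaleR_scaleC algebra_simps power2_eq_square)
  have B2: "B (c j + c j * Q' e) (y j) = B (c j + c j * Q) (y j) +
      e * (\<i> * t * B (c j * (c k + c k * Q)) (y j))" for e j
    by (simp add: Q'_def B' distrib_left mult_scaleC_right algebra_simps)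
  \<comment> \<open>The terms odd in e cancel, and the term with e^2 supplies exactly the summand j
    = k.\<close>
  have "\<Phi> 1 + \<Phi> (-1) = 2 * (B Q Z + \<i> * t * (\<Sum>j=k..<n. B (c j + c j * Q) (y j)))"
    unfolding \<Phi>_def B1 B2 split sum.distrib sum_distrib_left[symmetric]
    by (simp add: algebra_simps)
  then have "2 * cmod (B Q Z + \<i> * t * (\<Sum>j=k..<n. B (c j + c j * Q) (y j))) \<le> cmod (\<Phi> 1) + cmod (\<Phi> (-1))"
    using norm_triangle_ineq[of "\<Phi> 1" "\<Phi> (-1)"] by (metis norm_mult norm_numeral)
  then have "cmod (B Q Z + \<i> * t * (\<Sum>j=k..<n. B (c j + c j * Q) (y j))) \<le> cmod (\<Phi> 1) \<or>
      cmod (B Q Z + \<i> * t * (\<Sum>j=k..<n. B (c j + c j * Q) (y j))) \<le> cmod (\<Phi> (-1))"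
    by linarith
  then obtain e where e: "e = 1 \<or> e = -1"
    and le: "cmod (B Q Z + \<i> * t * (\<Sum>j=k..<n. B (c j + c j * Q) (y j))) \<le> cmod (\<Phi> e)"
    by blast
  have bound: "norm (x + Q' e * x) ^ 2 \<le> (1 + t\<^sup>2) ^ Suc k * norm x ^ 2" for x
  proof -
    define w where "w = x + Q * x"
    have e2: "e * e = 1" using e by auto
    have "x + Q' e * x = w + (\<i> * e * t) *\<^sub>C (c k * w)"
      by (simp add: Q'_def w_def algebra_simps mult_scaleC_left mult_scaleC_right)
    also have "norm \<dots> ^ 2 = norm (star w * w + (t * t) *\<^sub>R (star (c k * w) * (c k * w)))"
    proof -
      define \<alpha> where "\<alpha> = \<i> * complex_of_real e * complex_of_real t"
      have "\<alpha> * \<alpha> = (\<i> * \<i>) * (of_real (e * e) * of_real (t * t))"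
        by (simp only: \<alpha>_def of_real_mult ac_simps)
      then have \<alpha>\<alpha>: "\<alpha> * \<alpha> = - of_real (t * t)" unfolding e2 by simp
      have "star (w + \<alpha> *\<^sub>C (c k * w)) = star w - \<alpha> *\<^sub>C (c k * star w)"
        by (simp add: star_add star_scaleC star_mult c \<alpha>_def complex_vector.scale_minus_left mult.commute)
      moreover have "(star w - \<alpha> *\<^sub>C (c k * star w)) * (w + \<alpha> *\<^sub>C (c k * w)) =
          star w * w - (\<alpha> * \<alpha>) *\<^sub>C ((c k * star w) * (c k * w))"
        by (simp add: algebra_simps mult_scaleC_left mult_scaleC_right scaleC_scaleC)
      moreover have "\<dots> = star w * w + (t * t) *\<^sub>R (star (c k * w) * (c k * w))"
        unfolding \<alpha>\<alpha> scaleR_scaleC by (simp add: complex_vector.scale_minus_left star_mult c mult.commute)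
      ultimately show ?thesis
        unfolding norm_star_mult_self[symmetric] \<alpha>_def by simp
    qed
    also have "\<dots> \<le> norm w ^ 2 + (t * t) * norm (c k * w) ^ 2"
      by (rule order_trans[OF norm_triangle_ineq]) (simp add: norm_star_mult_self)
    also have "norm (c k * w) \<le> norm w"
      using norm_mult_le[of "c k" w] mult_right_mono[OF c(2)[of k] norm_ge_zero[of w]] by simp
    then have "(t * t) * norm (c k * w) ^ 2 \<le> (t * t) * norm w ^ 2"
      by (intro mult_left_mono power_mono) auto
    then have "norm w ^ 2 + (t * t) * norm (c k * w) ^ 2 \<le> (1 + t\<^sup>2) * norm w ^ 2"
      by (simp add: distrib_right power2_eq_square)
    also have "\<dots> \<le> (1 + t\<^sup>2) * ((1 + t\<^sup>2) ^ k * norm x ^ 2)"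
      unfolding w_def using IH(3) by (intro mult_left_mono) auto
    finally show ?thesis by (simp add: mult.assoc)
  qed
  have "Z' e = (\<Sum>j<Suc k. (\<epsilon>(k := e)) j *\<^sub>R y j)"
    by (simp add: Z'_def IH(2))
  then show ?case
    using e IH(1) bound order_trans[OF IH(4) le] unfolding \<Phi>_def
    by (intro exI[of _ "Q' e"] exI[of _ "Z' e"] exI[of _ "\<epsilon>(k := e)"]) auto
qed

text \<open>With t = 1 / sqrt n the Riesz product 1 + Q acts with norm at most 2 and the signed sum
  Z has norm below 2, so the rotated pairings add up to O(sqrt n). If all had modulus at least
  \<open>\<delta>\<close>, their sum would be of order n.\<close>

lemma no_nearly_orthogonal_pairing:
  fixes B :: "'a::commutative_cstar_algebra \<Rightarrow> 'a \<Rightarrow> complex"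
  assumes B: "bounded_bilinear_form B K" and "\<delta> > 0"
  obtains n where "\<And>c y. (\<And>j. j < n \<Longrightarrow> norm (c j) \<le> 1) \<Longrightarrow> (\<And>j. j < n \<Longrightarrow> norm (y j) \<le> 1) \<Longrightarrow>
    (\<And>i j. i < n \<Longrightarrow> j < n \<Longrightarrow> i \<noteq> j \<Longrightarrow> norm (y i * y j) \<le> 1 / (real n)\<^sup>2) \<Longrightarrow>
    \<exists>j<n. cmod (B (c j) (y j)) < \<delta>"
proof -
  note B' = bounded_bilinear_formD[OF B]
  \<comment> \<open>The bounds 3 for Q and 2 for Z give 6; the remaining factor 2 is lost in passing
    to self-adjoint elements.\<close>
  obtain n :: nat where "(12 * \<bar>K\<bar> / \<delta>)\<^sup>2 < real n"
    using reals_Archimedean2 by blast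
  then have n: "12 * \<bar>K\<bar> / \<delta> < sqrt (real n)" and n0: "0 < real n"
    using real_less_rsqrt order_le_less_trans[OF zero_le_power2] by blast+
  have contra: False
    if c: "\<And>j. j < n \<Longrightarrow> norm (c j) \<le> 1" and y: "\<And>j. j < n \<Longrightarrow> norm (y j) \<le> 1"
      and orth: "\<And>i j. i < n \<Longrightarrow> j < n \<Longrightarrow> i \<noteq> j \<Longrightarrow> norm (y i * y j) \<le> 1 / (real n)\<^sup>2"
      and ge: "\<And>j. j < n \<Longrightarrow> cmod (B (c j) (y j)) \<ge> \<delta>" for c y
  proof -
    \<comment> \<open>Riesz products need self-adjoint factors. The real or the imaginary part of
      c_j retains at least half of the pairing.\<close>
    have "\<exists>d. star d = d \<and> norm d \<le> 1 \<and> (j < n \<longrightarrow> cmod (B d (y j)) \<ge> \<delta> / 2)" for j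
    proof (cases "j < n")
      case True
      define h where "h = (1/2) *\<^sub>C (c j + star (c j))"
      define k where "k = (-\<i>/2) *\<^sub>C (c j - star (c j))"
      have h: "star h = h" "norm h \<le> 1"
        using norm_triangle_ineq[of "c j" "star (c j)"] c[OF True]
        by (simp_all add: h_def star_scaleC star_add star_star add.commute norm_scaleC norm_star)
      have "star k = (\<i>/2) *\<^sub>C (- (c j - star (c j)))"
        by (simp add: k_def star_scaleC star_diff star_star star_minus)
      also have "\<dots> = k"
        unfolding k_def complex_vector.scale_minus_right complex_vector.scale_minus_left[symmetric] by simp
      finally have k: "star k = k" "norm k \<le> 1"
        using norm_triangle_ineq4[of "c j" "star (c j)"] c[OF True]
        by (simp_all add: k_def norm_scaleC norm_star norm_divide)
      have "h + \<i> *\<^sub>C k = (1/2) *\<^sub>C ((c j + star (c j)) + (c j - star (c j)))"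
        unfolding h_def k_def scaleC_scaleC scaleC_add_right by simp
      also have "\<dots> = (1/2 + 1/2) *\<^sub>C c j"
        unfolding scaleC_add_left scaleC_add_right[symmetric] by simp
      finally have "c j = h + \<i> *\<^sub>C k" by (simp add: scaleC_one)
      then have "B (c j) (y j) = B h (y j) + \<i> * B k (y j)" by (simp add: B')
      then have "\<delta> \<le> cmod (B h (y j)) + cmod (B k (y j))"
        using ge[OF True] norm_triangle_ineq[of "B h (y j)" "\<i> * B k (y j)"] by (simp add: norm_mult)
      then have "\<delta> / 2 \<le> cmod (B h (y j)) \<or> \<delta> / 2 \<le> cmod (B k (y j))" by linarith
      then show ?thesis using h k by blast
    qed (auto intro!: exI[of _ 0] simp: star_zero)
    then obtain d where d: "\<And>j. star (d j) = d j" "\<And>j. norm (d j) \<le> 1"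
      "\<And>j. j < n \<Longrightarrow> cmod (B (d j) (y j)) \<ge> \<delta> / 2" by metis
    \<comment> \<open>These phases make every pairing nonnegative, so that the sum of the pairings
      is the sum of their moduli.\<close>
    define u where "u j = cnj (sgn (B (d j) (y j)))" for j
    have u: "u j * B (d j) (y j) = cmod (B (d j) (y j))" for j
      by (simp add: u_def sgn_eq complex_norm_square[symmetric] field_simps power2_eq_square)
    have u1: "norm (u j) \<le> 1" for j by (simp add: u_def norm_sgn)
    define t where "t = 1 / sqrt (real n)"
    obtain Q Z \<epsilon> where \<epsilon>: "\<And>j. \<epsilon> j = (1::real) \<or> \<epsilon> j = -1"
      and Z: "Z = (\<Sum>j<n. \<epsilon> j *\<^sub>R (u j *\<^sub>C y j))"
      and Q: "\<And>x. norm (x + Q * x) ^ 2 \<le> (1 + t\<^sup>2) ^ n * norm x ^ 2"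
      and le: "cmod (\<i> * t * (\<Sum>j<n. B (d j) (u j *\<^sub>C y j))) \<le> cmod (B Q Z)"
      using Riesz_product[where c = d and y = "\<lambda>j. u j *\<^sub>C y j" and t = t, OF B d(1,2) order_refl[of n]] by auto
    have "(1 + t\<^sup>2) ^ n \<le> exp (t\<^sup>2) ^ n"
      by (intro power_mono exp_ge_add_one_self) (simp add: add_nonneg_nonneg)
    also have "\<dots> = exp 1"
      using n0 by (simp add: exp_of_nat_mult[symmetric] t_def power_divide)
    also have "\<dots> \<le> 2\<^sup>2" using exp_le by simp
    finally have t4: "(1 + t\<^sup>2) ^ n \<le> 2\<^sup>2" .
    have "norm (Q * x) \<le> 3 * norm x" for x
    proof -
      have "norm (x + Q * x) ^ 2 \<le> (2 * norm x)\<^sup>2"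
        using order_trans[OF Q[of x] mult_right_mono[OF t4 zero_le_power2]] by (simp only: power_mult_distrib)
      then have "norm (x + Q * x) \<le> 2 * norm x" by (rule power2_le_imp_le) simp
      then show ?thesis using norm_triangle_ineq4[of "x + Q * x" x] by simp
    qed
    then have Q3: "norm Q \<le> 3" by (rule norm_le_multiplier) simp
    define z where "z j = (\<epsilon> j * u j) *\<^sub>C y j" for j
    have \<epsilon>u: "cmod (\<epsilon> j * u j) \<le> 1" for j
      using \<epsilon>[of j] u1[of j] by (auto simp: norm_mult)
    have "norm (\<Sum>j<n. z j) < 2"
    proof (rule norm_sum_nearly_orthogonal)
      show "norm (z j) \<le> 1" if "j < n" for j
        using mult_mono[OF \<epsilon>u[of j] y[OF that]] by (simp add: z_def norm_scaleC)
      show "norm (z i * z j) \<le> 1 / (real n)\<^sup>2" if "i < n" "j < n" "i \<noteq> j" for i j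
      proof -
        have "norm (z i * z j) = cmod (\<epsilon> i * u i) * (cmod (\<epsilon> j * u j) * norm (y i * y j))"
          by (simp only: z_def mult_scaleC_left mult_scaleC_right norm_scaleC mult.left_commute)
        also have "\<dots> \<le> 1 * (1 * (1 / (real n)\<^sup>2))"
          by (intro mult_mono \<epsilon>u orth that) auto
        finally show ?thesis by simp
      qed
    qed
    then have Z2: "norm Z \<le> 2" by (simp add: Z z_def scaleR_scaleC scaleC_scaleC)
    have "cmod (B Q Z) \<le> \<bar>K\<bar> * norm Q * norm Z"
      using B'(5)[of Q Z] abs_ge_self[of K] by (meson mult_right_mono norm_ge_zero order_trans)
    also have "\<dots> \<le> \<bar>K\<bar> * 3 * 2"
      by (intro mult_mono Q3 Z2) auto
    finally have "cmod (\<i> * t * (\<Sum>j<n. B (d j) (u j *\<^sub>C y j))) \<le> 6 * \<bar>K\<bar>"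
      using le by simp
    moreover have eq: "(\<Sum>j<n. B (d j) (u j *\<^sub>C y j)) = of_real (\<Sum>j<n. cmod (B (d j) (y j)))"
      by (simp add: B' u)
    have "cmod (\<i> * t * of_real (\<Sum>j<n. cmod (B (d j) (y j)))) = t * (\<Sum>j<n. cmod (B (d j) (y j)))"
      by (simp add: norm_mult t_def sum_nonneg norm_divide del: of_real_sum)
    ultimately have "t * (\<Sum>j<n. cmod (B (d j) (y j))) \<le> 6 * \<bar>K\<bar>"
      unfolding eq by linarith
    moreover have "real n * (\<delta> / 2) \<le> (\<Sum>j<n. cmod (B (d j) (y j)))"
      using sum_mono[of "{..<n}" "\<lambda>_. \<delta> / 2" "\<lambda>j. cmod (B (d j) (y j))"] d(3) by simp
    then have "t * (real n * (\<delta> / 2)) \<le> t * (\<Sum>j<n. cmod (B (d j) (y j)))"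
      by (rule mult_left_mono) (simp add: t_def)
    ultimately have "t * (real n * (\<delta> / 2)) \<le> 6 * \<bar>K\<bar>"
      by linarith
    moreover have "t * real n = sqrt (real n)"
      using n0 by (simp add: t_def real_div_sqrt)
    ultimately have "sqrt (real n) * (\<delta> / 2) \<le> 6 * \<bar>K\<bar>" by (simp only: mult.assoc[symmetric])
    then show False using n \<open>\<delta> > 0\<close> by (simp add: field_simps)
  qed
  show thesis
  proof (rule that, rule ccontr)
    fix c y :: "nat \<Rightarrow> 'a"
    assume a: "\<And>j. j < n \<Longrightarrow> norm (c j) \<le> 1" "\<And>j. j < n \<Longrightarrow> norm (y j) \<le> 1"
      "\<And>i j. i < n \<Longrightarrow> j < n \<Longrightarrow> i \<noteq> j \<Longrightarrow> norm (y i * y j) \<le> 1 / (real n)\<^sup>2"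
      and none: "\<not> (\<exists>j<n. cmod (B (c j) (y j)) < \<delta>)"
    have "\<And>j. j < n \<Longrightarrow> cmod (B (c j) (y j)) \<ge> \<delta>" using none by (meson not_less)
    with a show False by (rule contra[of c y])
  qed
qed

section \<open>Resolvents of skew-adjoint elements\<close>

text \<open>In a unitization 1 + s inverts 1 - r. Without a unit, s is found as the fixed point of
  the contraction that sends x to r + r x.\<close>

lemma Neumann_quasi_inverse:
  fixes r :: "'a::complex_banach_algebra"
  assumes "norm r < 1"
  obtains s where "s = r + r * s"
proof -
  have "\<exists>!s. r + r * s = s"
  proof (rule banach_fix_type[of "norm r"])
    have "dist (r + r * x) (r + r * y) = norm (r * (x - y))" for x y
      by (simp add: dist_norm algebra_simps)
    then show "\<forall>x y. dist (r + r * x) (r + r * y) \<le> norm r * dist x y"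
      by (simp add: dist_norm norm_mult_le)
  qed (use assms in auto)
  then show thesis using that by metis
qed

text \<open>The equation for b says that 1 - b inverts 1 + w, so \<open>norm_le_skew\<close> applies
  to (1 - b) x.\<close>

lemma norm_minus_resolvent_mult:
  fixes w b x :: "'a::commutative_cstar_algebra"
  assumes "star w = - w" and "b + w * b = w"
  shows "norm (x - b * x) \<le> norm x"
proof -
  have "(x - b * x) + w * (x - b * x) = x + (w - (b + w * b)) * x"
    by (simp add: algebra_simps)
  then show ?thesis
    using norm_le_skew[OF assms(1), of "x - b * x"] assms(2) by simp
qed

text \<open>The formal inverse 1 - b of 1 + n g is a contraction for every n. Hence adding g once
  more is always a perturbation small enough for a Neumann inverse.\<close>

lemma skew_resolvent:
  fixes g :: "'a::commutative_cstar_algebra"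
  assumes "star g = - g" and "norm g \<le> 1 / 2"
  shows "\<exists>b. b + (real n *\<^sub>R g) * b = real n *\<^sub>R g"
proof (induction n)
  case 0
  show ?case by (rule exI[of _ 0]) simp
next
  case (Suc n)
  define w where "w = real n *\<^sub>R g"
  have w: "star w = - w"
    by (simp add: w_def scaleR_scaleC star_scaleC assms(1) complex_vector.scale_minus_right)
  from Suc obtain b where b: "b + w * b = w" unfolding w_def by blast
  \<comment> \<open>Here 1 + w + g = (1 + w)(1 - r). Its inverse is (1 - b)(1 + s) = 1 - (b - s + b
    s), which gives the new witness.\<close>
  define r where "r = b * g - g"
  have "norm r \<le> norm g"
    unfolding r_def using norm_minus_resolvent_mult[OF w b, of g] by (simp add: norm_minus_commute)
  then have "norm r < 1" using assms(2) by simp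
  then obtain s where s: "s = r + r * s" by (rule Neumann_quasi_inverse)
  have "(b - s + b * s) + (w + g) * (b - s + b * s) - (w + g) =
      (b + w * b - w) + (b + w * b - w) * s + (r + r * s - s)"
    by (simp add: r_def algebra_simps)
  also have "\<dots> = 0" using b s by simp
  finally have "(b - s + b * s) + (w + g) * (b - s + b * s) = w + g" by simp
  moreover have "real (Suc n) *\<^sub>R g = w + g" by (simp add: w_def algebra_simps)
  ultimately show ?case by metis
qed

text \<open>From b_n = n g (1 - b_n) and the bound on b_n it follows that g (1 - b_n) is O(1/n). The
  same identity for b_m writes it as a multiple of g and passes the convergence on to b_m
  b_n.\<close>

lemma skew_approximate_identity:
  fixes g :: "'a::commutative_cstar_algebra"
  assumes "star g = - g" and "norm g \<le> 1 / 2"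
  obtains b where "\<And>n. b n = real n *\<^sub>R (g - g * b n)" "\<And>n. norm (b n) \<le> 2"
    "(\<lambda>n. g * b n) \<longlonglongrightarrow> g" "\<And>m. (\<lambda>n. b m * b n) \<longlonglongrightarrow> b m"
proof -
  obtain b where b: "\<And>n. b n + (real n *\<^sub>R g) * b n = real n *\<^sub>R g"
    using skew_resolvent[OF assms] by metis
  have skew: "star (real n *\<^sub>R g) = - (real n *\<^sub>R g)" for n
    by (simp add: scaleR_scaleC star_scaleC assms(1) complex_vector.scale_minus_right)
  note contr = norm_minus_resolvent_mult[OF skew b]
  have b': "b n = real n *\<^sub>R (g - g * b n)" for n
    using b[of n] by (simp add: algebra_simps)
  have b2: "norm (b n) \<le> 2" for n
  proof (rule norm_le_multiplier)
    show "norm (b n * x) \<le> 2 * norm x" for x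
      using norm_triangle_ineq4[of x "x - b n * x"] contr[of x n] by simp
  qed simp
  have gb: "norm (g - g * b n) \<le> 2 / real n" if "n \<ge> 1" for n
  proof -
    have "real n * norm (g - g * b n) = norm (b n)"
      by (subst (2) b') simp
    then show ?thesis using b2[of n] that by (simp add: field_simps)
  qed
  have lim: "(\<lambda>n. c * (2 / real n)) \<longlonglongrightarrow> 0" for c
    using lim_const_over_n[of "c * 2"] by simp
  have "(\<lambda>n. g * b n - g) \<longlonglongrightarrow> 0"
    by (rule Lim_null_comparison[OF eventually_sequentiallyI[of 1] lim[of 1]])
       (use gb in \<open>simp add: norm_minus_commute\<close>)
  then have 1: "(\<lambda>n. g * b n) \<longlonglongrightarrow> g" by (simp add: LIM_zero_iff)
  have "(\<lambda>n. b m * b n - b m) \<longlonglongrightarrow> 0" for m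
  proof (rule Lim_null_comparison[OF eventually_sequentiallyI[of 1] lim[of "real m"]])
    fix n :: nat
    assume n: "1 \<le> n"
    define u where "u = g - g * b n"
    have "b m - b m * b n = real m *\<^sub>R (u - b m * u)"
      by (subst (1 2) b'[of m]) (simp add: u_def algebra_simps)
    then have "norm (b m * b n - b m) = real m * norm (u - b m * u)"
      by (simp add: norm_minus_commute)
    also have "\<dots> \<le> real m * (2 / real n)"
      using order_trans[OF contr[of u m] gb[OF n, folded u_def]] by (rule mult_left_mono) simp
    finally show "norm (b m * b n - b m) \<le> real m * (2 / real n)" .
  qed
  then have "(\<lambda>n. b m * b n) \<longlonglongrightarrow> b m" for m by (simp add: LIM_zero_iff)
  with b' b2 1 show thesis by (rule that)
qed

text \<open>Otherwise violating differences exist with indices as large as desired. Since b_k almost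
  fixes b_m for large k, sparse indices make these differences nearly orthogonal, against
  \<open>no_nearly_orthogonal_pairing\<close>. The factor d is there for estimating norms of
  functionals F box (a tensor b_n).\<close>

lemma approximate_identity_pairing_Cauchy:
  fixes B :: "'a::commutative_cstar_algebra \<Rightarrow> 'a \<Rightarrow> complex"
  assumes B: "bounded_bilinear_form B K"
    and b2: "\<And>n. norm (b n) \<le> 2" and lim: "\<And>m. (\<lambda>n. b m * b n) \<longlonglongrightarrow> b m" and "\<delta> > 0"
  shows "\<exists>N. \<forall>p\<ge>N. \<forall>q\<ge>N. \<forall>c. norm c \<le> 1 \<longrightarrow> cmod (B c (b p - b q)) < \<delta> \<and>
    (\<forall>d. norm d \<le> 1 \<longrightarrow> cmod (B c ((b p - b q) * d)) < \<delta>)"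
proof (rule ccontr)
  define G where "G p q c y \<longleftrightarrow> norm c \<le> 1 \<and> \<delta> \<le> cmod (B c y) \<and>
    (y = b p - b q \<or> (\<exists>d. norm d \<le> 1 \<and> y = (b p - b q) * d))" for p q c y
  assume "\<not> ?thesis"
  then have "\<forall>N. \<exists>p\<ge>N. \<exists>q\<ge>N. \<exists>c y. G p q c y"
    unfolding G_def by (metis not_less)
  then obtain p q c y where pq: "\<And>N. p N \<ge> N" "\<And>N. q N \<ge> N" and G: "\<And>N. G (p N) (q N) (c N) (y N)"
    by metis
  \<comment> \<open>The differences have norm at most 4 and are divided by 4 below.\<close>
  from \<open>\<delta> > 0\<close> have "\<delta> / 4 > 0" by simp
  then obtain n where n: "\<And>c y. (\<And>j. j < n \<Longrightarrow> norm (c j) \<le> 1) \<Longrightarrow> (\<And>j. j < n \<Longrightarrow> norm (y j) \<le> 1) \<Longrightarrow>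
    (\<And>i j. i < n \<Longrightarrow> j < n \<Longrightarrow> i \<noteq> j \<Longrightarrow> norm (y i * y j) \<le> 1 / (real n)\<^sup>2) \<Longrightarrow>
    \<exists>j<n. cmod (B (c j) (y j)) < \<delta> / 4"
    using no_nearly_orthogonal_pairing[OF B] by metis
  have n0: "n > 0" using n[of "\<lambda>_. 0" "\<lambda>_. 0"] by fastforce
  have "\<exists>M. \<forall>m\<le>N. \<forall>k\<ge>M. norm (b m - b m * b k) \<le> 1 / (real n)\<^sup>2" for N
  proof -
    have "\<forall>\<^sub>F k in sequentially. norm (b m - b m * b k) \<le> 1 / (real n)\<^sup>2" for m
      using tendstoD[OF lim[of m], of "1 / (real n)\<^sup>2"] n0
      by (auto simp: dist_norm norm_minus_commute elim!: eventually_mono)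
    then have "\<forall>\<^sub>F k in sequentially. \<forall>m\<in>{..N}. norm (b m - b m * b k) \<le> 1 / (real n)\<^sup>2"
      by (intro eventually_ball_finite) auto
    then show ?thesis by (auto simp: eventually_sequentially)
  qed
  then obtain M where M: "\<And>N m k. m \<le> N \<Longrightarrow> k \<ge> M N \<Longrightarrow> norm (b m - b m * b k) \<le> 1 / (real n)\<^sup>2"
    by metis
  \<comment> \<open>From \<open>L N\<close> on, every b_k almost fixes both b's chosen at stage N.
    The maximum with N makes the iterates monotone.\<close>
  define L where "L N = max N (M (max (p N) (q N)))" for N
  define N where "N j = (L ^^ j) 0" for j
  have "mono N"
    unfolding mono_iff_le_Suc by (simp add: N_def L_def)
  have Nij: "N j \<ge> M (max (p (N i)) (q (N i)))" if "i < j" for i j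
  proof -
    have "N (Suc i) \<le> N j" using \<open>mono N\<close> that by (simp add: monoD)
    then show ?thesis by (simp add: N_def L_def)
  qed
  define z where "z j = (1/4) *\<^sub>R y (N j)" for j
  have e4: "norm (b i - b j) \<le> 4" for i j
    using norm_triangle_ineq4[of "b i" "b j"] b2[of i] b2[of j] by simp
  have y4: "norm (y j) \<le> 4" for j
  proof -
    have "norm ((b (p j) - b (q j)) * d) \<le> 4" if "norm d \<le> 1" for d
      using norm_mult_le[of "b (p j) - b (q j)" d] mult_mono[OF e4[of "p j" "q j"] that] by simp
    then show ?thesis using G[of j] e4[of "p j" "q j"] unfolding G_def by metis
  qed
  have orth: "norm (z i * z j) \<le> 1 / (real n)\<^sup>2" if "i < j" for i j
  proof -
    define e where "e k = b (p (N k)) - b (q (N k))" for k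
    have small: "norm (b m - b m * b k) \<le> 1 / (real n)\<^sup>2"
      if "m = p (N i) \<or> m = q (N i)" "k = p (N j) \<or> k = q (N j)" for m k
      using that order_trans[OF Nij[OF \<open>i < j\<close>] pq(1)] order_trans[OF Nij[OF \<open>i < j\<close>] pq(2)]
      by (intro M[of _ "max (p (N i)) (q (N i))"]) auto
    define f where "f m k = b m - b m * b k" for m k
    \<comment> \<open>Replacing each b_m b_k by b_m would make the product vanish, so only four
      small errors remain.\<close>
    have "e i * e j = (f (p (N i)) (q (N j)) - f (p (N i)) (p (N j))) +
        (f (q (N i)) (p (N j)) - f (q (N i)) (q (N j)))"
      by (simp add: e_def f_def algebra_simps)
    also have "norm \<dots> \<le> (norm (f (p (N i)) (q (N j))) + norm (f (p (N i)) (p (N j)))) +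
        (norm (f (q (N i)) (p (N j))) + norm (f (q (N i)) (q (N j))))"
      by (rule order_trans[OF norm_triangle_ineq add_mono[OF norm_triangle_ineq4 norm_triangle_ineq4]])
    also have "\<dots> \<le> 4 / (real n)\<^sup>2"
      using small[folded f_def, of "p (N i)" "p (N j)"] small[folded f_def, of "p (N i)" "q (N j)"]
        small[folded f_def, of "q (N i)" "p (N j)"] small[folded f_def, of "q (N i)" "q (N j)"] by simp
    finally have ee: "norm (e i * e j) \<le> 4 / (real n)\<^sup>2" .
    have le_d: "norm (v * d) \<le> norm v" if "norm d \<le> 1" for v d :: 'a
      using norm_mult_le[of v d] mult_left_mono[OF that norm_ge_zero[of v]] by simp
    have "norm (y (N i) * y (N j)) \<le> norm (e i * y (N j))"
      using G[of "N i"] le_d[of _ "e i * y (N j)"] unfolding G_def e_def[symmetric]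
      by (auto simp: ac_simps)
    also have "\<dots> \<le> norm (e i * e j)"
      using G[of "N j"] le_d[of _ "e i * e j"] unfolding G_def e_def[symmetric]
      by (auto simp: ac_simps)
    finally have "norm (y (N i) * y (N j)) \<le> 4 / (real n)\<^sup>2" using ee by simp
    also have "\<dots> \<le> 16 / (real n)\<^sup>2" by (rule divide_right_mono) auto
    finally show ?thesis by (simp add: z_def)
  qed
  have "\<exists>j<n. cmod (B (c (N j)) (z j)) < \<delta> / 4"
  proof (rule n)
    show "norm (c (N j)) \<le> 1" for j using G[of "N j"] unfolding G_def by blast
    show "norm (z j) \<le> 1" for j using y4[of "N j"] by (simp add: z_def)
    show "norm (z i * z j) \<le> 1 / (real n)\<^sup>2" if "i \<noteq> j" for i j
      using orth[of i j] orth[of j i] that by (cases "i < j") (auto simp: mult.commute)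
  qed
  then obtain j where "cmod (B (c (N j)) (z j)) < \<delta> / 4" by blast
  moreover have "cmod (B (c (N j)) (z j)) = cmod (B (c (N j)) (y (N j))) / 4"
    by (simp add: z_def scaleR_scaleC bounded_bilinear_formD[OF B] norm_mult norm_divide)
  ultimately show False using G[of "N j"] unfolding G_def by simp
qed

section \<open>Functionals and slice maps on projective tensor products\<close>

lemma bounded_linear_scaleC: "bounded_linear (\<lambda>x::'a::complex_normed_vector. c *\<^sub>C x)"
  by (rule bounded_linear_intro[of _ "cmod c"])
    (simp_all add: scaleC_add_right scaleR_scaleC scaleC_scaleC norm_scaleC mult.commute)

lemma bounded_linear_cdual_apply: "bounded_linear (cdual_apply f)"
  unfolding cdual_apply.rep_eq by (rule blinfun.bounded_linear_right)

lemmas cdual_apply_zero_right = linear_0[OF bounded_linear.linear[OF bounded_linear_cdual_apply]]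
lemmas cdual_apply_diff_right = linear_diff[OF bounded_linear.linear[OF bounded_linear_cdual_apply]]
lemmas tendsto_cdual_apply = bounded_linear.tendsto[OF bounded_linear_cdual_apply]

lemma cdual_apply_diff: "cdual_apply (f - g) x = cdual_apply f x - cdual_apply g x"
  by transfer (simp add: blinfun.bilinear_simps)

text \<open>Complex homogeneity survives pointwise limits, so completeness is inherited from the
  space of bounded real-linear maps.\<close>

instance cdual :: (complex_normed_vector) banach
proof
  fix f :: "nat \<Rightarrow> 'a cdual"
  assume "Cauchy f"
  have dist: "dist (cdual_blinfun f) (cdual_blinfun g) = dist f g" for f g :: "'a cdual"
    by (simp add: dist_norm norm_cdual.rep_eq minus_cdual.rep_eq)
  have "Cauchy (\<lambda>n. cdual_blinfun (f n))"
    using \<open>Cauchy f\<close> unfolding Cauchy_def dist .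
  then obtain L where L: "(\<lambda>n. cdual_blinfun (f n)) \<longlonglongrightarrow> L"
    by (auto simp: Cauchy_convergent_iff convergent_def)
  have "blinfun_apply L (c *\<^sub>C x) = c * blinfun_apply L x" for c x
  proof (rule LIMSEQ_unique)
    have lim: "(\<lambda>n. blinfun_apply (cdual_blinfun (f n)) x) \<longlonglongrightarrow> blinfun_apply L x" for x
      by (intro tendsto_intros L)
    show "(\<lambda>n. blinfun_apply (cdual_blinfun (f n)) (c *\<^sub>C x)) \<longlonglongrightarrow> blinfun_apply L (c *\<^sub>C x)"
      by (rule lim)
    show "(\<lambda>n. blinfun_apply (cdual_blinfun (f n)) (c *\<^sub>C x)) \<longlonglongrightarrow> c * blinfun_apply L x"
      using tendsto_mult_left[OF lim[of x], of c] by (simp add: cdual_apply.rep_eq[symmetric] cdual_apply_scaleC)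
  qed
  then have "cdual_blinfun (Abs_cdual L) = L" by (simp add: Abs_cdual_inverse)
  then have "f \<longlonglongrightarrow> Abs_cdual L"
    using L unfolding lim_sequentially by (metis dist)
  then show "convergent f" by (rule convergentI)
qed

section \<open>Elementary tensors and norms of functionals\<close>

definition ptensor :: "'a::complex_normed_vector \<Rightarrow> 'b::complex_normed_vector \<Rightarrow> ('a, 'b) proj_tensor"
  where "ptensor x y = of_tensor (elem_tensor x y)"

lemma ptensor_simps:
  "ptensor (x + x') y = ptensor x y + ptensor x' y"
  "ptensor x (y + y') = ptensor x y + ptensor x y'"
  "ptensor (c *\<^sub>C x) y = c *\<^sub>C ptensor x y"
  "ptensor x (c *\<^sub>C y) = c *\<^sub>C ptensor x y"
  by (simp_all only: ptensor_def elem_tensor_add_left elem_tensor_add_right elem_tensor_scaleC_left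
    elem_tensor_scaleC_right of_tensor_add of_tensor_scaleC)

lemma ptensor_mult: "ptensor a b * ptensor c d = ptensor (a * c) (b * d)"
  by (simp only: ptensor_def of_tensor_mult[symmetric] elem_tensor_mult)

lemma ptensor_diff_right: "ptensor x (y - y') = ptensor x y - ptensor x y'"
  using ptensor_simps(2)[of x "y - y'" y'] by (simp add: eq_diff_eq)

lemma norm_ptensor_le: "norm (ptensor x y) \<le> norm x * norm y"
  by (simp only: ptensor_def norm_of_tensor proj_norm_elem)

lemma bounded_bilinear_form_ptensor:
  "bounded_bilinear_form (\<lambda>x y. cdual_apply F (ptensor x y)) (norm F)"
proof -
  have "cmod (cdual_apply F (ptensor x y)) \<le> norm F * norm x * norm y" for x y
    using order_trans[OF norm_cdual_apply mult_left_mono[OF norm_ptensor_le norm_ge_zero], of F x y]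
    by (simp add: mult.assoc)
  then show ?thesis
    by (simp add: bounded_bilinear_form_def ptensor_simps cdual_apply_add cdual_apply_scaleC)
qed

lemma of_tensor_sequence:
  obtains t where "(\<lambda>n. of_tensor (t n)) \<longlonglongrightarrow> z"
proof -
  have "\<exists>t. dist (of_tensor t) z < 1 / real (Suc n)" for n
    by (rule of_tensor_dense) simp
  then obtain t where t: "\<And>n. dist (of_tensor (t n)) z < 1 / real (Suc n)" by metis
  have "(\<lambda>n. of_tensor (t n)) \<longlonglongrightarrow> z"
  proof (rule LIM_zero_cancel, rule Lim_null_comparison)
    show "\<forall>\<^sub>F n in sequentially. norm (of_tensor (t n) - z) \<le> inverse (real (Suc n))"
      using t by (intro always_eventually allI less_imp_le) (simp only: dist_norm inverse_eq_divide)
  qed (rule LIMSEQ_inverse_real_of_nat)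
  then show thesis by (rule that)
qed

text \<open>A functional is no larger than its bilinear form: estimate a finite representation
  termwise, take the infimum over representations, and pass to the completion by density.\<close>

lemma norm_cdual_proj_tensor_le:
  fixes G :: "('a::complex_normed_vector, 'b::complex_normed_vector) proj_tensor cdual"
  assumes K: "0 \<le> K" and bd: "\<And>x y. cmod (cdual_apply G (ptensor x y)) \<le> K * norm x * norm y"
  shows "norm G \<le> K"
proof (rule norm_cdual_bound[OF K])
  fix z :: "('a, 'b) proj_tensor"
  have rep: "cmod (cdual_apply G (of_tensor (\<Sum>(x, y)\<in>#M. elem_tensor x y))) \<le>
      K * (\<Sum>(x, y)\<in>#M. norm x * norm y)" for M :: "('a \<times> 'b) multiset"
  proof (induction M)
    case empty
    have "of_tensor (0 :: ('a, 'b) tensor) = 0"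
      using norm_of_tensor[of "0 :: ('a, 'b) tensor"] by (simp add: proj_norm_zero)
    then show ?case by (simp add: cdual_apply_zero_right)
  next
    case (add p M)
    obtain x y where p: "p = (x, y)" by (cases p)
    show ?case
      using norm_triangle_le[OF add_mono[OF bd[of x y] add]]
      by (simp add: p of_tensor_add cdual_apply_add ptensor_def distrib_left mult.assoc)
  qed
  have tensor: "cmod (cdual_apply G (of_tensor t)) \<le> K * norm (of_tensor t)" for t
  proof (rule field_le_epsilon)
    fix e :: real assume "e > 0"
    then obtain d where d: "d > 0" "K * d \<le> e" using small_factor[OF K] by blast
    obtain M where M: "t = (\<Sum>(x, y)\<in>#M. elem_tensor x y)"
      "(\<Sum>(x, y)\<in>#M. norm x * norm y) < proj_norm t + d"
      using proj_norm_approx[OF d(1)] .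
    have "cmod (cdual_apply G (of_tensor t)) \<le> K * (\<Sum>(x, y)\<in>#M. norm x * norm y)"
      unfolding M(1) by (rule rep)
    also have "\<dots> \<le> K * (proj_norm t + d)"
      by (rule mult_left_mono[OF less_imp_le[OF M(2)] K])
    finally show "cmod (cdual_apply G (of_tensor t)) \<le> K * norm (of_tensor t) + e"
      using d(2) by (simp add: norm_of_tensor distrib_left)
  qed
  obtain t where t: "(\<lambda>n. of_tensor (t n)) \<longlonglongrightarrow> z" by (rule of_tensor_sequence)
  show "cmod (cdual_apply G z) \<le> K * norm z"
    by (rule LIMSEQ_le[OF tendsto_norm[OF tendsto_cdual_apply[OF t]]
        tendsto_mult_left[OF tendsto_norm[OF t]]]) (use tensor in blast)
qed

lemma cdual_proj_tensor_eqI: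
  assumes "\<And>x y. cdual_apply F (ptensor x y) = cdual_apply G (ptensor x y)"
  shows "F = G"
  using norm_cdual_proj_tensor_le[of 0 "F - G"] assms by (simp add: cdual_apply_diff)

text \<open>Weak-star continuity is tested coordinatewise, and evaluation at a fixed g is weak-star
  continuous.\<close>

lemma topological_centreI:
  assumes "\<And>f. \<exists>g. \<forall>Y. cdual_apply (X \<box> Y) f = cdual_apply Y g"
  shows "X \<in> topological_centre"
proof -
  from assms obtain g where g: "\<And>f Y. cdual_apply (X \<box> Y) f = cdual_apply Y (g f)" by metis
  have ev: "continuous_map weak_star_topology euclidean (\<lambda>Y. cdual_apply Y f)" for f :: "'a cdual"
  proof -
    have "continuous_map weak_star_topology (product_topology (\<lambda>_. euclidean) UNIV)
        (cdual_apply :: 'a cdual cdual \<Rightarrow> _)"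
      unfolding weak_star_topology_def using continuous_map_pullback[OF continuous_map_id]
      by (simp add: id_def o_def)
    then show ?thesis by (simp add: continuous_map_componentwise_UNIV)
  qed
  have "continuous_map weak_star_topology (product_topology (\<lambda>_. euclidean) UNIV)
      (cdual_apply \<circ> (\<lambda>Y. X \<box> Y))"
    unfolding continuous_map_componentwise_UNIV by (simp add: g ev)
  then have "continuous_map weak_star_topology weak_star_topology (\<lambda>Y. X \<box> Y)"
    unfolding weak_star_topology_def[where 'a = "'a cdual"]
    by (rule continuous_map_pullback') simp
  then show ?thesis by (simp add: topological_centre_def)
qed

lemma bidual_embed_in_topological_centre: "bidual_embed a \<in> topological_centre"
  by (rule topological_centreI) (auto simp: cdual_apply_arens cdual_apply_bidual_embed cdual_apply_bidual_box)

section \<open>Slice maps, which apply a functional to the first tensor factor\<close>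

definition slice_multiset ::
  "'a::complex_normed_vector cdual \<Rightarrow> ('a \<times> 'b::complex_vector) multiset \<Rightarrow> 'b"
  where "slice_multiset \<phi> M = (\<Sum>(x, y)\<in>#M. cdual_apply \<phi> x *\<^sub>C y)"

lemma slice_multiset_cong: "tensor_eq M N \<Longrightarrow> slice_multiset \<phi> M = slice_multiset \<phi> N"
  by (induction rule: tensor_eq.induct)
    (auto simp: slice_multiset_def cdual_apply_add cdual_apply_scaleC cdual_apply_zero_right
      scaleC_add_left scaleC_add_right scaleC_scaleC mult.commute)

definition slice_tensor ::
  "'a::complex_normed_vector cdual \<Rightarrow> ('a, 'b::complex_vector) tensor \<Rightarrow> 'b"
  where "slice_tensor \<phi> u = slice_multiset \<phi> (rep_tensor u)"

lemma slice_tensor_abs: "slice_tensor \<phi> (abs_tensor M) = slice_multiset \<phi> M"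
  unfolding slice_tensor_def
  by (rule slice_multiset_cong) (rule Quotient3_rep_abs[OF Quotient3_tensor], rule tensor_eq.refl)

lemma slice_tensor_simps:
  fixes u v :: "('a::complex_normed_vector, 'b::complex_vector) tensor"
  shows "slice_tensor \<phi> (u + v) = slice_tensor \<phi> u + slice_tensor \<phi> v"
  "slice_tensor \<phi> (elem_tensor x y) = cdual_apply \<phi> x *\<^sub>C y"
  "slice_tensor \<phi> (c *\<^sub>C u) = c *\<^sub>C slice_tensor \<phi> u"
proof -
  have rep: "\<exists>M. w = abs_tensor M" for w :: "('a, 'b) tensor"
    using Quotient3_abs_rep[OF Quotient3_tensor, of w] by metis
  obtain M N where MN: "u = abs_tensor M" "v = abs_tensor N" using rep by metis
  show "slice_tensor \<phi> (u + v) = slice_tensor \<phi> u + slice_tensor \<phi> v"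
    unfolding MN plus_tensor.abs_eq slice_tensor_abs by (simp add: slice_multiset_def)
  show "slice_tensor \<phi> (elem_tensor x y) = cdual_apply \<phi> x *\<^sub>C y"
    unfolding elem_tensor_def slice_tensor_abs[symmetric] by (simp add: slice_tensor_abs slice_multiset_def)
  have "slice_multiset \<phi> (image_mset (\<lambda>(x, y). (c *\<^sub>C x, y)) M) = c *\<^sub>C slice_multiset \<phi> M"
    by (induction M) (auto simp: slice_multiset_def cdual_apply_scaleC scaleC_add_right scaleC_scaleC
      complex_vector.scale_zero_right)
  then show "slice_tensor \<phi> (c *\<^sub>C u) = c *\<^sub>C slice_tensor \<phi> u"
    unfolding MN scaleC_tensor.abs_eq slice_tensor_abs .
qed

lemma slice_tensor_diff: "slice_tensor \<phi> (u - v) = slice_tensor \<phi> u - slice_tensor \<phi> v"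
  using slice_tensor_simps(1)[of \<phi> "u - v" v] by (simp add: eq_diff_eq)

lemma norm_slice_tensor:
  fixes u :: "('a::complex_normed_vector, 'b::complex_normed_vector) tensor"
  shows "norm (slice_tensor \<phi> u) \<le> norm \<phi> * proj_norm u"
proof (rule field_le_epsilon)
  fix e :: real assume "e > 0"
  then obtain d where d: "d > 0" "norm \<phi> * d \<le> e" using small_factor[OF norm_ge_zero] by blast
  obtain M where M: "u = (\<Sum>(x, y)\<in>#M. elem_tensor x y)"
    "(\<Sum>(x, y)\<in>#M. norm x * norm y) < proj_norm u + d"
    using proj_norm_approx[OF d(1)] .
  have "norm (slice_tensor \<phi> (\<Sum>(x, y)\<in>#M. elem_tensor x y)) \<le> norm \<phi> * (\<Sum>(x, y)\<in>#M. norm x * norm y)"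
  proof (induction M)
    case empty
    show ?case using slice_tensor_diff[of \<phi> "0::('a,'b) tensor" 0] by simp
  next
    case (add p M)
    obtain x y where p: "p = (x, y)" by (cases p)
    have "norm (cdual_apply \<phi> x *\<^sub>C y) \<le> norm \<phi> * (norm x * norm y)"
      using mult_right_mono[OF norm_cdual_apply[of \<phi> x] norm_ge_zero[of y]]
      by (simp add: norm_scaleC mult.assoc)
    from norm_triangle_le[OF add_mono[OF this add]] show ?case
      by (simp add: p slice_tensor_simps distrib_left)
  qed
  also have "\<dots> \<le> norm \<phi> * (proj_norm u + d)"
    by (rule mult_left_mono[OF less_imp_le[OF M(2)] norm_ge_zero])
  finally show "norm (slice_tensor \<phi> u) \<le> norm \<phi> * proj_norm u + e"
    using d(2) unfolding M(1)[symmetric] by (simp add: distrib_left)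
qed

definition slice ::
  "'a::complex_normed_vector cdual \<Rightarrow> ('a, 'b::{complex_normed_vector, banach}) proj_tensor \<Rightarrow> 'b"
  where "slice \<phi> z = lim (\<lambda>n. slice_tensor \<phi> (rep_proj_tensor z n))"

text \<open>Slicing is Lipschitz for the projective norm and so extends to the completion; the value
  does not depend on the representing sequence chosen in the definition.\<close>

lemma slice_LIMSEQ:
  fixes z :: "('a::complex_normed_vector, 'b::{complex_normed_vector, banach}) proj_tensor"
  assumes "(\<lambda>n. of_tensor (t n)) \<longlonglongrightarrow> z"
  shows "(\<lambda>n. slice_tensor \<phi> (t n)) \<longlonglongrightarrow> slice \<phi> z"
proof -
  define u where "u = rep_proj_tensor z"
  have "proj_eq u u" and "abs_proj_tensor u = z"
    unfolding u_def using Quotient3_rep_reflp[OF Quotient3_proj_tensor] Quotient3_abs_rep[OF Quotient3_proj_tensor]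
    by blast+
  then have u: "(\<lambda>n. of_tensor (u n)) \<longlonglongrightarrow> z"
    using abs_proj_tensor_LIMSEQ unfolding proj_eq_refl_iff by metis
  have le: "norm (slice_tensor \<phi> v - slice_tensor \<phi> w) \<le> norm \<phi> * norm (of_tensor v - of_tensor w)"
    for v w :: "('a, 'b) tensor"
    by (simp only: slice_tensor_diff[symmetric] of_tensor_diff[symmetric] norm_of_tensor norm_slice_tensor)
  have "Cauchy (\<lambda>n. slice_tensor \<phi> (u n))"
  proof (rule metric_CauchyI)
    fix e :: real assume e: "0 < e"
    have "Cauchy (\<lambda>n. of_tensor (u n))" using u by (rule LIMSEQ_imp_Cauchy)
    moreover have pos: "e / (norm \<phi> + 1) > 0" using e by (simp add: add_nonneg_pos)
    ultimately obtain N where N: "\<And>m n. m \<ge> N \<Longrightarrow> n \<ge> N \<Longrightarrow>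
        dist (of_tensor (u m)) (of_tensor (u n)) < e / (norm \<phi> + 1)"
      unfolding Cauchy_def by blast
    have "dist (slice_tensor \<phi> (u m)) (slice_tensor \<phi> (u n)) < e" if "m \<ge> N" "n \<ge> N" for m n
    proof -
      have "dist (slice_tensor \<phi> (u m)) (slice_tensor \<phi> (u n)) \<le>
          (norm \<phi> + 1) * dist (of_tensor (u m)) (of_tensor (u n))"
        unfolding dist_norm by (rule order_trans[OF le]) (simp add: distrib_right)
      also have "\<dots> < e"
        using N[OF that] by (simp add: pos_less_divide_eq add_nonneg_pos mult.commute)
      finally show ?thesis .
    qed
    then show "\<exists>M. \<forall>m\<ge>M. \<forall>n\<ge>M. dist (slice_tensor \<phi> (u m)) (slice_tensor \<phi> (u n)) < e" by blast
  qed
  then have lim_u: "(\<lambda>n. slice_tensor \<phi> (u n)) \<longlonglongrightarrow> slice \<phi> z"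
    unfolding slice_def u_def by (simp add: Cauchy_convergent_iff convergent_LIMSEQ_iff)
  have "(\<lambda>n. norm \<phi> * norm (of_tensor (t n) - of_tensor (u n))) \<longlonglongrightarrow> 0"
    using tendsto_norm_zero[OF tendsto_diff[OF assms u, simplified]] by (rule tendsto_mult_right_zero)
  then have "(\<lambda>n. slice_tensor \<phi> (t n) - slice_tensor \<phi> (u n)) \<longlonglongrightarrow> 0"
    by (rule Lim_null_comparison[rotated]) (simp add: le)
  from tendsto_add[OF this lim_u] show ?thesis by simp
qed

lemma slice_add: "slice \<phi> (y + z) = slice \<phi> y + slice \<phi> z"
proof -
  obtain s t where st: "(\<lambda>n. of_tensor (s n)) \<longlonglongrightarrow> y" "(\<lambda>n. of_tensor (t n)) \<longlonglongrightarrow> z"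
    by (metis of_tensor_sequence)
  have "(\<lambda>n. slice_tensor \<phi> (s n + t n)) \<longlonglongrightarrow> slice \<phi> (y + z)"
    by (rule slice_LIMSEQ) (simp only: of_tensor_add tendsto_add[OF st])
  moreover have "(\<lambda>n. slice_tensor \<phi> (s n + t n)) \<longlonglongrightarrow> slice \<phi> y + slice \<phi> z"
    unfolding slice_tensor_simps by (intro tendsto_add slice_LIMSEQ st)
  ultimately show ?thesis by (rule LIMSEQ_unique)
qed

lemma slice_scaleC: "slice \<phi> (c *\<^sub>C z) = c *\<^sub>C slice \<phi> z"
proof -
  obtain t where t: "(\<lambda>n. of_tensor (t n)) \<longlonglongrightarrow> z" by (rule of_tensor_sequence)
  have "(\<lambda>n. slice_tensor \<phi> (c *\<^sub>C t n)) \<longlonglongrightarrow> slice \<phi> (c *\<^sub>C z)"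
    by (rule slice_LIMSEQ) (simp only: of_tensor_scaleC bounded_linear.tendsto[OF bounded_linear_scaleC t])
  moreover have "(\<lambda>n. slice_tensor \<phi> (c *\<^sub>C t n)) \<longlonglongrightarrow> c *\<^sub>C slice \<phi> z"
    unfolding slice_tensor_simps by (intro bounded_linear.tendsto[OF bounded_linear_scaleC] slice_LIMSEQ t)
  ultimately show ?thesis by (rule LIMSEQ_unique)
qed

lemma norm_slice: "norm (slice \<phi> z) \<le> norm \<phi> * norm z"
proof -
  obtain t where t: "(\<lambda>n. of_tensor (t n)) \<longlonglongrightarrow> z" by (rule of_tensor_sequence)
  show ?thesis
    by (rule LIMSEQ_le[OF tendsto_norm[OF slice_LIMSEQ[OF t]] tendsto_mult_left[OF tendsto_norm[OF t]]])
      (simp add: norm_of_tensor norm_slice_tensor)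
qed

lemma slice_ptensor: "slice \<phi> (ptensor x y) = cdual_apply \<phi> x *\<^sub>C y"
  using LIMSEQ_unique[OF slice_LIMSEQ[of "\<lambda>_. elem_tensor x y" "ptensor x y" \<phi>] tendsto_const]
  by (simp add: ptensor_def slice_tensor_simps)

text \<open>This F is the tensor product of the two functionals. It turns weak convergence of
  tensors into weak convergence of their slices.\<close>

lemma cdual_compose_slice:
  obtains F where "\<And>z. cdual_apply F z = cdual_apply \<psi> (slice \<phi> z)"
proof
  have "cmod (cdual_apply \<psi> (slice \<phi> z)) \<le> (norm \<psi> * norm \<phi>) * norm z" for z
    using order_trans[OF norm_cdual_apply mult_left_mono[OF norm_slice norm_ge_zero], of \<psi> \<phi> z]
    by (simp add: mult.assoc)
  then show "cdual_apply (cdual_of (\<lambda>z. cdual_apply \<psi> (slice \<phi> z))) z = cdual_apply \<psi> (slice \<phi> z)" for z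
    by (intro cdual_apply_cdual_of[where K = "norm \<psi> * norm \<phi>"])
      (simp_all add: slice_add slice_scaleC cdual_apply_add cdual_apply_scaleC)
qed

section \<open>The Hahn--Banach theorem\<close>

text \<open>An inequality for positive c is what constructions by infima yield directly; equality
  for all nonnegative c follows in \<open>sublinear_scaleR\<close>.\<close>

definition sublinear :: "('a::real_vector \<Rightarrow> real) \<Rightarrow> bool" where
  "sublinear p \<longleftrightarrow> (\<forall>x y. p (x + y) \<le> p x + p y) \<and> (\<forall>c>0. \<forall>x. p (c *\<^sub>R x) \<le> c * p x)"

lemma sublinear_add: "sublinear p \<Longrightarrow> p (x + y) \<le> p x + p y"
  by (simp add: sublinear_def)

lemma sublinear_scaleR:
  assumes "sublinear p" "0 \<le> c"
  shows "p (c *\<^sub>R x) = c * p x"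
proof (cases "c = 0")
  case True
  have "p (2 *\<^sub>R 0) \<le> 2 * p 0" "p ((1/2) *\<^sub>R 0) \<le> (1/2) * p 0"
    using assms(1) unfolding sublinear_def by (simp_all only: zero_less_numeral zero_less_divide_1_iff)
  then show ?thesis using True by simp
next
  case False
  then have c: "c > 0" using assms(2) by simp
  have "p ((1/c) *\<^sub>R (c *\<^sub>R x)) \<le> (1/c) * p (c *\<^sub>R x)"
    using assms(1) c unfolding sublinear_def by (simp only: zero_less_divide_1_iff)
  then have "c * p x \<le> p (c *\<^sub>R x)" using c by (simp add: field_simps)
  moreover have "p (c *\<^sub>R x) \<le> c * p x" using assms(1) c unfolding sublinear_def by blast
  ultimately show ?thesis by simp
qed

lemma sublinear_minus: "sublinear p \<Longrightarrow> - p (- x) \<le> p x"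
  using sublinear_add[of p x "- x"] sublinear_scaleR[of p 0 0] by simp

text \<open>In the infimum defining q, t = 0 gives q \<le> p and t = 1 gives the bound at -y. This
  makes minimal sublinear functionals odd, and it also serves to force positivity at a prescribed
  point.\<close>

lemma sublinear_tilt:
  assumes p: "sublinear p"
  obtains q where "sublinear q" "\<And>x. q x \<le> p x" "q (- y) \<le> - p y"
proof -
  define f where "f x t = p (x + t *\<^sub>R y) - t * p y" for x t
  define q where "q x = (INF t\<in>{0..}. f x t)" for x
  have bdd: "bdd_below (f x ` {0..})" for x
  proof (rule bdd_belowI2)
    fix t :: real assume "t \<in> {0..}"
    then have "t * p y = p ((x + t *\<^sub>R y) + (- x))"
      using sublinear_scaleR[OF p, of t y] by simp
    also have "\<dots> \<le> p (x + t *\<^sub>R y) + p (- x)" by (rule sublinear_add[OF p])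
    finally show "- p (- x) \<le> f x t" by (simp add: f_def)
  qed
  have q_le: "q x \<le> f x t" if "t \<ge> 0" for x t
    unfolding q_def using that by (intro cINF_lower[OF bdd]) simp
  have q_ge: "m \<le> q x" if "\<And>t. t \<ge> 0 \<Longrightarrow> m \<le> f x t" for x m
    unfolding q_def using that by (intro cINF_greatest) auto
  have "q (x + x') - q x \<le> q x'" for x x'
  proof (rule q_ge)
    fix t' :: real assume t': "t' \<ge> 0"
    have "q (x + x') - f x' t' \<le> q x"
    proof (rule q_ge)
      fix t :: real assume t: "t \<ge> 0"
      have "q (x + x') \<le> f (x + x') (t + t')" using t t' by (intro q_le) simp
      also have "\<dots> \<le> f x t + f x' t'"
        using sublinear_add[OF p, of "x + t *\<^sub>R y" "x' + t' *\<^sub>R y"] by (simp add: f_def algebra_simps)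
      finally show "q (x + x') - f x' t' \<le> f x t" by simp
    qed
    then show "q (x + x') - q x \<le> f x' t'" by simp
  qed
  moreover have "q (c *\<^sub>R x) \<le> c * q x" if c: "c > 0" for c x
  proof -
    have "q (c *\<^sub>R x) / c \<le> q x"
    proof (rule q_ge)
      fix t :: real assume t: "t \<ge> 0"
      have "q (c *\<^sub>R x) \<le> f (c *\<^sub>R x) (c * t)" using c t by (intro q_le) simp
      also have "\<dots> = c * f x t"
        using sublinear_scaleR[OF p, of c "x + t *\<^sub>R y"] c by (simp add: f_def algebra_simps)
      finally show "q (c *\<^sub>R x) / c \<le> f x t" using c by (simp add: field_simps)
    qed
    then show ?thesis using c by (simp add: field_simps)
  qed
  ultimately have "sublinear q" unfolding sublinear_def by (simp add: algebra_simps)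
  moreover have "q x \<le> p x" for x using q_le[of 0 x] by (simp add: f_def)
  moreover have "q (- y) \<le> - p y"
    using q_le[of 1 "- y"] sublinear_scaleR[OF p, of 0 y] by (simp add: f_def)
  ultimately show thesis by (rule that)
qed

text \<open>Minimal sublinear functionals are linear, so this is the Hahn--Banach theorem.\<close>

lemma sublinear_dominates_linear:
  fixes p :: "'a::real_vector \<Rightarrow> real"
  assumes p: "sublinear p"
  obtains u where "linear u" "\<And>x. u x \<le> p x"
proof -
  define A where "A = {q. sublinear q \<and> q \<le> p}"
  have "\<exists>m\<in>A. \<forall>a\<in>A. m \<ge> a \<longrightarrow> a = m"
  proof (rule predicate_Zorn)
    show "partial_order_on A (relation_of (\<ge>) A)"
      by (rule partial_order_on_relation_ofI) auto
  next
    fix C assume C: "C \<in> Chains (relation_of (\<ge>) A)"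
    show "\<exists>u\<in>A. \<forall>a\<in>C. a \<ge> u"
    proof (cases "C = {}")
      case True
      then show ?thesis using p by (auto simp: A_def)
    next
      case False
      have CA: "C \<subseteq> A" using C by (rule Chains_relation_of)
      have total: "a \<le> b \<or> b \<le> a" if "a \<in> C" "b \<in> C" for a b
        using C that unfolding Chains_def relation_of_def by blast
      define u where "u x = (INF r\<in>C. r x)" for x
      have bdd: "bdd_below ((\<lambda>r. r x) ` C)" for x
      proof (rule bdd_belowI2)
        fix r assume "r \<in> C"
        then have r: "sublinear r" "r \<le> p" using CA by (auto simp: A_def)
        then show "- p (- x) \<le> r x"
          using sublinear_minus[OF r(1), of x] le_funD[OF r(2), of "- x"] by simp
      qed
      have u_le: "u x \<le> r x" if "r \<in> C" for r x
        unfolding u_def using that by (rule cINF_lower[OF bdd])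
      have u_ge: "m \<le> u x" if "\<And>r. r \<in> C \<Longrightarrow> m \<le> r x" for m x
        unfolding u_def using False that by (intro cINF_greatest) auto
      have "u (x + y) - u x \<le> u y" for x y
      proof (rule u_ge)
        fix r assume r: "r \<in> C"
        have "u (x + y) - r y \<le> u x"
        proof (rule u_ge)
          fix s assume s: "s \<in> C"
          obtain m where m: "m \<in> C" "m \<le> r" "m \<le> s" using total[OF r s] r s by blast
          then have "sublinear m" using CA by (auto simp: A_def)
          then have "u (x + y) \<le> m x + m y"
            using u_le[OF m(1), of "x + y"] sublinear_add[of m x y] by linarith
          then show "u (x + y) - r y \<le> s x"
            using le_funD[OF m(2), of y] le_funD[OF m(3), of x] by linarith
        qed
        then show "u (x + y) - u x \<le> r y" by simp
      qed
      moreover have "u (c *\<^sub>R x) \<le> c * u x" if c: "c > 0" for c x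
      proof -
        have "u (c *\<^sub>R x) / c \<le> u x"
        proof (rule u_ge)
          fix r assume r: "r \<in> C"
          then have "sublinear r" using CA by (auto simp: A_def)
          then show "u (c *\<^sub>R x) / c \<le> r x"
            using u_le[OF r, of "c *\<^sub>R x"] sublinear_scaleR[of r c x] c by (simp add: field_simps)
        qed
        then show ?thesis using c by (simp add: field_simps)
      qed
      ultimately have "sublinear u" unfolding sublinear_def by (simp add: algebra_simps)
      moreover have "u \<le> p"
      proof -
        obtain r where r: "r \<in> C" using False by blast
        then have "r \<le> p" using CA by (auto simp: A_def)
        then show ?thesis using u_le[OF r] by (meson le_fun_def order_trans)
      qed
      ultimately have "u \<in> A" by (simp add: A_def)
      then show ?thesis using u_le by (auto simp: le_fun_def)
    qed
  qed
  then obtain m where m: "sublinear m" "m \<le> p"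
    and min: "\<And>q. sublinear q \<Longrightarrow> q \<le> m \<Longrightarrow> q = m"
    unfolding A_def by (auto intro: order_trans)
  \<comment> \<open>By minimality the tilt of m at y is m itself. Once m is odd, subadditivity
    becomes additivity.\<close>
  have minus: "m (- y) = - m y" for y
  proof -
    obtain q where q: "sublinear q" "\<And>x. q x \<le> m x" "q (- y) \<le> - m y"
      using sublinear_tilt[OF m(1)] by blast
    then have "q = m" by (intro min) (auto simp: le_fun_def)
    then show ?thesis using q(3) sublinear_minus[OF m(1), of y] by simp
  qed
  have "linear m"
  proof (rule linearI)
    fix x y
    have "m ((x + y) + (- y)) \<le> m (x + y) + m (- y)" by (rule sublinear_add[OF m(1)])
    then show "m (x + y) = m x + m y"
      using sublinear_add[OF m(1), of x y] by (simp add: minus)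
  next
    fix c x
    show "m (c *\<^sub>R x) = c *\<^sub>R m x"
      using sublinear_scaleR[OF m(1), of c x] sublinear_scaleR[OF m(1), of "- c" x] minus[of "c *\<^sub>R x"]
      by (cases "0 \<le> c") auto
  qed
  then show thesis using that[of m] m(2) by (simp add: le_fun_def)
qed

section \<open>Separation of a point from a closed subspace\<close>

lemma sublinear_infdist:
  fixes S :: "'a::real_normed_vector set"
  assumes "subspace S"
  shows "sublinear (\<lambda>x. infdist x S)"
  unfolding sublinear_def
proof (intro conjI allI impI)
  have ne: "S \<noteq> {}" using subspace_0[OF assms] by blast
  have approx: "\<exists>s\<in>S. norm (x - s) < infdist x S + e" if "e > 0" for x e
    using cInf_lessD[of "dist x ` S" "infdist x S + e"] ne that by (auto simp: infdist_def dist_norm)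
  show "infdist (x + y) S \<le> infdist x S + infdist y S" for x y
  proof (rule field_le_epsilon)
    fix e :: real assume "e > 0"
    then have e: "e / 2 > 0" by simp
    obtain s t where st: "s \<in> S" "norm (x - s) < infdist x S + e / 2" "t \<in> S" "norm (y - t) < infdist y S + e / 2"
      using approx[OF e] by metis
    have "infdist (x + y) S \<le> norm ((x + y) - (s + t))"
      using infdist_le[OF subspace_add[OF assms st(1,3)], of "x + y"] by (simp add: dist_norm)
    also have "\<dots> \<le> norm (x - s) + norm (y - t)"
      by (rule norm_diff_triangle_ineq)
    finally show "infdist (x + y) S \<le> infdist x S + infdist y S + e" using st by simp
  qed
  show "infdist (c *\<^sub>R x) S \<le> c * infdist x S" if c: "c > 0" for c x
  proof (rule field_le_epsilon)
    fix e :: real assume e: "e > 0"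
    then obtain s where s: "s \<in> S" "norm (x - s) < infdist x S + e / c"
      using approx[of "e / c" x] c by auto
    have "infdist (c *\<^sub>R x) S \<le> norm (c *\<^sub>R x - c *\<^sub>R s)"
      using infdist_le[OF subspace_scale[OF assms s(1)], of "c *\<^sub>R x"] by (simp add: dist_norm)
    also have "\<dots> = c * norm (x - s)"
      using c by (simp add: scaleR_diff_right[symmetric])
    also have "\<dots> \<le> c * (infdist x S + e / c)"
      using c s(2) by (intro mult_left_mono) auto
    finally show "infdist (c *\<^sub>R x) S \<le> c * infdist x S + e" using c by (simp add: distrib_left)
  qed
qed

lemma scaleC_eq_scaleR:
  "c *\<^sub>C (x::'a::complex_vector) = Re c *\<^sub>R x + Im c *\<^sub>R (\<i> *\<^sub>C x)"
  unfolding scaleR_scaleC scaleC_scaleC scaleC_add_left[symmetric]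
  by (simp add: complex_eq[symmetric] mult.commute[of _ \<i>])

lemma Hahn_Banach_cdual:
  fixes S :: "'a::complex_normed_vector set"
  assumes S: "complex_vector.subspace S" and y: "y \<notin> closure S"
  obtains \<phi> where "\<And>s. s \<in> S \<Longrightarrow> cdual_apply \<phi> s = 0" "cdual_apply \<phi> y \<noteq> 0"
proof -
  have S': "subspace S"
    using S unfolding subspace_def complex_vector.subspace_def by (simp add: scaleR_scaleC)
  have S0: "0 \<in> S" using subspace_0[OF S'] .
  \<comment> \<open>Tilting the distance at y first ensures that a linear u below q has u y at least
    the distance from y to S.\<close>
  obtain q where q: "sublinear q" "\<And>x. q x \<le> infdist x S" "q (- y) \<le> - infdist y S"
    using sublinear_tilt[OF sublinear_infdist[OF S']] by blast
  obtain u where u: "linear u" "\<And>x. u x \<le> q x"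
    using sublinear_dominates_linear[OF q(1)] by blast
  have u_le: "u x \<le> infdist x S" for x using u(2) q(2) order_trans by blast
  have u_minus: "u (- x) = - u x" for x using u(1) by (rule linear_neg)
  have u_abs: "\<bar>u x\<bar> \<le> norm x" for x
    using u_le[of x] u_le[of "- x"] infdist_le[OF S0, of x] infdist_le[OF S0, of "- x"]
    by (simp add: u_minus abs_le_iff)
  have u_S: "u s = 0" if "s \<in> S" for s
    using u_le[of s] u_le[of "- s"] infdist_zero[OF that] infdist_zero[OF subspace_neg[OF S' that]]
    by (simp add: u_minus)
  \<comment> \<open>The complex-linear functional with real part u.\<close>
  define f where "f x = Complex (u x) (- u (\<i> *\<^sub>C x))" for x
  have u_scaleC: "u (c *\<^sub>C x) = Re c * u x + Im c * u (\<i> *\<^sub>C x)" for c x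
    by (subst scaleC_eq_scaleR) (simp add: linear_add[OF u(1)] linear_scale[OF u(1)])
  have app: "cdual_apply (cdual_of f) x = f x" for x
  proof (rule cdual_apply_cdual_of[where K = 2])
    show "f (x + y) = f x + f y" for x y
      by (simp add: f_def linear_add[OF u(1)] scaleC_add_right complex_eq_iff)
    show "f (c *\<^sub>C x) = c * f x" for c x
      unfolding f_def scaleC_scaleC u_scaleC[of c] u_scaleC[of "\<i> * c"] by (simp add: complex_eq_iff)
    show "cmod (f x) \<le> 2 * norm x" for x
      using cmod_le[of "f x"] u_abs[of x] u_abs[of "\<i> *\<^sub>C x"] by (simp add: f_def norm_scaleC)
  qed
  have "infdist y S > 0"
    using y S0 in_closure_iff_infdist_zero[of S y] infdist_nonneg[of y S] by fastforce
  then have "u y > 0" using u(2)[of "- y"] q(3) by (simp add: u_minus)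
  then have "f y \<noteq> 0" by (simp add: f_def complex_eq_iff)
  moreover have "f s = 0" if "s \<in> S" for s
    using u_S[OF that] u_S[OF complex_vector.subspace_scale[OF S that, of \<i>]]
    by (simp add: f_def complex_eq_iff)
  ultimately show thesis using that[of "cdual_of f"] app by simp
qed

lemma cdual_separates:
  fixes x y :: "'a::complex_normed_vector"
  assumes "\<And>\<phi>. cdual_apply \<phi> x = cdual_apply \<phi> y"
  shows "x = y"
proof (rule ccontr)
  assume "x \<noteq> y"
  then have "x - y \<notin> closure {0}" by simp
  then obtain \<phi> where "cdual_apply \<phi> (x - y) \<noteq> 0"
    using Hahn_Banach_cdual[OF complex_vector.subspace_single_0] by blast
  moreover have "cdual_apply \<phi> (x - y) + cdual_apply \<phi> y = cdual_apply \<phi> x"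
    unfolding cdual_apply_add[symmetric] by simp
  ultimately show False using assms[of \<phi>] by simp
qed

section \<open>Strong Arens irregularity implies von Neumann regularity\<close>

lemma functional_box_diff: "functional_box F (a - b) = functional_box F a - functional_box F b"
  using functional_box_linear(3)[of F "a - b" b] by (simp add: eq_diff_eq)

text \<open>On c tensor d the difference of two functionals is F (a c tensor (b_p - b_q) d). The
  estimate uniform in c and d therefore controls its norm.\<close>

lemma approximate_identity_functional_box_Cauchy:
  fixes F :: "'a::commutative_cstar_algebra varopoulos cdual"
  assumes a: "norm a \<le> 1"
    and b: "\<And>n. norm (b n) \<le> 2" "\<And>m. (\<lambda>n. b m * b n) \<longlonglongrightarrow> b m"
  shows "Cauchy (\<lambda>n. cdual_apply F (ptensor a (b n)))"
    and "Cauchy (\<lambda>n. functional_box F (ptensor a (b n)))"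
proof -
  note small = approximate_identity_pairing_Cauchy[OF bounded_bilinear_form_ptensor[of F] b]
  show "Cauchy (\<lambda>n. cdual_apply F (ptensor a (b n)))"
    unfolding Cauchy_def dist_norm cdual_apply_diff_right[symmetric] ptensor_diff_right[symmetric]
    using small a by meson
  show "Cauchy (\<lambda>n. functional_box F (ptensor a (b n)))"
    unfolding Cauchy_def dist_norm functional_box_diff[symmetric] ptensor_diff_right[symmetric]
  proof (intro allI impI)
    fix e :: real assume e: "0 < e"
    then obtain N where N: "\<And>p q c d. N \<le> p \<Longrightarrow> N \<le> q \<Longrightarrow> norm c \<le> 1 \<Longrightarrow> norm d \<le> 1 \<Longrightarrow>
        cmod (cdual_apply F (ptensor c ((b p - b q) * d))) < e / 2"
      using small[of "e / 2"] by (metis half_gt_zero)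
    have "norm (functional_box F (ptensor a (b p - b q))) < e" if pq: "N \<le> p" "N \<le> q" for p q
    proof -
      have "norm (functional_box F (ptensor a (b p - b q))) \<le> e / 2"
      proof (rule norm_cdual_proj_tensor_le)
        show "0 \<le> e / 2" using e by simp
        fix c d :: 'a
        show "cmod (cdual_apply (functional_box F (ptensor a (b p - b q))) (ptensor c d))
            \<le> e / 2 * norm c * norm d"
        proof (cases "c = 0 \<or> d = 0")
          case True
          have "ptensor c d = 0" using True norm_ptensor_le[of c d] by auto
          then show ?thesis using e by (simp add: cdual_apply_zero_right)
        next
          case False
          define c' where "c' = complex_of_real (1 / norm c) *\<^sub>C c"
          define d' where "d' = complex_of_real (1 / norm d) *\<^sub>C d"
          have norms: "norm c' = 1" "norm d' = 1"
            using False by (simp_all add: c'_def d'_def norm_scaleC norm_divide)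
          have cd: "c = complex_of_real (norm c) *\<^sub>C c'" "d = complex_of_real (norm d) *\<^sub>C d'"
            using False by (simp_all add: c'_def d'_def scaleC_scaleC scaleC_one)
          have "norm (a * c') \<le> 1"
            using norm_mult_le[of a c'] a norms by simp
          then have "cmod (cdual_apply F (ptensor (a * c') ((b p - b q) * d'))) < e / 2"
            using N[OF pq] norms by simp
          then have "norm c * norm d * cmod (cdual_apply F (ptensor (a * c') ((b p - b q) * d')))
              \<le> norm c * norm d * (e / 2)"
            by (intro mult_left_mono) auto
          moreover have "cmod (cdual_apply (functional_box F (ptensor a (b p - b q))) (ptensor c d)) =
              norm c * norm d * cmod (cdual_apply F (ptensor (a * c') ((b p - b q) * d')))"
            by (subst cd(1), subst cd(2)) (simp add: cdual_apply_functional_box ptensor_mult ptensor_simps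
              mult_scaleC_right cdual_apply_scaleC norm_mult)
          ultimately show ?thesis by (simp add: ac_simps)
        qed
      qed
      then show ?thesis using e by simp
    qed
    then show "\<exists>M. \<forall>m\<ge>M. \<forall>n\<ge>M. norm (functional_box F (ptensor a (b m - b n))) < e" by blast
  qed
qed

text \<open>
  The weak-star limit of \<open>a \<otimes> b\<^sub>n\<close> lies in the topological centre since the functionals
  \<open>F \<box> (a \<otimes> b\<^sub>n)\<close> converge in norm.
\<close>

lemma strongly_Arens_irregular_limit:
  assumes SAI: "strongly_Arens_irregular TYPE('a::commutative_cstar_algebra varopoulos)"
    and a: "norm (a::'a) \<le> 1"
    and b: "\<And>n. norm (b n :: 'a) \<le> 2" "\<And>m. (\<lambda>n. b m * b n) \<longlonglongrightarrow> b m"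
  obtains v where "\<And>F. (\<lambda>n. cdual_apply F (ptensor a (b n))) \<longlonglongrightarrow> cdual_apply F v"
proof -
  define L where "L F = lim (\<lambda>n. cdual_apply F (ptensor a (b n)))" for F :: "'a varopoulos cdual"
  have L: "(\<lambda>n. cdual_apply F (ptensor a (b n))) \<longlonglongrightarrow> L F" for F
    using approximate_identity_functional_box_Cauchy(1)[OF a b, of F]
    by (simp add: L_def Cauchy_convergent_iff convergent_LIMSEQ_iff)
  have X: "cdual_apply (cdual_of L) F = L F" for F
  proof (rule cdual_apply_cdual_of[where K = 2])
    show "L (F + G) = L F + L G" for F G
      by (rule LIMSEQ_unique[OF L]) (simp add: cdual_apply_simps tendsto_add L)
    show "L (c *\<^sub>C F) = c * L F" for c F
      by (rule LIMSEQ_unique[OF L]) (simp add: cdual_apply_simps tendsto_mult_left L)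
    show "cmod (L F) \<le> 2 * norm F" for F
    proof (rule LIMSEQ_le_const2[OF tendsto_norm[OF L]], intro exI allI impI)
      fix n
      have "norm (ptensor a (b n)) \<le> 1 * 2"
        using norm_ptensor_le[of a "b n"] mult_mono[OF a b(1)[of n]] by simp
      then have "norm F * norm (ptensor a (b n)) \<le> norm F * 2"
        by (intro mult_left_mono) auto
      then show "cmod (cdual_apply F (ptensor a (b n))) \<le> 2 * norm F"
        using norm_cdual_apply[of F "ptensor a (b n)"] by simp
    qed
  qed
  have "cdual_of L \<in> topological_centre"
  proof (rule topological_centreI)
    fix F :: "'a varopoulos cdual"
    obtain G where G: "(\<lambda>n. functional_box F (ptensor a (b n))) \<longlonglongrightarrow> G"
      using approximate_identity_functional_box_Cauchy(2)[OF a b, of F]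
      by (auto simp: Cauchy_convergent_iff convergent_def)
    \<comment> \<open>Both sides are limits of Y (F box (a tensor b_n)): one by the definition of L,
      the other by norm convergence.\<close>
    have "cdual_apply (cdual_of L \<box> Y) F = cdual_apply Y G" for Y
    proof (rule LIMSEQ_unique)
      show "(\<lambda>n. cdual_apply (bidual_box Y F) (ptensor a (b n))) \<longlonglongrightarrow> cdual_apply (cdual_of L \<box> Y) F"
        unfolding cdual_apply_arens X by (rule L)
      show "(\<lambda>n. cdual_apply (bidual_box Y F) (ptensor a (b n))) \<longlonglongrightarrow> cdual_apply Y G"
        unfolding cdual_apply_bidual_box by (rule tendsto_cdual_apply[OF G])
    qed
    then show "\<exists>G. \<forall>Y. cdual_apply (cdual_of L \<box> Y) F = cdual_apply Y G" by blast
  qed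
  then obtain v where "cdual_of L = bidual_embed v"
    using SAI unfolding strongly_Arens_irregular_def by blast
  then have "L F = cdual_apply F v" for F
    using X[of F] by (simp add: cdual_apply_bidual_embed)
  then show thesis using that[of v] L by metis
qed

text \<open>Slicing the limit tensor by a functional with value 1 at g gives a weak limit y of b_n
  in the algebra. It satisfies g y = g and lies in the norm closure of g A, so it is close to some g
  x; a quasi-inverse removes the error.\<close>

lemma strongly_Arens_irregular_skew_regular:
  assumes SAI: "strongly_Arens_irregular TYPE('a::commutative_cstar_algebra varopoulos)"
    and g: "star (g::'a) = - g" "norm g \<le> 1 / 2"
  shows "\<exists>z. g = g * g * z"
proof (cases "g = 0")
  case False
  obtain b where b: "\<And>n. b n = real n *\<^sub>R (g - g * b n)" "\<And>n. norm (b n) \<le> 2"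
    "(\<lambda>n. g * b n) \<longlonglongrightarrow> g" "\<And>m. (\<lambda>n. b m * b n) \<longlonglongrightarrow> b m"
    using skew_approximate_identity[OF g] by blast
  obtain \<phi>\<^sub>0 where \<phi>\<^sub>0: "cdual_apply \<phi>\<^sub>0 g \<noteq> 0"
    using cdual_separates[of g 0] False by (auto simp: cdual_apply_zero_right)
  define \<phi> where "\<phi> = (1 / cdual_apply \<phi>\<^sub>0 g) *\<^sub>C \<phi>\<^sub>0"
  have \<phi>: "cdual_apply \<phi> g = 1" using \<phi>\<^sub>0 by (simp add: \<phi>_def cdual_apply_simps)
  have "norm g \<le> 1" using g(2) by simp
  then obtain v where v: "\<And>F. (\<lambda>n. cdual_apply F (ptensor g (b n))) \<longlonglongrightarrow> cdual_apply F v"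
    using strongly_Arens_irregular_limit[OF SAI _ b(2,4)] by blast
  define y where "y = slice \<phi> v"
  have y: "(\<lambda>n. cdual_apply \<psi> (b n)) \<longlonglongrightarrow> cdual_apply \<psi> y" for \<psi>
  proof -
    obtain F where F: "\<And>z. cdual_apply F z = cdual_apply \<psi> (slice \<phi> z)"
      using cdual_compose_slice[of \<psi> \<phi>] by metis
    show ?thesis using v[of F] by (simp add: F slice_ptensor \<phi> scaleC_one y_def)
  qed
  have gy: "g * y = g"
  proof (rule cdual_separates)
    fix \<psi> :: "'a cdual"
    have "(\<lambda>n. cdual_apply \<psi> (g * b n)) \<longlonglongrightarrow> cdual_apply \<psi> (g * y)"
      using y[of "functional_box \<psi> g"] by (simp add: cdual_apply_functional_box)
    moreover have "(\<lambda>n. cdual_apply \<psi> (g * b n)) \<longlonglongrightarrow> cdual_apply \<psi> g"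
      by (rule tendsto_cdual_apply[OF b(3)])
    ultimately show "cdual_apply \<psi> (g * y) = cdual_apply \<psi> g" by (rule LIMSEQ_unique)
  qed
  \<comment> \<open>A functional vanishing on g A vanishes at g = g y, hence at every b_n and at
    their weak limit y.\<close>
  have "y \<in> closure (range ((*) g))"
  proof (rule ccontr)
    assume "y \<notin> closure (range ((*) g))"
    moreover have "complex_vector.subspace (range ((*) g))"
      unfolding complex_vector.subspace_def
      by (auto simp: image_iff distrib_left[symmetric] mult_scaleC_right[symmetric] intro: exI[of _ 0])
    ultimately obtain \<psi> where \<psi>: "\<And>x. cdual_apply \<psi> (g * x) = 0" "cdual_apply \<psi> y \<noteq> 0"
      using Hahn_Banach_cdual by (metis rangeI)
    have "cdual_apply \<psi> g = 0" using gy \<psi>(1)[of y] by simp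
    then have "cdual_apply \<psi> (b n) = 0" for n
      by (subst b(1)) (simp add: scaleR_scaleC cdual_apply_scaleC cdual_apply_diff_right \<psi>(1))
    then have "cdual_apply \<psi> y = 0" using y[of \<psi>] LIMSEQ_unique[OF _ tendsto_const] by simp
    with \<psi>(2) show False by simp
  qed
  then obtain x where x: "dist (g * x) y < 1"
    unfolding closure_approachable by (metis imageE zero_less_one)
  \<comment> \<open>Since g y = g, formally g^2 x = g (1 - r), and 1 + s inverts 1 - r.\<close>
  define r where "r = y - g * x"
  obtain s where s: "s = r + r * s"
    using x Neumann_quasi_inverse[of r] by (auto simp: r_def dist_norm norm_minus_commute)
  have "g * g * (x + x * s) = g * (y - r) + g * (y - r) * s"
    by (simp add: r_def algebra_simps)
  also have "\<dots> = g * y + g * y * s - g * (r + r * s)"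
    by (simp add: algebra_simps)
  also have "\<dots> = g" using s gy by simp
  finally show ?thesis by metis
qed simp

text \<open>An imaginary multiple of \<open>star a * a\<close> is skew-adjoint, and its regularity
  gives a multiple q of \<open>star a * a\<close> that fixes \<open>star a * a\<close>. The
  C*-identity then yields a = a q.\<close>

lemma strongly_Arens_irregular_regular:
  assumes SAI: "strongly_Arens_irregular TYPE('a::commutative_cstar_algebra varopoulos)"
  shows "\<exists>z. (a::'a) = a * a * z"
proof (cases "a = 0")
  case False
  define u where "u = star a * a"
  have u0: "norm u > 0" using False by (simp add: u_def norm_star_mult_self)
  define c where "c = \<i> * complex_of_real (1 / (2 * norm u))"
  have c: "cnj c = - c" "cmod c * norm u = 1 / 2" "c \<noteq> 0"
    using u0 by (simp_all add: c_def norm_mult norm_divide)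
  have "star u = u" by (simp add: u_def star_mult star_star)
  then obtain z where z: "c *\<^sub>C u = (c *\<^sub>C u) * (c *\<^sub>C u) * z"
    using strongly_Arens_irregular_skew_regular[OF SAI, of "c *\<^sub>C u"] c
    by (auto simp: star_scaleC norm_scaleC complex_vector.scale_minus_left)
  define w where "w = a - a * (u * (c *\<^sub>C z))"
  have "c *\<^sub>C u = c *\<^sub>C (u * u * (c *\<^sub>C z))"
    using z by (simp add: mult_scaleC_left mult_scaleC_right)
  then have uz: "u = u * u * (c *\<^sub>C z)"
    using c(3) by (simp add: complex_vector.scale_cancel_left)
  define q where "q = u * (c *\<^sub>C z)"
  have uq: "u * q = u" using uz by (simp add: q_def mult.assoc)
  have w: "w = a - a * q" by (simp add: w_def q_def)
  have "star w * w = (u - u * q) - (u - u * q) * star q"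
    unfolding w by (simp add: star_diff star_mult u_def algebra_simps)
  then have "norm w ^ 2 = 0" unfolding norm_star_mult_self[symmetric] uq by simp
  then have "a = a * (u * (c *\<^sub>C z))" by (simp add: w_def)
  then have "a = a * a * (star a * (c *\<^sub>C z))" by (simp add: u_def ac_simps)
  then show ?thesis by blast
qed simp

section \<open>Von Neumann regular commutative Banach algebras\<close>

text \<open>The corner q A is a field with unit q. If x were not a scalar, its resolvent would be
  defined on the whole plane, weakly holomorphic and null at infinity, hence zero by Liouville's
  theorem.\<close>

lemma Gelfand_Mazur_corner:
  fixes q x :: "'a::{complex_normed_algebra, comm_ring}"
  assumes q: "q * q = q" "q \<noteq> 0"
    and inv: "\<And>y. q * y = y \<Longrightarrow> y \<noteq> 0 \<Longrightarrow> \<exists>r. q * r = r \<and> y * r = q"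
    and x: "q * x = x"
  obtains c where "x = c *\<^sub>C q"
proof -
  have "\<exists>c. x = c *\<^sub>C q"
  proof (rule ccontr)
    assume no: "\<not> ?thesis"
    have "\<exists>r. q * r = r \<and> (x - c *\<^sub>C q) * r = q" for c
      using no by (intro inv) (auto simp: right_diff_distrib mult_scaleC_right q x)
    then obtain r where r: "\<And>c. q * r c = r c" "\<And>c. (x - c *\<^sub>C q) * r c = q" by metis
    have resolvent: "r c - r d = (c - d) *\<^sub>C (r c * r d)" for c d
    proof -
      have "r c * ((x - d *\<^sub>C q) * r d) = r c" "((x - c *\<^sub>C q) * r c) * r d = r d"
        using r by (simp_all add: mult.commute)
      then have "r c - r d = r c * ((x - d *\<^sub>C q) * r d) - ((x - c *\<^sub>C q) * r c) * r d" by simp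
      also have "\<dots> = r c * (c *\<^sub>C (q * r d)) - r c * (d *\<^sub>C (q * r d))"
        by (simp add: algebra_simps mult_scaleC_left mult_scaleC_right)
      also have "\<dots> = (c - d) *\<^sub>C (r c * r d)"
        by (simp add: r mult_scaleC_right complex_vector.scale_left_diff_distrib)
      finally show ?thesis .
    qed
    have cont: "(r \<longlongrightarrow> r d) (at d)" for d
    proof (rule LIM_zero_cancel, rule Lim_null_comparison)
      define k where "k = norm (r d)"
      have k: "k \<ge> 0" by (simp add: k_def)
      show "((\<lambda>c. cmod (c - d) * (2 * k * k)) \<longlongrightarrow> 0) (at d)"
        by (rule tendsto_mult_left_zero, rule tendsto_norm_zero, rule LIM_zero, rule tendsto_ident_at)
      \<comment> \<open>For such c the resolvent identity gives norm (r c) \<le> k + norm (r c) / 2;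
        the 1 in the radius covers k = 0.\<close>
      have "norm (r c - r d) \<le> cmod (c - d) * (2 * k * k)" if c: "cmod (c - d) < 1 / (2 * k + 1)" for c
      proof -
        have le: "norm (r c - r d) \<le> cmod (c - d) * (norm (r c) * k)"
          unfolding resolvent norm_scaleC k_def by (intro mult_left_mono norm_mult_le) simp
        have "cmod (c - d) * k \<le> 1 / (2 * k + 1) * k"
          using c k by (intro mult_right_mono) auto
        also have "\<dots> \<le> 1 / 2" using k by (simp add: field_simps)
        finally have "norm (r c) * (cmod (c - d) * k) \<le> norm (r c) * (1 / 2)"
          by (rule mult_left_mono) simp
        then have "norm (r c) \<le> 2 * k"
          using le norm_triangle_sub[of "r c" "r d"] by (simp add: k_def[symmetric] mult.commute mult.left_commute)
        then have "cmod (c - d) * (norm (r c) * k) \<le> cmod (c - d) * (2 * k * k)"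
          using k by (intro mult_left_mono mult_right_mono) auto
        with le show ?thesis by simp
      qed
      moreover have "1 / (2 * k + 1) > 0" using k by (simp add: add_nonneg_pos)
      ultimately show "\<forall>\<^sub>F c in at d. norm (r c - r d) \<le> cmod (c - d) * (2 * k * k)"
        unfolding eventually_at dist_norm by blast
    qed
    have "cdual_apply \<phi> (r 0) = 0" for \<phi>
    proof (rule Liouville_weak_0[of "\<lambda>c. cdual_apply \<phi> (r c)"])
      have "((\<lambda>c. cdual_apply \<phi> (r c)) has_field_derivative cdual_apply \<phi> (r d * r d)) (at d)" for d
        unfolding has_field_derivative_iff
      proof (rule Lim_transform_eventually)
        show "((\<lambda>c. cdual_apply \<phi> (r c * r d)) \<longlongrightarrow> cdual_apply \<phi> (r d * r d)) (at d)"
          by (intro bounded_linear.tendsto[OF bounded_linear_cdual_apply] tendsto_mult cont tendsto_const)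
        have "cdual_apply \<phi> (r c) - cdual_apply \<phi> (r d) = (c - d) * cdual_apply \<phi> (r c * r d)" for c
          unfolding cdual_apply_diff_right[symmetric] resolvent cdual_apply_scaleC ..
        then show "\<forall>\<^sub>F c in at d. cdual_apply \<phi> (r c * r d) =
            (cdual_apply \<phi> (r c) - cdual_apply \<phi> (r d)) / (c - d)"
          unfolding eventually_at by (intro exI[of _ 1]) simp
      qed
      then show "(\<lambda>c. cdual_apply \<phi> (r c)) holomorphic_on UNIV"
        by (auto simp: holomorphic_on_open)
      show "((\<lambda>c. cdual_apply \<phi> (r c)) \<longlongrightarrow> 0) at_infinity"
      proof (rule Lim_null_comparison)
        show "((\<lambda>c::complex. (norm \<phi> * (2 * norm q)) / norm c) \<longlongrightarrow> 0) at_infinity"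
          by (intro tendsto_divide_0[OF tendsto_const] filterlim_at_top_imp_at_infinity filterlim_norm_at_top)
        \<comment> \<open>For these c the product x (r c) has at most half the norm of c (r c) and
          can be absorbed.\<close>
        have "cmod (cdual_apply \<phi> (r c)) \<le> (norm \<phi> * (2 * norm q)) / norm c"
          if c: "2 * norm x + 1 \<le> norm c" for c
        proof -
          have c0: "norm c > 0" using c norm_ge_zero[of x] by linarith
          have "c *\<^sub>C r c = x * r c - q"
            using r(2)[of c] by (simp add: left_diff_distrib mult_scaleC_left r(1) diff_eq_eq eq_diff_eq add.commute)
          then have "norm c * norm (r c) \<le> norm (x * r c) + norm q"
            by (metis norm_scaleC norm_triangle_ineq4)
          also have "\<dots> \<le> norm x * norm (r c) + norm q" by (simp add: norm_mult_le)
          also have "norm x * norm (r c) \<le> norm c / 2 * norm (r c)"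
            using c by (intro mult_right_mono) auto
          finally have "norm (r c) \<le> 2 * norm q / norm c" using c0 by (simp add: field_simps)
          then have "norm \<phi> * norm (r c) \<le> norm \<phi> * (2 * norm q / norm c)"
            by (rule mult_left_mono) simp
          then show ?thesis using norm_cdual_apply[of \<phi> "r c"] by simp
        qed
        then show "\<forall>\<^sub>F c in at_infinity. cmod (cdual_apply \<phi> (r c)) \<le> (norm \<phi> * (2 * norm q)) / norm c"
          unfolding eventually_at_infinity by blast
      qed
    qed
    then have "r 0 = 0" by (intro cdual_separates) (simp add: cdual_apply_zero_right)
    then show False using r(2)[of 0] q(2) by simp
  qed
  then show thesis using that by blast
qed

text \<open>The support idempotent of \<open>a\<close>: regularity turns every nonzero element into
  a nonzero idempotent.\<close>

lemma regular_support:
  fixes a :: "'a::comm_ring"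
  assumes "\<And>a::'a. \<exists>z. a = a * a * z"
  obtains z where "(a * z) * (a * z) = a * z" "(a * z) * a = a"
proof -
  obtain z where z: "a = a * a * z" using assms by blast
  have 1: "(a * z) * a = a" using z by (simp add: ac_simps)
  have "(a * z) * (a * z) = ((a * z) * a) * z" by (simp only: mult.assoc)
  then have "(a * z) * (a * z) = a * z" unfolding 1 .
  then show thesis using 1 by (rule that)
qed

lemma norm_idempotent_ge_1:
  fixes e :: "'a::complex_normed_algebra"
  assumes "e * e = e" "e \<noteq> 0"
  shows "1 \<le> norm e"
  using norm_mult_le[of e e] assms by simp

text \<open>For a = sum of c_n e_n, orthogonality gives e_k a = c_k e_k. Regularity of a then forces
  e_k = c_k e_k z, and the decay of c_k makes norm z at least 2^k for every k.\<close>

lemma regular_no_orthogonal_idempotents: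
  fixes e :: "nat \<Rightarrow> 'a::{complex_banach_algebra, comm_ring}"
  assumes reg: "\<And>a::'a. \<exists>z. a = a * a * z"
    and idem: "\<And>n. e n * e n = e n" and nz: "\<And>n. e n \<noteq> 0"
    and orth: "\<And>m n. m < n \<Longrightarrow> e m * e n = 0"
  shows False
proof -
  define c where "c n = (1/2) ^ n / norm (e n)" for n
  have c: "c n > 0" for n using nz[of n] by (simp add: c_def)
  define a where "a = (\<Sum>n. c n *\<^sub>R e n)"
  have "norm (c n *\<^sub>R e n) = (1/2) ^ n" for n
    using nz[of n] by (simp add: c_def)
  then have "summable (\<lambda>n. norm (c n *\<^sub>R e n))"
    using summable_geometric[of "1/2::real"] by (simp only:) simp
  then have sum: "summable (\<lambda>n. c n *\<^sub>R e n)" by (rule summable_norm_cancel)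
  have ea: "e k * a = c k *\<^sub>R e k" for k
  proof -
    have "e k * (c n *\<^sub>R e n) = (if n = k then c k *\<^sub>R e k else 0)" for n
      using orth[of k n] orth[of n k] idem[of k] by (cases n k rule: linorder_cases) (auto simp: mult.commute)
    then have "(\<lambda>n. e k * (c n *\<^sub>R e n)) sums (c k *\<^sub>R e k)"
      using sums_single[of k "\<lambda>_. c k *\<^sub>R e k"] by simp
    moreover have "(\<lambda>n. e k * (c n *\<^sub>R e n)) sums (e k * a)"
      unfolding a_def by (intro sums_mult summable_sums sum)
    ultimately show ?thesis by (rule sums_unique2[symmetric])
  qed
  obtain z where z: "a = a * a * z" using reg by blast
  have "2 ^ k \<le> norm z" for k
  proof -
    have "e k * a = (e k * a) * (a * z)" using z by (metis mult.assoc)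
    also have "\<dots> = c k *\<^sub>R ((e k * a) * z)" unfolding ea[of k] by (simp add: mult.assoc[symmetric] ea)
    also have "\<dots> = c k *\<^sub>R (c k *\<^sub>R (e k * z))" unfolding ea[of k] by simp
    finally have "e k = c k *\<^sub>R (e k * z)"
      using c[of k] unfolding ea scaleR_cancel_left by simp
    then have "norm (e k) \<le> c k * (norm (e k) * norm z)"
      using norm_mult_le[of "e k" z] c[of k] by (metis abs_of_pos less_imp_le mult_left_mono norm_scaleR)
    also have "\<dots> = (1/2) ^ k * norm z" using nz[of k] by (simp add: c_def)
    finally have "1 \<le> (1/2) ^ k * norm z" using norm_idempotent_ge_1[OF idem nz, of k] by linarith
    then show ?thesis by (simp add: power_divide field_simps)
  qed
  moreover obtain k where "norm z < 2 ^ k" using real_arch_pow[of 2 "norm z"] by auto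
  ultimately show False by (meson not_less)
qed

text \<open>Otherwise there is an infinite strictly decreasing sequence of idempotents below e, and
  its consecutive differences are nonzero and orthogonal.\<close>

lemma regular_minimal_idempotent:
  fixes e :: "'a::{complex_banach_algebra, comm_ring}"
  assumes reg: "\<And>a::'a. \<exists>z. a = a * a * z" and e: "e * e = e" "e \<noteq> 0"
  obtains q where "q * q = q" "q \<noteq> 0" "q * e = q" "\<And>f. f * f = f \<Longrightarrow> f * q = f \<Longrightarrow> f \<noteq> 0 \<Longrightarrow> f = q"
proof (rule ccontr)
  assume no: "\<not> thesis"
  note minimal = that
  define P where "P f \<longleftrightarrow> f * f = f \<and> f \<noteq> 0 \<and> f * e = f" for f
  have "\<exists>f'. P f' \<and> (f' * f = f' \<and> f' \<noteq> f)" if Pf: "P f" for f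
  proof -
    have "\<exists>f'. f' * f' = f' \<and> f' * f = f' \<and> f' \<noteq> 0 \<and> f' \<noteq> f"
    proof (rule ccontr)
      assume *: "\<not> ?thesis"
      have thesis
      proof (rule minimal)
        show "f * f = f" "f \<noteq> 0" "f * e = f" using Pf by (simp_all add: P_def)
        show "f' = f" if "f' * f' = f'" "f' * f = f'" "f' \<noteq> 0" for f' using * that by blast
      qed
      with no show False by blast
    qed
    then obtain f' where f': "f' * f' = f'" "f' * f = f'" "f' \<noteq> 0" "f' \<noteq> f" by blast
    moreover have "f' * e = f'"
      using f'(2) Pf unfolding P_def by (metis mult.assoc)
    ultimately show ?thesis by (auto simp: P_def)
  qed
  moreover have "P e" using e by (simp add: P_def)
  ultimately obtain f where f: "\<And>n. P (f n)" "\<And>n. f (Suc n) * f n = f (Suc n) \<and> f (Suc n) \<noteq> f n"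
    using dependent_nat_choice[of "\<lambda>_. P" "\<lambda>_ f f'. f' * f = f' \<and> f' \<noteq> f"] by metis
  have idem: "f n * f n = f n" for n using f(1) by (simp add: P_def)
  have le: "f n * f m = f n" if "m \<le> n" for m n
    using that
  proof (induction n rule: dec_induct)
    case (step n)
    then show ?case using f(2)[of n] by (metis mult.assoc)
  qed (rule idem)
  show False
  proof (rule regular_no_orthogonal_idempotents[OF reg])
    show "(f n - f (Suc n)) * (f n - f (Suc n)) = f n - f (Suc n)" for n
      using le[of n "Suc n"] by (simp add: algebra_simps idem)
    show "f n - f (Suc n) \<noteq> 0" for n using f(2)[of n] by auto
    show "(f m - f (Suc m)) * (f n - f (Suc n)) = 0" if "m < n" for m n
      using le[of m n] le[of "Suc m" n] le[of m "Suc n"] le[of "Suc m" "Suc n"] that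
      by (simp add: algebra_simps)
  qed
qed

text \<open>Idempotents p with finite-dimensional p A are enlarged by orthogonal minimal
  idempotents. If this never exhausted the algebra, it would produce a forbidden orthogonal
  sequence.\<close>

lemma regular_imp_finite_dimensional:
  assumes reg: "\<And>a::'a::{complex_banach_algebra, comm_ring}. \<exists>z. a = a * a * z"
  shows "finite_dimensional TYPE('a)"
proof (rule ccontr)
  assume inf: "\<not> ?thesis"
  define P where "P p \<longleftrightarrow> p * p = p \<and> (\<exists>B. finite B \<and> (\<forall>x. p * x \<in> complex_vector.span B))" for p :: 'a
  define R where "R p p' \<longleftrightarrow> (\<exists>q. q * q = q \<and> q \<noteq> 0 \<and> q * p = 0 \<and> p' = p + q)" for p p' :: 'a
  have "\<exists>p'. P p' \<and> R p p'" if Pp: "P p" for p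
  proof -
    obtain B where p: "p * p = p" and B: "finite B" "\<And>x. p * x \<in> complex_vector.span B"
      using Pp unfolding P_def by blast
    have "\<exists>a. a - p * a \<noteq> 0"
    proof (rule ccontr)
      assume "\<not> ?thesis"
      then have "p * x = x" for x by auto
      then have "complex_vector.span B = UNIV" using B(2) by (metis UNIV_eq_I)
      then show False using inf B(1) unfolding finite_dimensional_def by blast
    qed
    then obtain a where a: "a - p * a \<noteq> 0" by blast
    define w where "w = a - p * a"
    obtain z where z: "(w * z) * (w * z) = w * z" "(w * z) * w = w"
      using regular_support[OF reg, of w] by blast
    have "w * z \<noteq> 0" using z(2) a by (auto simp: w_def)
    then obtain q where q: "q * q = q" "q \<noteq> 0" "q * (w * z) = q"
      and min: "\<And>f. f * f = f \<Longrightarrow> f * q = f \<Longrightarrow> f \<noteq> 0 \<Longrightarrow> f = q"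
      using regular_minimal_idempotent[OF reg z(1)] by metis
    have "p * w = 0" by (simp add: w_def right_diff_distrib mult.assoc[symmetric] p)
    \<comment> \<open>q lies below the support \<open>w * z\<close>, and p annihilates w.\<close>
    then have qp: "q * p = 0" using q(3) by (metis mult.assoc mult.commute mult_zero_right)
    have "q * x \<in> complex_vector.span (insert q B)" for x
    proof -
      obtain c where "q * x = c *\<^sub>C q"
      proof (rule Gelfand_Mazur_corner[OF q(1,2)])
        show "q * (q * x) = q * x" by (simp add: mult.assoc[symmetric] q(1))
        fix y assume y: "q * y = y" "y \<noteq> 0"
        obtain s where s: "(y * s) * (y * s) = y * s" "(y * s) * y = y"
          using regular_support[OF reg, of y] by blast
        \<comment> \<open>Minimality identifies the support of y with q, so \<open>q * s\<close>
          inverts y in the corner.\<close>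
        have "y * s = q"
        proof (rule min[OF s(1)])
          show "(y * s) * q = y * s" using y(1) by (metis mult.assoc mult.commute)
          show "y * s \<noteq> 0" using s(2) y(2) by auto
        qed
        then have "q * (q * s) = q * s \<and> y * (q * s) = q"
          using y(1) q(1) by (metis mult.assoc mult.commute)
        then show "\<exists>r. q * r = r \<and> y * r = q" by blast
      qed
      then show ?thesis by (simp add: complex_vector.span_scale complex_vector.span_base)
    qed
    moreover have "p * x \<in> complex_vector.span (insert q B)" for x
      using B(2)[of x] complex_vector.span_mono[of B "insert q B"] by blast
    ultimately have "(p + q) * x \<in> complex_vector.span (insert q B)" for x
      unfolding distrib_right by (intro complex_vector.span_add)
    moreover have "(p + q) * (p + q) = p + q"
      using qp p q(1) by (simp add: distrib_left distrib_right mult.commute[of p q])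
    ultimately have "P (p + q)" using B(1) unfolding P_def by (metis finite.insertI)
    moreover have "R p (p + q)" using q qp unfolding R_def by blast
    ultimately show ?thesis by blast
  qed
  moreover have "P 0" unfolding P_def by (auto intro!: exI[of _ "{}"] simp: complex_vector.span_zero)
  ultimately obtain p where "\<And>n. R (p n) (p (Suc n))"
    using dependent_nat_choice[of "\<lambda>_. P" "\<lambda>_. R"] by metis
  then obtain q where q: "\<And>n. q n * q n = q n" "\<And>n. q n \<noteq> 0" "\<And>n. q n * p n = 0"
    and p: "\<And>n. p (Suc n) = p n + q n" unfolding R_def by metis
  \<comment> \<open>p contains \<open>q m\<close> from index \<open>Suc m\<close> on, whereas
    \<open>q n\<close> is orthogonal to \<open>p n\<close>.\<close>
  have le: "q m * p n = q m" if "Suc m \<le> n" for m n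
    using that
  proof (induction n rule: dec_induct)
    case base
    show ?case by (simp add: p distrib_left q)
  next
    case (step n)
    have "q m * q n = (q n * p n) * q m" using step by (metis mult.assoc mult.commute)
    then show ?case using step by (simp add: p distrib_left q)
  qed
  show False
  proof (rule regular_no_orthogonal_idempotents[OF reg q(1,2)])
    show "q m * q n = 0" if "m < n" for m n
      using le[of m n] q(3)[of n] that by (metis Suc_leI mult.assoc mult.commute mult_zero_right)
  qed
qed

section \<open>The finite-dimensional case\<close>

lemma bidual_embed_add: "bidual_embed (x + y) = bidual_embed x + bidual_embed y"
  by (rule cdual_eqI) (simp add: cdual_apply_bidual_embed cdual_apply_simps cdual_apply_add)

lemma bidual_embed_scaleC: "bidual_embed (c *\<^sub>C x) = c *\<^sub>C bidual_embed x"
  by (rule cdual_eqI) (simp add: cdual_apply_bidual_embed cdual_apply_simps cdual_apply_scaleC)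

text \<open>X is a linear combination of the evaluations at J. The induction subtracts from X the
  multiple of the evaluation at v dictated by a functional that vanishes on J but not at v.\<close>

lemma bidual_embed_if_finitely_determined:
  assumes "finite J"
    and "\<And>f. (\<And>v. v \<in> J \<Longrightarrow> cdual_apply f v = 0) \<Longrightarrow> cdual_apply X f = 0"
  shows "X \<in> range bidual_embed"
  using assms
proof (induction J arbitrary: X rule: finite_induct)
  case empty
  have "X = bidual_embed 0"
    by (rule cdual_eqI) (subst empty, simp_all add: cdual_apply_bidual_embed cdual_apply_zero_right)
  then show ?case by blast
next
  case (insert v J)
  show ?case
  proof (cases "\<exists>f. (\<forall>w\<in>J. cdual_apply f w = 0) \<and> cdual_apply f v \<noteq> 0")
    case True
    then obtain f where f: "\<And>w. w \<in> J \<Longrightarrow> cdual_apply f w = 0" "cdual_apply f v \<noteq> 0" by blast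
    define c where "c = cdual_apply X f / cdual_apply f v"
    have "X - c *\<^sub>C bidual_embed v \<in> range bidual_embed"
    proof (rule insert.IH)
      fix g assume g: "\<And>w. w \<in> J \<Longrightarrow> cdual_apply g w = 0"
      have "cdual_apply X (g - (cdual_apply g v / cdual_apply f v) *\<^sub>C f) = 0"
        using f g by (intro insert.prems) (auto simp: cdual_apply_diff cdual_apply_simps)
      then show "cdual_apply (X - c *\<^sub>C bidual_embed v) g = 0"
        using f(2) by (simp add: cdual_apply_diff cdual_apply_diff_right cdual_apply_simps cdual_apply_scaleC
          cdual_apply_bidual_embed c_def)
    qed
    then obtain w where "X - c *\<^sub>C bidual_embed v = bidual_embed w" by blast
    then have "X = bidual_embed (w + c *\<^sub>C v)"
      by (simp add: bidual_embed_add bidual_embed_scaleC algebra_simps)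
    then show ?thesis by blast
  next
    case False
    then show ?thesis by (intro insert.IH insert.prems) blast
  qed
qed

text \<open>By bilinearity a functional is determined on tensors of a finite spanning set, so the
  whole bidual consists of evaluations, and these lie in the topological centre.\<close>

lemma finite_dimensional_imp_strongly_Arens_irregular:
  assumes "finite_dimensional TYPE('a::complex_banach_algebra)"
  shows "strongly_Arens_irregular TYPE(('a, 'a) proj_tensor)"
proof -
  obtain B :: "'a set" where B: "finite B" "complex_vector.span B = UNIV"
    using assms unfolding finite_dimensional_def by blast
  define J where "J = (\<lambda>(x, y). ptensor x y) ` (B \<times> B)"
  have "X \<in> range bidual_embed" for X :: "('a, 'a) proj_tensor cdual cdual"
  proof (rule bidual_embed_if_finitely_determined)
    show "finite J" using B(1) by (simp add: J_def)
    fix f assume f: "\<And>v. v \<in> J \<Longrightarrow> cdual_apply f v = 0"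
    have zero: "ptensor x 0 = 0" "ptensor 0 x = 0" for x :: 'a
      using ptensor_simps(3)[of 0 0 x] ptensor_simps(4)[of x 0 0]
      by (simp_all add: complex_vector.scale_zero_left)
    have base: "cdual_apply f (ptensor x y) = 0" if "x \<in> B" for x y
    proof -
      have "y \<in> complex_vector.span B" using B(2) by simp
      then show ?thesis
        by (induction rule: complex_vector.span_induct_alt)
          (use f that in \<open>auto simp: J_def ptensor_simps cdual_apply_add cdual_apply_scaleC
            cdual_apply_zero_right zero\<close>)
    qed
    have "cdual_apply f (ptensor x y) = 0" for x y
    proof -
      have "x \<in> complex_vector.span B" using B(2) by simp
      then show ?thesis
        by (induction rule: complex_vector.span_induct_alt)
          (auto simp: base ptensor_simps cdual_apply_add cdual_apply_scaleC cdual_apply_zero_right zero)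
    qed
    then have "f = 0" by (intro cdual_proj_tensor_eqI) (simp add: zero_cdual.rep_eq cdual_apply.rep_eq)
    then show "cdual_apply X f = 0" by (simp add: cdual_apply_zero_right)
  qed
  then show ?thesis
    unfolding strongly_Arens_irregular_def using bidual_embed_in_topological_centre by blast
qed

theorem corollary3p3:
  shows "strongly_Arens_irregular TYPE('a::commutative_cstar_algebra varopoulos)
    \<longleftrightarrow> finite_dimensional TYPE('a)"
  using regular_imp_finite_dimensional[OF strongly_Arens_irregular_regular]
    finite_dimensional_imp_strongly_Arens_irregular by blast

end
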